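(* Let $C^{\mathrm{obs}}\in\mathrm{HS}(L^2(\mathbb{M}))$ be self-adjoint. Then the DAMAS problem of finding $q\in L^2(\Omega)$ with $$\mathcal{I}(\mathbf{y})=\int_\Omega\psi(\mathbf{y},\mathbf{y}')\,q(\mathbf{y}')\,d\mathbf{y}'\qquad(\mathbf{y}\in\Omega)$$ is equivalent to the operator equation $$\mathcal{C}^*\mathcal{C}(q)=\mathcal{C}^*C^{\mathrm{obs}},$$ which is the normal equation of the least squares problem $\|\mathcal{C}(q)-C^{\mathrm{obs}}\|_{\mathrm{HS}}^2=\min!$. That is, $q$ satisfies the integral equation if and only if it satisfies the operator equation.
   Context: Let $d\in\{2,3\}$. Let $\Omega\subset\mathbb{R}^d$ be a bounded, open domain with $\mathbf{0}\in\Omega$ such that $\mathbb{R}^d\setminus\overline{\Omega}$ is connected, and let $\mathbb{M}\subset\mathbb{R}^d\setminus\overline{\Omega}$ be a bounded, open domain. Let $k>0$ be the wavenumber and let $\mathbf{m}\in\mathbb{R}^d$ be the Mach vector, with $|\mathbf{m}|<1$. Put $\beta:=\sqrt{1-|\mathbf{m}|^2}$ and $|\mathbf{x}|_{\mathbf{m}}:=\sqrt{(\mathbf{x}\cdot\mathbf{m})^2+\beta^2|\mathbf{x}|^2}$ for $\mathbf{x}\in\mathbb{R}^d$. The free field Green's function of the convected Helmholtz equation $(k+i\mathbf{m}\cdot\nabla)^2p+\Delta p=-Q$ is, for $\mathbf{x}\neq\mathbf{y}$, $$g(\mathbf{x},\mathbf{y})=\frac{\exp\left(\frac{ik}{\beta^2}\left(-(\mathbf{x}-\mathbf{y})\cdot\mathbf{m}+|\mathbf{x}-\mathbf{y}|_{\mathbf{m}}\right)\right)}{4\pi|\mathbf{x}-\mathbf{y}|_{\mathbf{m}}}\quad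 (d=3),$$ $$g(\mathbf{x},\mathbf{y})=\frac{i}{4\beta}\exp\left(-\frac{ik}{\beta^2}(\mathbf{x}-\mathbf{y})\cdot\mathbf{m}\right)H^{(1)}_0\left(\frac{k}{\beta^2}|\mathbf{x}-\mathbf{y}|_{\mathbf{m}}\right)\quad (d=2),$$ where $H^{(1)}_0$ is the Hankel function of the first kind of order $0$. All function spaces are complex. $\mathrm{HS}(L^2(\mathbb{M}))$ is the Hilbert space of Hilbert-Schmidt operators on $L^2(\mathbb{M})$ with inner product $\langle K_1,K_2\rangle_{\mathrm{HS}}:=\mathrm{tr}(K_2^*K_1)$ and norm $\|\cdot\|_{\mathrm{HS}}$. The forward operator $\mathcal{C}:L^2(\Omega)\to\mathrm{HS}(L^2(\mathbb{M}))$ is the linear map sending $q$ to the integral operator $(\mathcal{C}(q)\varphi)(\mathbf{x}_1):=\int_{\mathbb{M}}c_q(\mathbf{x}_1,\mathbf{x}_2)\varphi(\mathbf{x}_2)\,d\mathbf{x}_2$ with kernel $c_q(\mathbf{x}_1,\mathbf{x}_2):=\int_\Omega g(\mathbf{x}_1,\mathbf{y})q(\mathbf{y})\overline{g(\mathbf{x}_2,\mathbf{y})}\,d\mathbf{y}$. $\mathcal{C}^*:\mathrm{HS}(L^2(\mathbb{M}))\to L^2(\Omega)$ is its Hilbert space adjoint, which is given by $(\mathcal{C}^*K)(\mathbf{y})=\langle K,\mathcal{P}_{\mathbf{y}}\rangle_{\mathrm{HS}}$. For $\mathbf{y}\in\Omega$, the monopole operator $\mathcal{P}_{\mathbf{y}}\in\mathrm{HS}(L^2(\mathbb{M}))$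 is $(\mathcal{P}_{\mathbf{y}}\varphi)(\mathbf{x}_1):=\int_{\mathbb{M}}g(\mathbf{x}_1,\mathbf{y})\overline{g(\mathbf{x}_2,\mathbf{y})}\varphi(\mathbf{x}_2)\,d\mathbf{x}_2$. It satisfies $\|\mathcal{P}_{\mathbf{y}}\|_{\mathrm{HS}}^2=\|g(\cdot,\mathbf{y})\|_{L^2(\mathbb{M})}^4>0$. The Beamforming imaging functional is $\mathcal{I}(\mathbf{y}):=\mathrm{argmin}_{\mu\in\mathbb{R}}\|C^{\mathrm{obs}}-\mu\mathcal{P}_{\mathbf{y}}\|_{\mathrm{HS}}^2$, which for self-adjoint $C^{\mathrm{obs}}$ equals $\langle C^{\mathrm{obs}},\mathcal{P}_{\mathbf{y}}\rangle_{\mathrm{HS}}/\|\mathcal{P}_{\mathbf{y}}\|_{\mathrm{HS}}^2$. The point-spread function is $\psi(\mathbf{y},\mathbf{y}'):=\langle\mathcal{P}_{\mathbf{y}},\mathcal{P}_{\mathbf{y}'}\rangle_{\mathrm{HS}}/\|\mathcal{P}_{\mathbf{y}}\|_{\mathrm{HS}}^2$ for $\mathbf{y},\mathbf{y}'\in\Omega$. *)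

theory Defs
  imports "HOL-Analysis.Analysis"
begin

section \<open>The complex Hilbert space of square integrable functions\<close>

text \<open>Elements of the space are represented by functions; equality in the space is equality almost
  everywhere. The inner product is linear in the first argument.\<close>

definition L2 :: "'a measure \<Rightarrow> ('a \<Rightarrow> complex) set" where
  "L2 N = {f \<in> borel_measurable N. integrable N (\<lambda>x. (cmod (f x))\<^sup>2)}"

definition L2_inner :: "'a measure \<Rightarrow> ('a \<Rightarrow> complex) \<Rightarrow> ('a \<Rightarrow> complex) \<Rightarrow> complex" where
  "L2_inner N f h = (LINT x|N. f x * cnj (h x))"

definition L2_norm :: "'a measure \<Rightarrow> ('a \<Rightarrow> complex) \<Rightarrow> real" where
  "L2_norm N f = sqrt (Re (L2_inner N f f))"

text \<open>Orthonormal bases are the maximal orthonormal sets. Different members of \<open>B\<close> are orthogonal,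
  so \<open>B\<close> contains at most one representative of each class.\<close>

definition L2_onb :: "'a measure \<Rightarrow> ('a \<Rightarrow> complex) set \<Rightarrow> bool" where
  "L2_onb N B \<longleftrightarrow> B \<subseteq> L2 N \<and>
     (\<forall>e\<in>B. \<forall>f\<in>B. L2_inner N e f = (if e = f then 1 else 0)) \<and>
     (\<forall>h\<in>L2 N. (\<forall>e\<in>B. L2_inner N h e = 0) \<longrightarrow> (AE x in N. h x = 0))"

definition L2_basis :: "'a measure \<Rightarrow> ('a \<Rightarrow> complex) set" where
  "L2_basis N = (SOME B. L2_onb N B)"


section \<open>Bounded and Hilbert-Schmidt operators\<close>

type_synonym 'a operator = "('a \<Rightarrow> complex) \<Rightarrow> ('a \<Rightarrow> complex)"

text \<open>Linearity and boundedness together imply that \<open>K\<close> respects equality almost everywhere, so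
  that it acts on equivalence classes.\<close>

definition L2_operator :: "'a measure \<Rightarrow> 'a operator \<Rightarrow> bool" where
  "L2_operator N K \<longleftrightarrow>
     (\<forall>f\<in>L2 N. K f \<in> L2 N) \<and>
     (\<forall>f\<in>L2 N. \<forall>h\<in>L2 N. AE x in N. K (\<lambda>z. f z + h z) x = K f x + K h x) \<and>
     (\<forall>c. \<forall>f\<in>L2 N. AE x in N. K (\<lambda>z. c * f z) x = c * K f x) \<and>
     (\<exists>b. \<forall>f\<in>L2 N. L2_norm N (K f) \<le> b * L2_norm N f)"

definition self_adjoint :: "'a measure \<Rightarrow> 'a operator \<Rightarrow> bool" where
  "self_adjoint N K \<longleftrightarrow> (\<forall>f\<in>L2 N. \<forall>h\<in>L2 N. L2_inner N (K f) h = L2_inner N f (K h))"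

definition op_adjoint :: "'a measure \<Rightarrow> 'a operator \<Rightarrow> 'a operator" where
  "op_adjoint N K = (SOME A. L2_operator N A \<and>
     (\<forall>f\<in>L2 N. \<forall>h\<in>L2 N. L2_inner N (K f) h = L2_inner N f (A h)))"

text \<open>Neither the trace (of a product of two Hilbert-Schmidt operators) nor the Hilbert-Schmidt
  property depends on the orthonormal basis.\<close>

definition op_trace :: "'a measure \<Rightarrow> 'a operator \<Rightarrow> complex" where
  "op_trace N T = (\<Sum>\<^sub>\<infinity>e\<in>L2_basis N. L2_inner N (T e) e)"

definition HS :: "'a measure \<Rightarrow> 'a operator set" where
  "HS N = {K. L2_operator N K \<and> (\<lambda>e. (L2_norm N (K e))\<^sup>2) summable_on L2_basis N}"

definition HS_inner :: "'a measure \<Rightarrow> 'a operator \<Rightarrow> 'a operator \<Rightarrow> complex" where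
  "HS_inner N K\<^sub>1 K\<^sub>2 = op_trace N (op_adjoint N K\<^sub>2 \<circ> K\<^sub>1)"

definition HS_norm :: "'a measure \<Rightarrow> 'a operator \<Rightarrow> real" where
  "HS_norm N K = sqrt (Re (HS_inner N K K))"


section \<open>Green's function of the convected Helmholtz equation\<close>

text \<open>Power series of the Bessel functions of order zero, for positive argument
  (\<open>harm n\<close> is the \<open>n\<close>-th harmonic number), and the Hankel function of the first kind.\<close>

definition bessel_J0 :: "real \<Rightarrow> real" where
  "bessel_J0 t = (\<Sum>n. (-1) ^ n / (fact n)\<^sup>2 * (t / 2) ^ (2 * n))"

definition bessel_Y0 :: "real \<Rightarrow> real" where
  "bessel_Y0 t = 2 / pi * (ln (t / 2) + euler_mascheroni) * bessel_J0 t
     - 2 / pi * (\<Sum>n. (-1) ^ n * harm n / (fact n)\<^sup>2 * (t / 2) ^ (2 * n))"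

definition hankel1_0 :: "real \<Rightarrow> complex" where
  "hankel1_0 t = of_real (bessel_J0 t) + \<i> * of_real (bessel_Y0 t)"

definition mach_beta :: "real^'n \<Rightarrow> real" where
  "mach_beta m = sqrt (1 - (norm m)\<^sup>2)"

definition mach_norm :: "real^'n \<Rightarrow> real^'n \<Rightarrow> real" where
  "mach_norm m x = sqrt ((x \<bullet> m)\<^sup>2 + (mach_beta m)\<^sup>2 * (norm x)\<^sup>2)"

text \<open>Only meaningful for \<open>CARD('n) \<in> {2, 3}\<close>; the last branch is the two-dimensional case.\<close>

definition green :: "real \<Rightarrow> real^'n \<Rightarrow> real^'n \<Rightarrow> real^'n \<Rightarrow> complex" where
  "green k m x y =
     (if CARD('n) = 3
      then exp (\<i> * of_real (k / (mach_beta m)\<^sup>2 * (- ((x - y) \<bullet> m) + mach_norm m (x - y))))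
           / of_real (4 * pi * mach_norm m (x - y))
      else \<i> / of_real (4 * mach_beta m)
           * exp (- (\<i> * of_real (k / (mach_beta m)\<^sup>2 * ((x - y) \<bullet> m))))
           * hankel1_0 (k / (mach_beta m)\<^sup>2 * mach_norm m (x - y)))"


section \<open>Forward operator, monopoles, beamforming\<close>

text \<open>\<open>\<Omega>\<close> is the source region and \<open>M\<close> the measurement region.\<close>

definition forward_kernel ::
  "real \<Rightarrow> real^'n \<Rightarrow> (real^'n) set \<Rightarrow> (real^'n \<Rightarrow> complex) \<Rightarrow> real^'n \<Rightarrow> real^'n \<Rightarrow> complex" where
  "forward_kernel k m \<Omega> q x\<^sub>1 x\<^sub>2 =
     (LINT y|lebesgue_on \<Omega>. green k m x\<^sub>1 y * q y * cnj (green k m x\<^sub>2 y))"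

definition forward ::
  "real \<Rightarrow> real^'n \<Rightarrow> (real^'n) set \<Rightarrow> (real^'n) set \<Rightarrow> (real^'n \<Rightarrow> complex) \<Rightarrow> (real^'n) operator" where
  "forward k m \<Omega> M q \<phi> x\<^sub>1 = (LINT x\<^sub>2|lebesgue_on M. forward_kernel k m \<Omega> q x\<^sub>1 x\<^sub>2 * \<phi> x\<^sub>2)"

text \<open>The Hilbert space adjoint of the forward operator, determined almost everywhere.\<close>

definition forward_adjoint ::
  "real \<Rightarrow> real^'n \<Rightarrow> (real^'n) set \<Rightarrow> (real^'n) set \<Rightarrow> (real^'n) operator \<Rightarrow> real^'n \<Rightarrow> complex" where
  "forward_adjoint k m \<Omega> M K = (SOME f. f \<in> L2 (lebesgue_on \<Omega>) \<and>
     (\<forall>q\<in>L2 (lebesgue_on \<Omega>).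
        HS_inner (lebesgue_on M) (forward k m \<Omega> M q) K = L2_inner (lebesgue_on \<Omega>) q f))"

definition monopole :: "real \<Rightarrow> real^'n \<Rightarrow> (real^'n) set \<Rightarrow> real^'n \<Rightarrow> (real^'n) operator" where
  "monopole k m M y \<phi> x\<^sub>1 =
     (LINT x\<^sub>2|lebesgue_on M. green k m x\<^sub>1 y * cnj (green k m x\<^sub>2 y) * \<phi> x\<^sub>2)"

definition beamforming ::
  "real \<Rightarrow> real^'n \<Rightarrow> (real^'n) set \<Rightarrow> (real^'n) operator \<Rightarrow> real^'n \<Rightarrow> real" where
  "beamforming k m M C y = (ARG_MIN (\<lambda>\<mu>::real.
     (HS_norm (lebesgue_on M) (\<lambda>\<phi> x. C \<phi> x - of_real \<mu> * monopole k m M y \<phi> x))\<^sup>2) \<mu>. True)"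

definition psf ::
  "real \<Rightarrow> real^'n \<Rightarrow> (real^'n) set \<Rightarrow> real^'n \<Rightarrow> real^'n \<Rightarrow> complex" where
  "psf k m M y y' =
     HS_inner (lebesgue_on M) (monopole k m M y) (monopole k m M y')
     / of_real ((HS_norm (lebesgue_on M) (monopole k m M y))\<^sup>2)"

end

theory Submission
  imports Defs "HOL-Complex_Analysis.Conformal_Mappings"
begin

text \<open>The monopole operator is the rank-one operator of the column \<open>g\<^sub>y = g(\<cdot>, y)\<close>, so Parseval's identity
  gives \<open>\<langle>K, P\<^sub>y\<rangle> = \<langle>K g\<^sub>y, g\<^sub>y\<rangle>\<close> for every Hilbert-Schmidt operator \<open>K\<close>, and the adjoint of the forward
  operator is \<open>K \<mapsto> (y \<mapsto> \<langle>K g\<^sub>y, g\<^sub>y\<rangle>)\<close>. After multiplication with \<open>\<parallel>g\<^sub>y\<parallel>\<^sup>4\<close>, the two sides of the DAMAS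
  equation are this function for the observed operator and for the forward operator at \<open>q\<close>; the
  integral equation and the normal equation thus only differ by an exceptional null set, which is
  empty because \<open>y \<mapsto> g\<^sub>y\<close> is continuous into the square integrable functions. The closures of the two
  regions may touch; since the singularity of Green's function is square integrable, the columns
  are nevertheless uniformly bounded in norm, which makes the forward operator bounded.\<close>

section \<open>Square integrable functions\<close>

text \<open>Two choices by \<open>SOME\<close> shape the development. \<open>op_adjoint\<close> is
  meaningful only where an adjoint exists, so \<open>has_adjoint\<close> is carried along and
  established by explicit adjoints: that of \<open>source q\<close> is \<open>source\<close> at the
  conjugate of \<open>q\<close>, while rank-one operators and the observed operator are their own.
  \<open>forward_adjoint\<close> is fixed only almost everywhere, whereas the DAMAS equation is
  demanded at every point; \<open>beam K\<close> is the everywhere defined representative that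
  mediates. The basis is just some maximal orthonormal set, so series are limits along the net of
  its finite subsets, to which dominated convergence does not apply; uniform tail estimates take its
  place. Division by the fourth power of a column norm requires that no column vanishes. In
  dimension 3 the exponential settles this; in dimension 2 zeros of the Hankel function on an
  interval are excluded by the identity theorem for its real part \<open>bessel_J0\<close>. Both
  dimensions share the bound \<open>|g|^2 <= C / |x - y|^(d-1)\<close>: the exact order for
  \<open>d = 3\<close>, a generous majorant of the squared logarithm for \<open>d = 2\<close>. The
  exponent is below \<open>d\<close>, hence integrable.\<close>

lemma L2_measurable [measurable_dest]: "f \<in> L2 N \<Longrightarrow> f \<in> borel_measurable N"
  and L2_integrable_norm2: "f \<in> L2 N \<Longrightarrow> integrable N (\<lambda>x. (cmod (f x))\<^sup>2)"
  by (auto simp: L2_def)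

lemma borel_measurable_cnj [measurable (raw)]:
  "f \<in> borel_measurable N \<Longrightarrow> (\<lambda>x. cnj (f x)) \<in> borel_measurable N"
  by (rule borel_measurable_continuous_on[where f = cnj]) (auto intro: continuous_intros)

lemma norm_mult_le_sum_squares: "norm (a * b) \<le> (norm a)\<^sup>2 + (norm (b :: complex))\<^sup>2"
  using sum_squares_bound[of "norm a" "norm b"] zero_le_power2[of "norm a"] zero_le_power2[of "norm b"]
    mult_nonneg_nonneg[OF norm_ge_zero norm_ge_zero, of a b]
  unfolding norm_mult by linarith

lemma L2_mult_integrable:
  assumes "f \<in> L2 N" "h \<in> L2 N"
  shows "integrable N (\<lambda>x. f x * cnj (h x))" "integrable N (\<lambda>x. cmod (f x) * cmod (h x))"
proof -
  have [measurable]: "f \<in> borel_measurable N" "h \<in> borel_measurable N"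
    using assms by (auto intro: L2_measurable)
  have i: "integrable N (\<lambda>x. (cmod (f x))\<^sup>2 + (cmod (h x))\<^sup>2)"
    using assms by (intro Bochner_Integration.integrable_add L2_integrable_norm2)
  show "integrable N (\<lambda>x. f x * cnj (h x))"
    by (rule Bochner_Integration.integrable_bound[OF i])
       (use norm_mult_le_sum_squares in \<open>auto simp: norm_mult\<close>)
  show "integrable N (\<lambda>x. cmod (f x) * cmod (h x))"
    by (rule Bochner_Integration.integrable_bound[OF i])
       (use norm_mult_le_sum_squares in \<open>auto simp: norm_mult\<close>)
qed

lemma L2_zero: "(\<lambda>x. 0) \<in> L2 N"
  by (auto simp: L2_def)

lemma L2_add:
  assumes "f \<in> L2 N" "h \<in> L2 N"
  shows "(\<lambda>x. f x + h x) \<in> L2 N"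
proof -
  have [measurable]: "f \<in> borel_measurable N" "h \<in> borel_measurable N"
    using assms by (auto intro: L2_measurable)
  have "integrable N (\<lambda>x. (cmod (f x + h x))\<^sup>2)"
  proof (rule Bochner_Integration.integrable_bound)
    show "integrable N (\<lambda>x. 2 * (cmod (f x))\<^sup>2 + 2 * (cmod (h x))\<^sup>2)"
      using assms by (intro Bochner_Integration.integrable_add integrable_mult_right L2_integrable_norm2)
    have "(cmod (a + b))\<^sup>2 \<le> 2 * (cmod a)\<^sup>2 + 2 * (cmod b)\<^sup>2" for a b
    proof -
      have "(cmod (a + b))\<^sup>2 \<le> (cmod a + cmod b)\<^sup>2"
        by (intro power_mono norm_triangle_ineq) auto
      also have "\<dots> \<le> 2 * (cmod a)\<^sup>2 + 2 * (cmod b)\<^sup>2"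
        using sum_squares_bound[of "cmod a" "cmod b"] by (simp add: power2_sum)
      finally show ?thesis .
    qed
    then show "AE x in N. norm ((cmod (f x + h x))\<^sup>2) \<le> norm (2 * (cmod (f x))\<^sup>2 + 2 * (cmod (h x))\<^sup>2)"
      by auto
  qed measurable
  then show ?thesis by (auto simp: L2_def)
qed

lemma L2_scale: "f \<in> L2 N \<Longrightarrow> (\<lambda>x. c * f x) \<in> L2 N"
  by (auto simp: L2_def norm_mult power_mult_distrib)

lemma L2_diff: "f \<in> L2 N \<Longrightarrow> h \<in> L2 N \<Longrightarrow> (\<lambda>x. f x - h x) \<in> L2 N"
  using L2_add[of f N "\<lambda>x. -1 * h x"] L2_scale[of h N "-1"] by simp

lemma L2_cnj: "f \<in> L2 N \<Longrightarrow> (\<lambda>x. cnj (f x)) \<in> L2 N"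
  by (auto simp: L2_def)

lemma L2_sum: "(\<And>i. i \<in> I \<Longrightarrow> f i \<in> L2 N) \<Longrightarrow> (\<lambda>x. \<Sum>i\<in>I. f i x) \<in> L2 N"
  by (induction I rule: infinite_finite_induct) (auto intro: L2_add L2_zero)

lemma (in finite_measure) L2_boundedI:
  assumes "f \<in> borel_measurable M" "\<And>x. x \<in> space M \<Longrightarrow> cmod (f x) \<le> b"
  shows "f \<in> L2 M"
proof -
  have "integrable M (\<lambda>x. (cmod (f x))\<^sup>2)"
  proof (rule integrable_const_bound)
    show "AE x in M. norm ((cmod (f x))\<^sup>2) \<le> b\<^sup>2"
      using assms(2) by (intro AE_I2) (auto intro!: power_mono)
  qed (use assms(1) in measurable)
  then show ?thesis using assms(1) by (auto simp: L2_def)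
qed

lemma (in finite_measure) L2_integrable:
  assumes "f \<in> L2 M"
  shows "integrable M f"
proof (rule Bochner_Integration.integrable_bound)
  show "integrable M (\<lambda>x. (cmod (f x))\<^sup>2 + 1)"
    using assms by (intro Bochner_Integration.integrable_add L2_integrable_norm2) auto
  have "a \<le> a\<^sup>2 + 1" for a :: real
    using zero_le_power2[of "a - 1/2"] by (simp add: power2_diff field_simps)
  then show "AE x in M. norm (f x) \<le> norm ((cmod (f x))\<^sup>2 + 1)"
    by auto
qed (use assms in measurable)

lemma L2_inner_add_left:
  "f \<in> L2 N \<Longrightarrow> g \<in> L2 N \<Longrightarrow> h \<in> L2 N \<Longrightarrow>
     L2_inner N (\<lambda>x. f x + g x) h = L2_inner N f h + L2_inner N g h"
  by (simp add: L2_inner_def distrib_right L2_mult_integrable)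

lemma L2_inner_scale_left: "L2_inner N (\<lambda>x. c * f x) h = c * L2_inner N f h"
  by (simp add: L2_inner_def mult.assoc)

lemma L2_inner_commute: "L2_inner N h f = cnj (L2_inner N f h)"
proof -
  have "cnj (L2_inner N f h) = (LINT x|N. cnj (f x * cnj (h x)))"
    unfolding L2_inner_def by (rule Bochner_Integration.integral_cnj[symmetric])
  then show ?thesis by (simp add: L2_inner_def mult.commute)
qed

lemma L2_inner_diff_left:
  "f \<in> L2 N \<Longrightarrow> g \<in> L2 N \<Longrightarrow> h \<in> L2 N \<Longrightarrow>
     L2_inner N (\<lambda>x. f x - g x) h = L2_inner N f h - L2_inner N g h"
  by (simp add: L2_inner_def left_diff_distrib L2_mult_integrable)

lemma L2_inner_add_right:
  "f \<in> L2 N \<Longrightarrow> g \<in> L2 N \<Longrightarrow> h \<in> L2 N \<Longrightarrow>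
     L2_inner N h (\<lambda>x. f x + g x) = L2_inner N h f + L2_inner N h g"
  by (simp add: L2_inner_def distrib_left L2_mult_integrable)

lemma L2_inner_diff_right:
  "f \<in> L2 N \<Longrightarrow> g \<in> L2 N \<Longrightarrow> h \<in> L2 N \<Longrightarrow>
     L2_inner N h (\<lambda>x. f x - g x) = L2_inner N h f - L2_inner N h g"
  by (simp add: L2_inner_def right_diff_distrib L2_mult_integrable)

lemma L2_inner_scale_right: "L2_inner N f (\<lambda>x. c * h x) = cnj c * L2_inner N f h"
  by (simp add: L2_inner_def mult.left_commute)

lemma L2_inner_sum_left:
  assumes "\<And>i. i \<in> I \<Longrightarrow> f i \<in> L2 N" "h \<in> L2 N"
  shows "L2_inner N (\<lambda>x. \<Sum>i\<in>I. f i x) h = (\<Sum>i\<in>I. L2_inner N (f i) h)"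
  using assms by (simp add: L2_inner_def sum_distrib_right L2_mult_integrable)

lemma L2_inner_cong_AE:
  assumes "f \<in> L2 N" "f' \<in> L2 N" "h \<in> L2 N" "h' \<in> L2 N"
    and "AE x in N. f x = f' x" "AE x in N. h x = h' x"
  shows "L2_inner N f h = L2_inner N f' h'"
proof -
  have [measurable]: "f \<in> borel_measurable N" "h \<in> borel_measurable N"
    "f' \<in> borel_measurable N" "h' \<in> borel_measurable N"
    using assms by (auto intro: L2_measurable)
  have "AE x in N. f x * cnj (h x) = f' x * cnj (h' x)"
    using assms(5,6) by eventually_elim simp
  then show ?thesis unfolding L2_inner_def by (intro integral_cong_AE) measurable
qed

lemma L2_inner_self: "L2_inner N f f = of_real (LINT x|N. (cmod (f x))\<^sup>2)"
  by (simp only: L2_inner_def complex_norm_square[symmetric] integral_complex_of_real)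

lemma L2_norm_square: "(L2_norm N f)\<^sup>2 = (LINT x|N. (cmod (f x))\<^sup>2)"
  by (simp add: L2_norm_def L2_inner_self)

lemma L2_inner_self_norm: "L2_inner N f f = of_real ((L2_norm N f)\<^sup>2)"
  by (simp only: L2_norm_square L2_inner_self)

lemma L2_norm_nonneg: "L2_norm N f \<ge> 0"
  by (simp add: L2_norm_def L2_inner_self)

lemma L2_norm_cong_AE:
  "f \<in> L2 N \<Longrightarrow> f' \<in> L2 N \<Longrightarrow> AE x in N. f x = f' x \<Longrightarrow> L2_norm N f = L2_norm N f'"
  unfolding L2_norm_def using L2_inner_cong_AE[of f N f' f f'] by simp

lemma L2_norm_eq_0_iff:
  assumes "f \<in> L2 N"
  shows "L2_norm N f = 0 \<longleftrightarrow> (AE x in N. f x = 0)"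
proof -
  have "L2_norm N f = 0 \<longleftrightarrow> (LINT x|N. (cmod (f x))\<^sup>2) = 0"
    using L2_norm_square[of N f] by (metis power_zero_numeral zero_eq_power2)
  also have "\<dots> \<longleftrightarrow> (AE x in N. f x = 0)"
    using integral_nonneg_eq_0_iff_AE[OF L2_integrable_norm2[OF assms]] by simp
  finally show ?thesis .
qed

lemma L2_cong_space:
  assumes "\<And>x. x \<in> space N \<Longrightarrow> f x = f' x"
  shows "f \<in> L2 N \<longleftrightarrow> f' \<in> L2 N"
proof -
  have "f \<in> borel_measurable N \<longleftrightarrow> f' \<in> borel_measurable N"
    using assms by (rule measurable_cong)
  moreover have "integrable N (\<lambda>x. (cmod (f x))\<^sup>2) \<longleftrightarrow> integrable N (\<lambda>x. (cmod (f' x))\<^sup>2)"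
    using assms by (intro Bochner_Integration.integrable_cong) auto
  ultimately show ?thesis by (simp add: L2_def)
qed

lemma L2_norm_cong_space:
  assumes "\<And>x. x \<in> space N \<Longrightarrow> f x = f' x"
  shows "L2_norm N f = L2_norm N f'"
  unfolding L2_norm_def L2_inner_self using assms
  by (intro arg_cong[where f = sqrt] arg_cong[where f = Re] arg_cong[where f = of_real]
      Bochner_Integration.integral_cong) auto

section \<open>Cauchy-Schwarz inequality, norm estimates and completeness\<close>

lemma integral_Cauchy_Schwarz:
  fixes u v :: "'a \<Rightarrow> real"
  assumes "integrable N (\<lambda>x. (u x)\<^sup>2)" "integrable N (\<lambda>x. (v x)\<^sup>2)" "integrable N (\<lambda>x. u x * v x)"
  shows "(LINT x|N. u x * v x)\<^sup>2 \<le> (LINT x|N. (u x)\<^sup>2) * (LINT x|N. (v x)\<^sup>2)"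
proof -
  define A B C where "A = (LINT x|N. (u x)\<^sup>2)" and "B = (LINT x|N. u x * v x)" and "C = (LINT x|N. (v x)\<^sup>2)"
  \<comment> \<open>The form is the integral of \<open>(t * u + v)^2\<close>; Cauchy-Schwarz is the
    sign condition on its discriminant.\<close>
  have q: "A * t\<^sup>2 + 2 * B * t + C \<ge> 0" for t
  proof -
    have "0 \<le> (LINT x|N. (t * u x + v x)\<^sup>2)" by simp
    also have "\<dots> = (LINT x|N. t\<^sup>2 * (u x)\<^sup>2 + (2 * t) * (u x * v x) + (v x)\<^sup>2)"
      by (intro Bochner_Integration.integral_cong) (auto simp: power2_eq_square algebra_simps)
    also have "\<dots> = t\<^sup>2 * A + (2 * t) * B + C"
      using assms by (simp add: A_def B_def C_def)
    finally show ?thesis by (simp add: algebra_simps)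
  qed
  have A: "A \<ge> 0" unfolding A_def by simp
  have "B\<^sup>2 \<le> A * C"
  proof (cases "A = 0")
    case True
    have "B = 0"
    proof (rule ccontr)
      assume "B \<noteq> 0"
      \<comment> \<open>With \<open>A = 0\<close> the form is affine in \<open>t\<close>, and this
        \<open>t\<close> gives it the value \<open>-1\<close>.\<close>
      then show False using q[of "- (C + 1) / (2 * B)"] True by simp
    qed
    then show ?thesis using True by simp
  next
    case False
    \<comment> \<open>\<open>t = - B / A\<close> minimises the quadratic.\<close>
    then have "0 \<le> A * (A * (- B / A)\<^sup>2 + 2 * B * (- B / A) + C)"
      using q[of "- B / A"] A by simp
    also have "\<dots> = A * C - B\<^sup>2"
      using False by (simp add: power2_eq_square field_simps)
    finally show ?thesis by simp
  qed
  then show ?thesis by (simp add: A_def B_def C_def)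
qed

lemma L2_Cauchy_Schwarz_norm:
  assumes "f \<in> L2 N" "h \<in> L2 N"
  shows "(LINT x|N. cmod (f x) * cmod (h x)) \<le> L2_norm N f * L2_norm N h"
proof -
  have "(LINT x|N. cmod (f x) * cmod (h x))\<^sup>2 \<le> (L2_norm N f * L2_norm N h)\<^sup>2"
    using integral_Cauchy_Schwarz[of N "\<lambda>x. cmod (f x)" "\<lambda>x. cmod (h x)"] assms
    by (simp add: L2_integrable_norm2 L2_mult_integrable power_mult_distrib L2_norm_square)
  then show ?thesis
    by (rule power2_le_imp_le) (simp add: L2_norm_nonneg)
qed

lemma L2_Cauchy_Schwarz:
  assumes "f \<in> L2 N" "h \<in> L2 N"
  shows "cmod (L2_inner N f h) \<le> L2_norm N f * L2_norm N h"
proof -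
  have "cmod (L2_inner N f h) \<le> (LINT x|N. cmod (f x * cnj (h x)))"
    unfolding L2_inner_def by (rule integral_norm_bound)
  then show ?thesis using L2_Cauchy_Schwarz_norm[OF assms] by (simp add: norm_mult)
qed

lemma L2_norm_scale: "L2_norm N (\<lambda>x. c * f x) = cmod c * L2_norm N f"
proof -
  have "(L2_norm N (\<lambda>x. c * f x))\<^sup>2 = (cmod c * L2_norm N f)\<^sup>2"
    by (simp add: L2_norm_square norm_mult power_mult_distrib)
  then show ?thesis using L2_norm_nonneg
    by (metis mult_nonneg_nonneg norm_ge_zero power2_eq_imp_eq)
qed

lemma L2_norm_square_add:
  assumes "f \<in> L2 N" "h \<in> L2 N"
  shows "(L2_norm N (\<lambda>x. f x + h x))\<^sup>2 = (L2_norm N f)\<^sup>2 + 2 * Re (L2_inner N f h) + (L2_norm N h)\<^sup>2"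
proof -
  have "of_real ((L2_norm N (\<lambda>x. f x + h x))\<^sup>2)
      = of_real ((L2_norm N f)\<^sup>2) + (L2_inner N f h + cnj (L2_inner N f h)) + complex_of_real ((L2_norm N h)\<^sup>2)"
    unfolding L2_inner_self_norm[symmetric] using assms
    by (simp add: L2_inner_add_left L2_inner_add_right L2_add L2_inner_commute[of N h f])
  also have "\<dots> = of_real ((L2_norm N f)\<^sup>2 + 2 * Re (L2_inner N f h) + (L2_norm N h)\<^sup>2)"
    by (simp only: complex_add_cnj of_real_add)
  finally show ?thesis by (simp only: of_real_eq_iff)
qed

lemma L2_norm_triangle:
  assumes "f \<in> L2 N" "h \<in> L2 N"
  shows "L2_norm N (\<lambda>x. f x + h x) \<le> L2_norm N f + L2_norm N h"
proof (rule power2_le_imp_le)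
  have "Re (L2_inner N f h) \<le> L2_norm N f * L2_norm N h"
    using complex_Re_le_cmod L2_Cauchy_Schwarz[OF assms] by (rule order_trans)
  then show "(L2_norm N (\<lambda>x. f x + h x))\<^sup>2 \<le> (L2_norm N f + L2_norm N h)\<^sup>2"
    unfolding L2_norm_square_add[OF assms] by (simp add: power2_sum)
qed (simp add: L2_norm_nonneg)

lemma L2_norm_diff_triangle:
  assumes "f \<in> L2 N" "g \<in> L2 N" "h \<in> L2 N"
  shows "L2_norm N (\<lambda>x. f x - h x) \<le> L2_norm N (\<lambda>x. f x - g x) + L2_norm N (\<lambda>x. g x - h x)"
  using L2_norm_triangle[OF L2_diff[OF assms(1,2)] L2_diff[OF assms(2,3)]] by simp

lemma nn_integral_L2_norm:
  assumes "f \<in> L2 N"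
  shows "(\<integral>\<^sup>+x. ennreal ((cmod (f x))\<^sup>2) \<partial>N) = ennreal ((L2_norm N f)\<^sup>2)"
  using nn_integral_eq_integral[OF L2_integrable_norm2[OF assms]] by (simp add: L2_norm_square)

lemma L2_nn_integralI:
  assumes "f \<in> borel_measurable N" "(\<integral>\<^sup>+x. ennreal ((cmod (f x))\<^sup>2) \<partial>N) \<le> ennreal (b\<^sup>2)"
  shows "f \<in> L2 N" "L2_norm N f \<le> \<bar>b\<bar>"
proof -
  have "integrable N (\<lambda>x. (cmod (f x))\<^sup>2)"
    using assms by (intro integrableI_bounded) (auto simp: less_top[symmetric] top_unique)
  then show f: "f \<in> L2 N" using assms(1) by (simp add: L2_def)
  have "(L2_norm N f)\<^sup>2 \<le> b\<^sup>2"
    using assms(2) unfolding nn_integral_L2_norm[OF f] by simp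
  then show "L2_norm N f \<le> \<bar>b\<bar>"
    by (metis abs_le_square_iff L2_norm_nonneg abs_of_nonneg)
qed

text \<open>The weights \<open>2 ^ n\<close> make the partial sums converge almost everywhere.\<close>

lemma L2_complete:
  assumes s: "\<And>n. s n \<in> L2 N"
    and d: "\<And>n. (L2_norm N (\<lambda>x. s (Suc n) x - s n x))\<^sup>2 \<le> (1/4) ^ n"
  obtains f where "f \<in> L2 N" "(\<lambda>n. L2_norm N (\<lambda>x. f x - s n x)) \<longlonglongrightarrow> 0"
proof -
  note [measurable] = L2_measurable[OF s]
  define u where "u n x = s (Suc n) x - s n x" for n x
  have u: "u n \<in> L2 N" for n unfolding u_def by (intro L2_diff s)
  note [measurable] = L2_measurable[OF u]
  have "(\<integral>\<^sup>+x. (\<Sum>n. ennreal (2 ^ n * (cmod (u n x))\<^sup>2)) \<partial>N)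
      = (\<Sum>n. \<integral>\<^sup>+x. ennreal (2 ^ n * (cmod (u n x))\<^sup>2) \<partial>N)"
    by (intro nn_integral_suminf) measurable
  also have "\<dots> = (\<Sum>n. ennreal (2 ^ n * (L2_norm N (u n))\<^sup>2))"
    by (simp add: ennreal_mult nn_integral_cmult nn_integral_L2_norm u)
  also have "\<dots> \<le> (\<Sum>n. ennreal ((1/2) ^ n))"
  proof (intro suminf_le ennreal_leI summableI)
    fix n :: nat
    have "2 ^ n * (L2_norm N (u n))\<^sup>2 \<le> 2 ^ n * (1/4) ^ n"
      using d[of n] unfolding u_def by (intro mult_left_mono) auto
    also have "\<dots> = (1/2::real) ^ n" by (simp flip: power_mult_distrib)
    finally show "2 ^ n * (L2_norm N (u n))\<^sup>2 \<le> (1/2) ^ n" .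
  qed
  also have "\<dots> = ennreal (\<Sum>n. (1/2) ^ n)"
    by (intro suminf_ennreal_eq) (auto intro: summable_sums summable_geometric)
  also have "\<dots> < \<infinity>" by simp
  finally have "AE x in N. (\<Sum>n. ennreal (2 ^ n * (cmod (u n x))\<^sup>2)) \<noteq> \<infinity>"
    by (intro nn_integral_PInf_AE) auto
  then have conv: "AE x in N. convergent (\<lambda>n. s n x)"
  proof eventually_elim
    case (elim x)
    have sm: "summable (\<lambda>n. 2 ^ n * (cmod (u n x))\<^sup>2)"
      using elim by (intro summable_suminf_not_top) auto
    define a where "a n = 2 ^ n * (cmod (u n x))\<^sup>2" for n
    have "summable (\<lambda>n. cmod (u n x))"
    proof (rule summable_comparison_test')
      show "summable (\<lambda>n. a n + (1/2) ^ n)"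
        using sm unfolding a_def by (intro summable_add) (auto intro: summable_geometric)
      fix n :: nat
      have p: "(2::real) ^ n * (1/2) ^ n = 1" by (simp flip: power_mult_distrib)
      have "cmod (u n x) \<le> 2 ^ n * (cmod (u n x))\<^sup>2 + (1/2) ^ n"
      proof -
        \<comment> \<open>Expanded, this is \<open>2 a <= 2^n a^2 + 2^-n\<close> for
          \<open>a = cmod (u n x)\<close>, which bounds the increment by the terms of two convergent
          series.\<close>
        have "0 \<le> (2 ^ n * cmod (u n x) - 1)\<^sup>2 * (1/2) ^ n" by simp
        also have "\<dots> = (2 ^ n * (1/2) ^ n) * (2 ^ n * (cmod (u n x))\<^sup>2) - 2 * (2 ^ n * (1/2) ^ n) * cmod (u n x) + (1/2) ^ n"
          by (simp add: power2_eq_square algebra_simps)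
        finally have "2 * cmod (u n x) \<le> 2 ^ n * (cmod (u n x))\<^sup>2 + (1/2) ^ n"
          unfolding p by simp
        then show ?thesis using norm_ge_zero[of "u n x"] by linarith
      qed
      then show "norm (cmod (u n x)) \<le> a n + (1/2) ^ n" by (simp add: a_def)
    qed
    then have "summable (\<lambda>n. u n x)" by (rule summable_norm_cancel)
    then have "convergent (\<lambda>n. s n x - s 0 x)"
      unfolding summable_iff_convergent u_def by (simp only: sum_lessThan_telescope[of "\<lambda>n. s n x"])
    then obtain l where "(\<lambda>n. s n x - s 0 x) \<longlonglongrightarrow> l" by (auto simp: convergent_def)
    then have "(\<lambda>n. s n x - s 0 x + s 0 x) \<longlonglongrightarrow> l + s 0 x" by (intro tendsto_intros)
    then show ?case by (auto simp: convergent_def)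
  qed
  \<comment> \<open>At points of divergence \<open>lim\<close> is an arbitrary value; these points
    form a null set.\<close>
  define f where "f x = lim (\<lambda>n. s n x)" for x
  have [measurable]: "f \<in> borel_measurable N" unfolding f_def by measurable
  have lim: "AE x in N. (\<lambda>n. s n x) \<longlonglongrightarrow> f x"
    using conv by eventually_elim (simp add: f_def convergent_LIMSEQ_iff)
  \<comment> \<open>Increments of norm at most \<open>(1/2) ^ n\<close> add up to a geometric sum;
    keeping the subtracted term lets the induction close.\<close>
  have dist: "L2_norm N (\<lambda>x. s (n + k) x - s n x) \<le> 2 * (1/2) ^ n - 2 * (1/2) ^ (n + k)" for n k
  proof (induction k)
    case 0
    then show ?case by (simp add: L2_norm_square L2_norm_def L2_inner_self)
  next
    case (Suc k)
    have "(L2_norm N (\<lambda>x. s (Suc (n + k)) x - s (n + k) x))\<^sup>2 \<le> ((1/2) ^ (n + k))\<^sup>2"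
      using d[of "n + k"] by (simp add: power2_eq_square flip: power_mult_distrib)
    then have "L2_norm N (\<lambda>x. s (Suc (n + k)) x - s (n + k) x) \<le> (1/2) ^ (n + k)"
      by (rule power2_le_imp_le) simp
    then show ?case
      using Suc L2_norm_diff_triangle[OF s[of "Suc (n + k)"] s[of "n + k"] s[of n]] by simp
  qed
  have f_s: "(\<lambda>x. f x - s n x) \<in> L2 N \<and> L2_norm N (\<lambda>x. f x - s n x) \<le> 2 * (1/2) ^ n" for n
  proof -
    \<comment> \<open>Fatou's lemma: as \<open>k\<close> grows, \<open>s (n + k) - s n\<close> tends
      to \<open>f - s n\<close> almost everywhere, and \<open>dist\<close> bounds the norms
      uniformly in \<open>k\<close>.\<close>
    have "(\<integral>\<^sup>+x. ennreal ((cmod (f x - s n x))\<^sup>2) \<partial>N)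
        = (\<integral>\<^sup>+x. liminf (\<lambda>k. ennreal ((cmod (s (n + k) x - s n x))\<^sup>2)) \<partial>N)"
    proof (rule nn_integral_cong_AE, use lim in eventually_elim)
      case (elim x)
      have "(\<lambda>k. s (n + k) x) \<longlonglongrightarrow> f x"
        using LIMSEQ_ignore_initial_segment[OF elim, of n] by (simp add: add.commute)
      then have "(\<lambda>k. ennreal ((cmod (s (n + k) x - s n x))\<^sup>2)) \<longlonglongrightarrow> ennreal ((cmod (f x - s n x))\<^sup>2)"
        by (intro tendsto_intros)
      then show ?case by (metis lim_imp_Liminf sequentially_bot)
    qed
    also have "\<dots> \<le> liminf (\<lambda>k. \<integral>\<^sup>+x. ennreal ((cmod (s (n + k) x - s n x))\<^sup>2) \<partial>N)"
      by (intro nn_integral_liminf) measurable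
    also have "\<dots> = liminf (\<lambda>k. ennreal ((L2_norm N (\<lambda>x. s (n + k) x - s n x))\<^sup>2))"
      by (simp add: nn_integral_L2_norm L2_diff s)
    also have "\<dots> \<le> limsup (\<lambda>k. ennreal ((L2_norm N (\<lambda>x. s (n + k) x - s n x))\<^sup>2))"
      by (intro Liminf_le_Limsup) simp
    also have "\<dots> \<le> ennreal ((2 * (1/2) ^ n)\<^sup>2)"
    proof (intro Limsup_bounded always_eventually allI ennreal_leI power_mono L2_norm_nonneg)
      fix k
      have "(0::real) \<le> (1/2) ^ (n + k)" by simp
      then show "L2_norm N (\<lambda>x. s (n + k) x - s n x) \<le> 2 * (1/2) ^ n"
        using dist[of n k] by linarith
    qed
    finally show ?thesis
      using L2_nn_integralI[of "\<lambda>x. f x - s n x" N "2 * (1/2) ^ n"] by simp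
  qed
  have "(\<lambda>x. (f x - s 0 x) + s 0 x) \<in> L2 N"
    using f_s[of 0] s by (intro L2_add) auto
  then have "f \<in> L2 N" by simp
  moreover have "(\<lambda>n. L2_norm N (\<lambda>x. f x - s n x)) \<longlonglongrightarrow> 0"
  proof (rule tendsto_sandwich[OF _ _ tendsto_const])
    show "(\<lambda>n. 2 * (1/2::real) ^ n) \<longlonglongrightarrow> 0"
      by (intro tendsto_mult_right_zero LIMSEQ_power_zero) simp
  qed (use f_s L2_norm_nonneg in \<open>auto intro!: always_eventually\<close>)
  ultimately show thesis by (rule that)
qed

section \<open>Orthonormal bases\<close>

text \<open>Zorn's lemma for orthonormal sets ordered by inclusion. Maximality yields the
  completeness clause: a vector orthogonal to the set and not null could be normalised and
  added.\<close>

lemma L2_onb_exists: "\<exists>B. L2_onb N B"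
proof -
  define A where "A = {B. B \<subseteq> L2 N \<and> (\<forall>e\<in>B. \<forall>f\<in>B. L2_inner N e f = (if e = f then 1 else 0))}"
  have "\<exists>B\<in>A. \<forall>X\<in>A. B \<subseteq> X \<longrightarrow> X = B"
  proof (rule subset_Zorn)
    fix C assume C: "subset.chain A C"
    have "\<Union>C \<in> A"
      unfolding A_def
    proof (intro CollectI conjI ballI)
      show "\<Union>C \<subseteq> L2 N" using C by (auto simp: subset.chain_def A_def)
      fix e f assume "e \<in> \<Union>C" "f \<in> \<Union>C"
      then obtain X Y where XY: "e \<in> X" "X \<in> C" "f \<in> Y" "Y \<in> C" by auto
      then have "X \<subseteq> Y \<or> Y \<subseteq> X" "X \<in> A" "Y \<in> A"
        using C by (auto simp: subset.chain_def)
      then show "L2_inner N e f = (if e = f then 1 else 0)"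
        using XY unfolding A_def by blast
    qed
    then show "\<exists>U\<in>A. \<forall>X\<in>C. X \<subseteq> U" by auto
  qed
  then obtain B where B: "B \<in> A" "\<And>X. X \<in> A \<Longrightarrow> B \<subseteq> X \<Longrightarrow> X = B" by auto
  have "AE x in N. h x = 0" if h: "h \<in> L2 N" "\<forall>e\<in>B. L2_inner N h e = 0" for h
  proof (rule ccontr)
    assume "\<not> (AE x in N. h x = 0)"
    then have nz: "L2_norm N h \<noteq> 0" using L2_norm_eq_0_iff[OF h(1)] by simp
    define u where "u x = of_real (1 / L2_norm N h) * h x" for x
    have u: "u \<in> L2 N" unfolding u_def by (intro L2_scale h)
    have uu: "L2_inner N u u = 1"
      using nz unfolding u_def[abs_def] L2_inner_scale_left L2_inner_scale_right
      by (simp add: L2_inner_self_norm power2_eq_square)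
    have ue: "L2_inner N u e = 0" "L2_inner N e u = 0" if "e \<in> B" for e
      using h(2) that L2_inner_commute[of N e h]
      unfolding u_def[abs_def] L2_inner_scale_left L2_inner_scale_right by auto
    have "insert u B \<in> A"
      using B(1) u uu ue unfolding A_def by auto
    \<comment> \<open>Membership is contradictory: \<open>u\<close> would be orthogonal to itself
      although \<open>L2_inner N u u = 1\<close>.\<close>
    then have "u \<in> B" using B(2) by blast
    then show False using ue uu by fastforce
  qed
  then have "L2_onb N B" using B(1) unfolding A_def L2_onb_def by blast
  then show ?thesis by blast
qed

lemma L2_basis_onb: "L2_onb N (L2_basis N)"
  unfolding L2_basis_def using L2_onb_exists by (rule someI_ex)

lemma L2_onb_subset: "L2_onb N B \<Longrightarrow> e \<in> B \<Longrightarrow> e \<in> L2 N"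
  by (auto simp: L2_onb_def)

lemma L2_onb_inner: "L2_onb N B \<Longrightarrow> e \<in> B \<Longrightarrow> f \<in> B \<Longrightarrow> L2_inner N e f = (if e = f then 1 else 0)"
  by (auto simp: L2_onb_def)

lemma L2_onb_complete:
  "L2_onb N B \<Longrightarrow> h \<in> L2 N \<Longrightarrow> (\<And>e. e \<in> B \<Longrightarrow> L2_inner N h e = 0) \<Longrightarrow> AE x in N. h x = 0"
  by (auto simp: L2_onb_def)

definition L2_proj :: "'a measure \<Rightarrow> ('a \<Rightarrow> complex) set \<Rightarrow> ('a \<Rightarrow> complex) \<Rightarrow> 'a \<Rightarrow> complex" where
  "L2_proj N F f x = (\<Sum>e\<in>F. L2_inner N f e * e x)"

context
  fixes N :: "'a measure" and B
  assumes B: "L2_onb N B"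
begin

lemma L2_proj_L2: "F \<subseteq> B \<Longrightarrow> L2_proj N F f \<in> L2 N"
  unfolding L2_proj_def by (intro L2_sum L2_scale L2_onb_subset[OF B]) auto

lemma L2_proj_inner_left:
  assumes "F \<subseteq> B" "h \<in> L2 N"
  shows "L2_inner N (L2_proj N F f) h = (\<Sum>e\<in>F. L2_inner N f e * L2_inner N e h)"
proof -
  have "L2_inner N (\<lambda>x. \<Sum>e\<in>F. L2_inner N f e * e x) h
      = (\<Sum>e\<in>F. L2_inner N (\<lambda>x. L2_inner N f e * e x) h)"
    using assms by (intro L2_inner_sum_left L2_scale) (auto intro: L2_onb_subset[OF B])
  then show ?thesis by (simp add: L2_proj_def[abs_def] L2_inner_scale_left)
qed

lemma L2_proj_inner_basis:
  assumes "finite F" "F \<subseteq> B" "e \<in> B"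
  shows "L2_inner N (L2_proj N F f) e = (if e \<in> F then L2_inner N f e else 0)"
proof -
  have "L2_inner N (L2_proj N F f) e = (\<Sum>e'\<in>F. if e' = e then L2_inner N f e' else 0)"
    using assms unfolding L2_proj_inner_left[OF assms(2) L2_onb_subset[OF B assms(3)]]
    by (intro sum.cong) (auto simp: L2_onb_inner[OF B] subset_iff)
  then show ?thesis using assms(1) by simp
qed

lemma L2_norm_proj_square:
  assumes "finite F" "F \<subseteq> B"
  shows "(L2_norm N (L2_proj N F f))\<^sup>2 = (\<Sum>e\<in>F. (cmod (L2_inner N f e))\<^sup>2)"
proof -
  have "of_real ((L2_norm N (L2_proj N F f))\<^sup>2)
      = (\<Sum>e\<in>F. L2_inner N f e * L2_inner N e (L2_proj N F f))"
    unfolding L2_inner_self_norm[symmetric] using assms by (intro L2_proj_inner_left L2_proj_L2)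
  also have "\<dots> = (\<Sum>e\<in>F. L2_inner N f e * cnj (L2_inner N f e))"
    using assms by (intro sum.cong refl)
      (auto simp: L2_inner_commute[of N _ "L2_proj N F f"] L2_proj_inner_basis subset_iff)
  also have "\<dots> = of_real (\<Sum>e\<in>F. (cmod (L2_inner N f e))\<^sup>2)"
    by (simp only: complex_norm_square of_real_sum)
  finally show ?thesis by (simp only: of_real_eq_iff)
qed

text \<open>Pythagoras: the residual is orthogonal to the projection.\<close>

lemma L2_norm_residual_square:
  assumes "finite F" "F \<subseteq> B" "f \<in> L2 N"
  shows "(L2_norm N (\<lambda>x. f x - L2_proj N F f x))\<^sup>2
       = (L2_norm N f)\<^sup>2 - (\<Sum>e\<in>F. (cmod (L2_inner N f e))\<^sup>2)"
proof -
  note p = L2_proj_L2[OF assms(2), of f]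
  have "L2_inner N (L2_proj N F f) (\<lambda>x. f x - L2_proj N F f x)
      = (\<Sum>e\<in>F. L2_inner N f e * L2_inner N e (\<lambda>x. f x - L2_proj N F f x))"
    using assms p by (intro L2_proj_inner_left L2_diff)
  also have "\<dots> = 0"
  proof (intro sum.neutral ballI)
    fix e assume e: "e \<in> F"
    then have "e \<in> B" "e \<in> L2 N" using assms L2_onb_subset[OF B] by auto
    then show "L2_inner N f e * L2_inner N e (\<lambda>x. f x - L2_proj N F f x) = 0"
      using e assms p L2_inner_commute[of N e f] L2_inner_commute[of N e "L2_proj N F f"]
      by (simp add: L2_inner_diff_right L2_proj_inner_basis)
  qed
  finally have "Re (L2_inner N (L2_proj N F f) (\<lambda>x. f x - L2_proj N F f x)) = 0" by simp
  then show ?thesis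
    using L2_norm_square_add[OF p L2_diff[OF assms(3) p]]
    by (simp add: L2_norm_proj_square[OF assms(1,2)])
qed

lemma Bessel_inequality:
  assumes "finite F" "F \<subseteq> B" "f \<in> L2 N"
  shows "(\<Sum>e\<in>F. (cmod (L2_inner N f e))\<^sup>2) \<le> (L2_norm N f)\<^sup>2"
  using L2_norm_residual_square[OF assms] zero_le_power2[of "L2_norm N (\<lambda>x. f x - L2_proj N F f x)"]
  by linarith

lemma Bessel_summable:
  assumes "f \<in> L2 N"
  shows "(\<lambda>e. (cmod (L2_inner N f e))\<^sup>2) summable_on B"
  using Bessel_inequality[OF _ _ assms]
  by (intro nonneg_bdd_above_summable_on) (auto simp: bdd_above_def)

text \<open>Projections onto finite sets that exhaust the sum of squared coefficients up to
  \<open>(1/4) ^ n\<close> form a sequence to which \<open>L2_complete\<close> applies. Its limit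
  \<open>g\<close> has the same coefficients as \<open>f\<close>, so maximality of the basis gives
  \<open>f = g\<close> almost everywhere; the residual norms therefore tend to zero, and
  \<open>L2_norm_residual_square\<close> turns this into the identity.\<close>

lemma Parseval_norm:
  assumes f: "f \<in> L2 N"
  shows "((\<lambda>e. (cmod (L2_inner N f e))\<^sup>2) has_sum (L2_norm N f)\<^sup>2) B"
proof -
  define c where "c e = (cmod (L2_inner N f e))\<^sup>2" for e
  define S where "S = infsum c B"
  have sm: "(c has_sum S) B"
    unfolding S_def c_def[abs_def] using Bessel_summable[OF f] by simp
  have c_nonneg: "c e \<ge> 0" for e by (simp add: c_def)
  have le_S: "sum c F \<le> S" if "finite F" "F \<subseteq> B" for F
    using finite_sum_le_has_sum[OF sm that] c_nonneg by simp
  have ex: "\<exists>F. finite F \<and> F \<subseteq> B \<and> S - sum c F \<le> (1/4) ^ n" for n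
    using has_sum_finite_approximation[OF sm, of "(1/4) ^ n"] by (force simp: dist_real_def)
  then obtain F0 where F0: "\<And>n. finite (F0 n) \<and> F0 n \<subseteq> B \<and> S - sum c (F0 n) \<le> (1/4) ^ n"
    by metis
  \<comment> \<open>Unions make the sets increase, so that successive projections differ by the
    projection onto \<open>F (Suc n) - F n\<close>.\<close>
  define F where "F n = (\<Union>i\<le>n. F0 i)" for n
  have fin: "finite (F n)" "F n \<subseteq> B" for n using F0 by (auto simp: F_def)
  have F: "S - sum c (F n) \<le> (1/4) ^ n" for n
  proof -
    have "sum c (F0 n) \<le> sum c (F n)"
      using fin c_nonneg by (intro sum_mono2) (auto simp: F_def)
    then show ?thesis using F0[of n] by linarith
  qed
  define s where "s n = L2_proj N (F n) f" for n
  have s: "s n \<in> L2 N" for n unfolding s_def by (intro L2_proj_L2 fin)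
  have "(L2_norm N (\<lambda>x. s (Suc n) x - s n x))\<^sup>2 \<le> (1/4) ^ n" for n
  proof -
    have sub: "F n \<subseteq> F (Suc n)" unfolding F_def by (intro UN_mono) auto
    have "(\<lambda>x. s (Suc n) x - s n x) = L2_proj N (F (Suc n) - F n) f"
      using fin sub by (auto simp: s_def L2_proj_def[abs_def] fun_eq_iff sum_diff)
    then have "(L2_norm N (\<lambda>x. s (Suc n) x - s n x))\<^sup>2 = sum c (F (Suc n) - F n)"
      using fin[of "Suc n"] by (simp only:) (subst L2_norm_proj_square, auto simp: c_def)
    also have "\<dots> = sum c (F (Suc n)) - sum c (F n)" using fin sub by (intro sum_diff)
    also have "\<dots> \<le> (1/4) ^ n" using F[of n] le_S[OF fin, of "Suc n"] by linarith
    finally show ?thesis .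
  qed
  from L2_complete[of s, OF s this] obtain g where
    g: "g \<in> L2 N" "(\<lambda>n. L2_norm N (\<lambda>x. g x - s n x)) \<longlonglongrightarrow> 0" by metis
  have ortho: "L2_inner N (\<lambda>x. f x - g x) e = 0" if e: "e \<in> B" for e
  proof -
    note e' = L2_onb_subset[OF B e]
    have "(\<lambda>n. L2_inner N (\<lambda>x. f x - s n x) e) \<longlonglongrightarrow> 0"
    proof (rule Lim_null_comparison[where g = "\<lambda>n. sqrt ((1/4) ^ n)"])
      \<comment> \<open>If \<open>e\<close> lies in \<open>F n\<close>, its coefficient has been
        removed; otherwise its square belongs to the tail of \<open>S\<close>, which is at most
        \<open>(1/4) ^ n\<close>.\<close>
      have "cmod (L2_inner N (\<lambda>x. f x - s n x) e) \<le> sqrt ((1/4) ^ n)" for n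
      proof (cases "e \<in> F n")
        case True
        then show ?thesis
          using fin e f s e' by (simp add: L2_inner_diff_left s_def L2_proj_inner_basis)
      next
        case False
        have "c e + sum c (F n) \<le> S"
          using le_S[of "insert e (F n)"] False fin[of n] e by simp
        then have "c e \<le> (1/4) ^ n" using F[of n] by linarith
        then have "cmod (L2_inner N f e) \<le> sqrt ((1/4) ^ n)"
          unfolding c_def by (rule real_le_rsqrt)
        then show ?thesis
          using False fin e f s e' by (simp add: L2_inner_diff_left s_def L2_proj_inner_basis)
      qed
      then show "\<forall>\<^sub>F n in sequentially. norm (L2_inner N (\<lambda>x. f x - s n x) e) \<le> sqrt ((1/4) ^ n)"
        by simp
      have "(\<lambda>n. sqrt ((1/4) ^ n)) \<longlonglongrightarrow> sqrt 0"
        by (intro tendsto_intros LIMSEQ_power_zero) simp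
      then show "(\<lambda>n. sqrt ((1/4) ^ n)) \<longlonglongrightarrow> 0" by simp
    qed
    moreover have "(\<lambda>n. L2_inner N (\<lambda>x. g x - s n x) e) \<longlonglongrightarrow> 0"
    proof (rule Lim_null_comparison)
      show "\<forall>\<^sub>F n in sequentially. norm (L2_inner N (\<lambda>x. g x - s n x) e)
          \<le> L2_norm N (\<lambda>x. g x - s n x) * L2_norm N e"
        using g s e' by (intro always_eventually allI L2_Cauchy_Schwarz L2_diff)
      show "(\<lambda>n. L2_norm N (\<lambda>x. g x - s n x) * L2_norm N e) \<longlonglongrightarrow> 0"
        using g by (intro tendsto_mult_left_zero)
    qed
    ultimately have "(\<lambda>n. L2_inner N (\<lambda>x. f x - s n x) e - L2_inner N (\<lambda>x. g x - s n x) e) \<longlonglongrightarrow> 0 - 0"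
      by (rule tendsto_diff)
    moreover have "L2_inner N (\<lambda>x. f x - s n x) e - L2_inner N (\<lambda>x. g x - s n x) e
        = L2_inner N (\<lambda>x. f x - g x) e" for n
      using f g s e' by (simp add: L2_inner_diff_left)
    ultimately show ?thesis by (simp add: LIMSEQ_const_iff)
  qed
  have fg: "AE x in N. f x - g x = 0"
    using L2_onb_complete[OF B L2_diff[OF f g(1)] ortho] .
  have eq: "L2_norm N (\<lambda>x. g x - s n x) = L2_norm N (\<lambda>x. f x - s n x)" for n
    using fg f g s by (intro L2_norm_cong_AE L2_diff) (auto elim!: eventually_mono)
  have "(\<lambda>n. (L2_norm N f)\<^sup>2 - sum c (F n)) \<longlonglongrightarrow> 0\<^sup>2"
    using tendsto_power[OF g(2), of 2]
    unfolding eq unfolding s_def L2_norm_residual_square[OF fin f] c_def .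
  moreover have "(\<lambda>n. sum c (F n)) \<longlonglongrightarrow> S"
  proof (rule tendsto_sandwich)
    show "(\<lambda>n. S - (1/4) ^ n) \<longlonglongrightarrow> S"
      using tendsto_diff[OF tendsto_const, OF LIMSEQ_power_zero, of "1/4::real" S] by simp
    show "\<forall>\<^sub>F n in sequentially. S - (1/4) ^ n \<le> sum c (F n)"
      using F by (intro always_eventually allI) (simp add: algebra_simps)
    show "\<forall>\<^sub>F n in sequentially. sum c (F n) \<le> S"
      using le_S fin by (intro always_eventually allI) auto
  qed simp
  ultimately have "(\<lambda>n. ((L2_norm N f)\<^sup>2 - sum c (F n)) + sum c (F n)) \<longlonglongrightarrow> 0\<^sup>2 + S"
    by (rule tendsto_add)
  then have "(L2_norm N f)\<^sup>2 = S" by (simp add: LIMSEQ_const_iff)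
  then show ?thesis using sm by (simp add: c_def[abs_def])
qed

text \<open>The error of a finite partial sum is the inner product of the residual with
  \<open>h\<close>; Cauchy-Schwarz and \<open>Parseval_norm\<close> send it to zero along the finite
  subsets.\<close>

lemma Parseval:
  assumes f: "f \<in> L2 N" and h: "h \<in> L2 N"
  shows "((\<lambda>e. L2_inner N f e * L2_inner N e h) has_sum L2_inner N f h) B"
proof -
  let ?S = "finite_subsets_at_top B"
  have ev: "\<forall>\<^sub>F F in ?S. finite F \<and> F \<subseteq> B"
    by (rule eventually_finite_subsets_at_top_weakI) auto
  have "((\<lambda>F. L2_norm N f ^ 2 - (\<Sum>e\<in>F. (cmod (L2_inner N f e))\<^sup>2)) \<longlongrightarrow> L2_norm N f ^ 2 - L2_norm N f ^ 2) ?S"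
    using Parseval_norm[OF f] unfolding has_sum_def by (intro tendsto_intros)
  then have "((\<lambda>F. sqrt (L2_norm N f ^ 2 - (\<Sum>e\<in>F. (cmod (L2_inner N f e))\<^sup>2)) * L2_norm N h) \<longlongrightarrow> sqrt 0 * L2_norm N h) ?S"
    by (intro tendsto_intros) simp
  then have "((\<lambda>F. sqrt (L2_norm N f ^ 2 - (\<Sum>e\<in>F. (cmod (L2_inner N f e))\<^sup>2)) * L2_norm N h) \<longlongrightarrow> 0) ?S"
    by simp
  then have "((\<lambda>F. (\<Sum>e\<in>F. L2_inner N f e * L2_inner N e h) - L2_inner N f h) \<longlongrightarrow> 0) ?S"
  proof (rule Lim_null_comparison[rotated])
    show "\<forall>\<^sub>F F in ?S. norm ((\<Sum>e\<in>F. L2_inner N f e * L2_inner N e h) - L2_inner N f h)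
        \<le> sqrt (L2_norm N f ^ 2 - (\<Sum>e\<in>F. (cmod (L2_inner N f e))\<^sup>2)) * L2_norm N h"
      using ev
    proof eventually_elim
      case (elim F)
      then have p: "L2_proj N F f \<in> L2 N" by (intro L2_proj_L2) auto
      have "norm ((\<Sum>e\<in>F. L2_inner N f e * L2_inner N e h) - L2_inner N f h)
          = cmod (L2_inner N (\<lambda>x. f x - L2_proj N F f x) h)"
        using elim f h p by (simp add: L2_inner_diff_left L2_proj_inner_left norm_minus_commute)
      also have "\<dots> \<le> L2_norm N (\<lambda>x. f x - L2_proj N F f x) * L2_norm N h"
        using f h p by (intro L2_Cauchy_Schwarz L2_diff)
      also have "L2_norm N (\<lambda>x. f x - L2_proj N F f x)
          = sqrt (L2_norm N f ^ 2 - (\<Sum>e\<in>F. (cmod (L2_inner N f e))\<^sup>2))"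
        using L2_norm_residual_square[of F f] elim f L2_norm_nonneg
        by (metis real_sqrt_abs abs_of_nonneg)
      finally show ?case .
    qed
  qed
  then show ?thesis unfolding has_sum_def by (subst Lim_null)
qed

end

section \<open>Hilbert-Schmidt operators with an adjoint\<close>

text \<open>The existence condition under which the \<open>SOME\<close> in \<open>op_adjoint\<close>
  has its defining property.\<close>

definition has_adjoint :: "'a measure \<Rightarrow> 'a operator \<Rightarrow> bool" where
  "has_adjoint N K \<longleftrightarrow> (\<exists>A. L2_operator N A \<and>
     (\<forall>f\<in>L2 N. \<forall>h\<in>L2 N. L2_inner N (K f) h = L2_inner N f (A h)))"

lemma L2_operator_L2: "L2_operator N K \<Longrightarrow> f \<in> L2 N \<Longrightarrow> K f \<in> L2 N"
  by (auto simp: L2_operator_def)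

lemma L2_operator_bounded:
  assumes "L2_operator N K"
  obtains b where "b \<ge> 0" "\<And>f. f \<in> L2 N \<Longrightarrow> L2_norm N (K f) \<le> b * L2_norm N f"
proof -
  obtain b where b: "\<And>f. f \<in> L2 N \<Longrightarrow> L2_norm N (K f) \<le> b * L2_norm N f"
    using assms unfolding L2_operator_def by blast
  have "L2_norm N (K f) \<le> \<bar>b\<bar> * L2_norm N f" if "f \<in> L2 N" for f
    using b[OF that] mult_right_mono[of b "\<bar>b\<bar>" "L2_norm N f"] L2_norm_nonneg[of N f] by linarith
  then show thesis by (intro that[of "\<bar>b\<bar>"]) auto
qed

lemma L2_operator_diff_AE:
  assumes K: "L2_operator N K" and f: "f \<in> L2 N" "h \<in> L2 N"
  shows "AE x in N. K (\<lambda>z. f z - h z) x = K f x - K h x"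
proof -
  have "\<forall>f\<in>L2 N. \<forall>h\<in>L2 N. AE x in N. K (\<lambda>z. f z + h z) x = K f x + K h x"
    using K unfolding L2_operator_def by blast
  then have "AE x in N. K (\<lambda>z. f z + (- 1) * h z) x = K f x + K (\<lambda>z. (- 1) * h z) x"
    by (elim ballE[of _ _ f] ballE[of _ _ "\<lambda>z. (- 1) * h z"]) (use f L2_scale[OF f(2), of "- 1"] in auto)
  moreover have "AE x in N. K (\<lambda>z. (- 1) * h z) x = (- 1) * K h x"
    using K f unfolding L2_operator_def by blast
  ultimately show ?thesis by eventually_elim simp
qed

lemma L2_operator_comb:
  assumes K1: "L2_operator N K\<^sub>1" and K2: "L2_operator N K\<^sub>2"
  shows "L2_operator N (\<lambda>\<phi> x. K\<^sub>1 \<phi> x + c * K\<^sub>2 \<phi> x)"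
  unfolding L2_operator_def
proof (intro conjI ballI allI)
  fix f assume f: "f \<in> L2 N"
  show "(\<lambda>x. K\<^sub>1 f x + c * K\<^sub>2 f x) \<in> L2 N"
    by (intro L2_add L2_scale L2_operator_L2[OF K1] L2_operator_L2[OF K2] f)
  fix h assume h: "h \<in> L2 N"
  have "AE x in N. K\<^sub>1 (\<lambda>z. f z + h z) x = K\<^sub>1 f x + K\<^sub>1 h x"
    "AE x in N. K\<^sub>2 (\<lambda>z. f z + h z) x = K\<^sub>2 f x + K\<^sub>2 h x"
    using K1 K2 f h unfolding L2_operator_def by blast+
  then show "AE x in N. K\<^sub>1 (\<lambda>z. f z + h z) x + c * K\<^sub>2 (\<lambda>z. f z + h z) x
      = K\<^sub>1 f x + c * K\<^sub>2 f x + (K\<^sub>1 h x + c * K\<^sub>2 h x)"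
    by eventually_elim (simp add: algebra_simps)
next
  fix a f assume f: "f \<in> L2 N"
  have "AE x in N. K\<^sub>1 (\<lambda>z. a * f z) x = a * K\<^sub>1 f x" "AE x in N. K\<^sub>2 (\<lambda>z. a * f z) x = a * K\<^sub>2 f x"
    using K1 K2 f unfolding L2_operator_def by blast+
  then show "AE x in N. K\<^sub>1 (\<lambda>z. a * f z) x + c * K\<^sub>2 (\<lambda>z. a * f z) x = a * (K\<^sub>1 f x + c * K\<^sub>2 f x)"
    by eventually_elim (simp add: algebra_simps)
next
  obtain b1 where b1: "\<And>f. f \<in> L2 N \<Longrightarrow> L2_norm N (K\<^sub>1 f) \<le> b1 * L2_norm N f"
    using L2_operator_bounded[OF K1] by blast
  obtain b2 where b2: "\<And>f. f \<in> L2 N \<Longrightarrow> L2_norm N (K\<^sub>2 f) \<le> b2 * L2_norm N f"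
    using L2_operator_bounded[OF K2] by blast
  have "L2_norm N (\<lambda>x. K\<^sub>1 f x + c * K\<^sub>2 f x) \<le> (b1 + cmod c * b2) * L2_norm N f"
    if f: "f \<in> L2 N" for f
  proof -
    have "L2_norm N (\<lambda>x. K\<^sub>1 f x + c * K\<^sub>2 f x) \<le> L2_norm N (K\<^sub>1 f) + cmod c * L2_norm N (K\<^sub>2 f)"
      using L2_norm_triangle[OF L2_operator_L2[OF K1 f] L2_scale[OF L2_operator_L2[OF K2 f], of c]]
      by (simp add: L2_norm_scale)
    also have "\<dots> \<le> b1 * L2_norm N f + cmod c * (b2 * L2_norm N f)"
      by (intro add_mono mult_left_mono b1 b2 f) simp
    finally show ?thesis by (simp add: algebra_simps)
  qed
  then show "\<exists>b. \<forall>f\<in>L2 N. L2_norm N (\<lambda>x. K\<^sub>1 f x + c * K\<^sub>2 f x) \<le> b * L2_norm N f"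
    by blast
qed

lemma has_adjoint_comb:
  assumes K1: "L2_operator N K\<^sub>1" "has_adjoint N K\<^sub>1" and K2: "L2_operator N K\<^sub>2" "has_adjoint N K\<^sub>2"
  shows "has_adjoint N (\<lambda>\<phi> x. K\<^sub>1 \<phi> x + c * K\<^sub>2 \<phi> x)"
proof -
  obtain A where A: "L2_operator N A"
    "\<And>f h. f \<in> L2 N \<Longrightarrow> h \<in> L2 N \<Longrightarrow> L2_inner N (K\<^sub>1 f) h = L2_inner N f (A h)"
    using K1(2) by (auto simp: has_adjoint_def)
  obtain A' where A': "L2_operator N A'"
    "\<And>f h. f \<in> L2 N \<Longrightarrow> h \<in> L2 N \<Longrightarrow> L2_inner N (K\<^sub>2 f) h = L2_inner N f (A' h)"
    using K2(2) by (auto simp: has_adjoint_def)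
  show ?thesis
    unfolding has_adjoint_def
  proof (intro exI[of _ "\<lambda>\<phi> x. A \<phi> x + cnj c * A' \<phi> x"] conjI ballI)
    show "L2_operator N (\<lambda>\<phi> x. A \<phi> x + cnj c * A' \<phi> x)"
      by (intro L2_operator_comb A A')
    fix f h assume f: "f \<in> L2 N" and h: "h \<in> L2 N"
    show "L2_inner N (\<lambda>x. K\<^sub>1 f x + c * K\<^sub>2 f x) h = L2_inner N f (\<lambda>x. A h x + cnj c * A' h x)"
      using f h A A' K1 K2
      by (simp add: L2_inner_add_left L2_inner_add_right L2_scale L2_operator_L2
          L2_inner_scale_left L2_inner_scale_right)
  qed
qed

lemma self_adjoint_has_adjoint: "L2_operator N K \<Longrightarrow> self_adjoint N K \<Longrightarrow> has_adjoint N K"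
  by (auto simp: has_adjoint_def self_adjoint_def)

text \<open>The chosen adjoint is moved back to the other side of each diagonal entry, which
  eliminates \<open>op_adjoint\<close>. The identity is termwise, so it is available before
  summability is known.\<close>

lemma HS_inner_eq_infsum:
  assumes K1: "L2_operator N K\<^sub>1" and K2: "L2_operator N K\<^sub>2" "has_adjoint N K\<^sub>2"
  shows "HS_inner N K\<^sub>1 K\<^sub>2 = (\<Sum>\<^sub>\<infinity>e\<in>L2_basis N. L2_inner N (K\<^sub>1 e) (K\<^sub>2 e))"
proof -
  have A: "L2_operator N (op_adjoint N K\<^sub>2) \<and>
     (\<forall>f\<in>L2 N. \<forall>h\<in>L2 N. L2_inner N (K\<^sub>2 f) h = L2_inner N f (op_adjoint N K\<^sub>2 h))"
    using K2(2) unfolding has_adjoint_def op_adjoint_def by (rule someI_ex)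
  show ?thesis
    unfolding HS_inner_def op_trace_def o_def
  proof (rule infsum_cong)
    fix e assume "e \<in> L2_basis N"
    then have e: "e \<in> L2 N" by (rule L2_onb_subset[OF L2_basis_onb])
    then have "L2_inner N (K\<^sub>2 e) (K\<^sub>1 e) = L2_inner N e (op_adjoint N K\<^sub>2 (K\<^sub>1 e))"
      using A L2_operator_L2[OF K1] by blast
    then show "L2_inner N (op_adjoint N K\<^sub>2 (K\<^sub>1 e)) e = L2_inner N (K\<^sub>1 e) (K\<^sub>2 e)"
      using L2_inner_commute by metis
  qed
qed

lemma HS_inner_commute:
  assumes "L2_operator N K\<^sub>1" "has_adjoint N K\<^sub>1" "L2_operator N K\<^sub>2" "has_adjoint N K\<^sub>2"
  shows "HS_inner N K\<^sub>2 K\<^sub>1 = cnj (HS_inner N K\<^sub>1 K\<^sub>2)"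
  unfolding HS_inner_eq_infsum[OF assms(3,1,2)] HS_inner_eq_infsum[OF assms(1,3,4)] infsum_cnj[symmetric]
  by (rule infsum_cong) (rule L2_inner_commute)

lemma HS_operator: "K \<in> HS N \<Longrightarrow> L2_operator N K"
  by (simp add: HS_def)

lemma HS_summable: "K \<in> HS N \<Longrightarrow> (\<lambda>e. (L2_norm N (K e))\<^sup>2) summable_on L2_basis N"
  by (simp add: HS_def)

lemma HS_inner_has_sum:
  assumes K1: "K\<^sub>1 \<in> HS N" and K2: "K\<^sub>2 \<in> HS N" "has_adjoint N K\<^sub>2"
  shows "((\<lambda>e. L2_inner N (K\<^sub>1 e) (K\<^sub>2 e)) has_sum HS_inner N K\<^sub>1 K\<^sub>2) (L2_basis N)"
proof -
  have "(\<lambda>e. norm (L2_inner N (K\<^sub>1 e) (K\<^sub>2 e))) summable_on L2_basis N"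
  proof (rule Infinite_Sum.abs_summable_on_comparison_test')
    show "(\<lambda>e. (L2_norm N (K\<^sub>1 e))\<^sup>2 + (L2_norm N (K\<^sub>2 e))\<^sup>2) summable_on L2_basis N"
      by (intro summable_on_add HS_summable K1 K2)
    fix e assume "e \<in> L2_basis N"
    then have "e \<in> L2 N" by (rule L2_onb_subset[OF L2_basis_onb])
    then have "cmod (L2_inner N (K\<^sub>1 e) (K\<^sub>2 e)) \<le> L2_norm N (K\<^sub>1 e) * L2_norm N (K\<^sub>2 e)"
      using K1 K2 by (intro L2_Cauchy_Schwarz) (auto intro: L2_operator_L2[OF HS_operator])
    also have "\<dots> \<le> (L2_norm N (K\<^sub>1 e))\<^sup>2 + (L2_norm N (K\<^sub>2 e))\<^sup>2"
      using norm_mult_le_sum_squares[of "of_real (L2_norm N (K\<^sub>1 e))" "of_real (L2_norm N (K\<^sub>2 e))"]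
      by (simp add: norm_mult L2_norm_nonneg)
    finally show "norm (L2_inner N (K\<^sub>1 e) (K\<^sub>2 e)) \<le> (L2_norm N (K\<^sub>1 e))\<^sup>2 + (L2_norm N (K\<^sub>2 e))\<^sup>2" .
  qed
  then have "(\<lambda>e. L2_inner N (K\<^sub>1 e) (K\<^sub>2 e)) summable_on L2_basis N"
    by (rule abs_summable_summable)
  then show ?thesis
    using HS_inner_eq_infsum[OF HS_operator[OF K1] HS_operator[OF K2(1)] K2(2)] by simp
qed

text \<open>Without summability both sides are zero by the convention for
  \<open>infsum\<close>.\<close>

lemma infsum_complex_of_real: "(\<Sum>\<^sub>\<infinity>x\<in>A. complex_of_real (f x)) = of_real (\<Sum>\<^sub>\<infinity>x\<in>A. f x)"
proof (cases "f summable_on A")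
  case True
  then show ?thesis by (intro infsumI has_sum_of_real has_sum_infsum)
next
  case False
  then have "\<not> (\<lambda>x. complex_of_real (f x)) summable_on A"
    using summable_on_Re[of "\<lambda>x. complex_of_real (f x)" A] by auto
  then show ?thesis using False by (simp add: infsum_not_exists)
qed

lemma HS_inner_self_infsum:
  assumes "L2_operator N K" "has_adjoint N K"
  shows "HS_inner N K K = of_real (\<Sum>\<^sub>\<infinity>e\<in>L2_basis N. (L2_norm N (K e))\<^sup>2)"
  unfolding HS_inner_eq_infsum[OF assms(1,1,2)] L2_inner_self_norm infsum_complex_of_real ..

lemma HS_norm_square_infsum:
  assumes "L2_operator N K" "has_adjoint N K"
  shows "(HS_norm N K)\<^sup>2 = (\<Sum>\<^sub>\<infinity>e\<in>L2_basis N. (L2_norm N (K e))\<^sup>2)"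
  using infsum_nonneg[of "L2_basis N" "\<lambda>e. (L2_norm N (K e))\<^sup>2"]
  by (simp add: HS_norm_def HS_inner_self_infsum[OF assms])

lemma HS_inner_self:
  assumes "L2_operator N K" "has_adjoint N K"
  shows "HS_inner N K K = of_real ((HS_norm N K)\<^sup>2)"
  by (simp only: HS_norm_square_infsum[OF assms] HS_inner_self_infsum[OF assms])

text \<open>Meant for operators built from \<open>source\<close>: its linearity in the source holds
  for square integrable arguments and at points of the space, so operators that agree mathematically
  need not be equal as functions.\<close>

lemma HS_norm_cong:
  assumes K: "L2_operator N K" "has_adjoint N K" and K': "L2_operator N K'" "has_adjoint N K'"
    and eq: "\<And>f. f \<in> L2 N \<Longrightarrow> AE x in N. K f x = K' f x"
  shows "HS_norm N K = HS_norm N K'"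
proof -
  have "(L2_norm N (K e))\<^sup>2 = (L2_norm N (K' e))\<^sup>2" if "e \<in> L2_basis N" for e
  proof -
    have "e \<in> L2 N" using that by (rule L2_onb_subset[OF L2_basis_onb])
    then have "L2_norm N (K e) = L2_norm N (K' e)"
      by (intro L2_norm_cong_AE L2_operator_L2[OF K(1)] L2_operator_L2[OF K'(1)] eq)
    then show ?thesis by simp
  qed
  then show ?thesis
    unfolding HS_norm_def HS_inner_self_infsum[OF K] HS_inner_self_infsum[OF K']
    by (simp cong: infsum_cong)
qed

text \<open>The expansion of \<open>L2_norm_square_add\<close> is summed over the basis; the same
  sum shows that the combination is Hilbert-Schmidt.\<close>

lemma HS_norm_square_comb:
  assumes K1: "K\<^sub>1 \<in> HS N" "has_adjoint N K\<^sub>1" and K2: "K\<^sub>2 \<in> HS N" "has_adjoint N K\<^sub>2"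
  shows "(\<lambda>\<phi> x. K\<^sub>1 \<phi> x + c * K\<^sub>2 \<phi> x) \<in> HS N"
    and "(HS_norm N (\<lambda>\<phi> x. K\<^sub>1 \<phi> x + c * K\<^sub>2 \<phi> x))\<^sup>2
       = (HS_norm N K\<^sub>1)\<^sup>2 + 2 * Re (cnj c * HS_inner N K\<^sub>1 K\<^sub>2) + (cmod c)\<^sup>2 * (HS_norm N K\<^sub>2)\<^sup>2"
proof -
  define K where "K \<phi> x = K\<^sub>1 \<phi> x + c * K\<^sub>2 \<phi> x" for \<phi> x
  note ops = HS_operator[OF K1(1)] HS_operator[OF K2(1)]
  have K: "L2_operator N K" "has_adjoint N K"
    unfolding K_def[abs_def] by (intro L2_operator_comb has_adjoint_comb ops K1 K2)+
  have "((\<lambda>e. (L2_norm N (K\<^sub>1 e))\<^sup>2 + 2 * Re (cnj c * L2_inner N (K\<^sub>1 e) (K\<^sub>2 e)) + (cmod c)\<^sup>2 * (L2_norm N (K\<^sub>2 e))\<^sup>2)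
      has_sum (HS_norm N K\<^sub>1)\<^sup>2 + 2 * Re (cnj c * HS_inner N K\<^sub>1 K\<^sub>2) + (cmod c)\<^sup>2 * (HS_norm N K\<^sub>2)\<^sup>2) (L2_basis N)"
    using K1 K2 ops
    by (intro has_sum_add has_sum_cmult_right has_sum_Re HS_inner_has_sum)
       (simp_all add: HS_norm_square_infsum HS_summable)
  also have "?this \<longleftrightarrow> ((\<lambda>e. (L2_norm N (K e))\<^sup>2)
      has_sum (HS_norm N K\<^sub>1)\<^sup>2 + 2 * Re (cnj c * HS_inner N K\<^sub>1 K\<^sub>2) + (cmod c)\<^sup>2 * (HS_norm N K\<^sub>2)\<^sup>2) (L2_basis N)"
  proof (rule has_sum_cong)
    fix e assume "e \<in> L2_basis N"
    then have e: "e \<in> L2 N" by (rule L2_onb_subset[OF L2_basis_onb])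
    show "(L2_norm N (K\<^sub>1 e))\<^sup>2 + 2 * Re (cnj c * L2_inner N (K\<^sub>1 e) (K\<^sub>2 e)) + (cmod c)\<^sup>2 * (L2_norm N (K\<^sub>2 e))\<^sup>2
        = (L2_norm N (K e))\<^sup>2"
      using L2_norm_square_add[OF L2_operator_L2[OF ops(1) e] L2_scale[OF L2_operator_L2[OF ops(2) e], of c]]
      by (simp add: K_def[abs_def] L2_norm_scale L2_inner_scale_right power_mult_distrib)
  qed
  finally have hs: "((\<lambda>e. (L2_norm N (K e))\<^sup>2)
      has_sum (HS_norm N K\<^sub>1)\<^sup>2 + 2 * Re (cnj c * HS_inner N K\<^sub>1 K\<^sub>2) + (cmod c)\<^sup>2 * (HS_norm N K\<^sub>2)\<^sup>2) (L2_basis N)" .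
  then show "(\<lambda>\<phi> x. K\<^sub>1 \<phi> x + c * K\<^sub>2 \<phi> x) \<in> HS N"
    using K(1) unfolding HS_def K_def[abs_def] by (auto simp: summable_on_def)
  show "(HS_norm N (\<lambda>\<phi> x. K\<^sub>1 \<phi> x + c * K\<^sub>2 \<phi> x))\<^sup>2
       = (HS_norm N K\<^sub>1)\<^sup>2 + 2 * Re (cnj c * HS_inner N K\<^sub>1 K\<^sub>2) + (cmod c)\<^sup>2 * (HS_norm N K\<^sub>2)\<^sup>2"
    using HS_norm_square_infsum[OF K] infsumI[OF hs] by (simp add: K_def[abs_def])
qed

section \<open>Rank-one operators and the quadratic minimum\<close>

definition rank_one :: "'a measure \<Rightarrow> ('a \<Rightarrow> complex) \<Rightarrow> 'a operator" where
  "rank_one N g \<phi> x = L2_inner N \<phi> g * g x"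

context
  fixes N :: "'a measure" and g
  assumes g: "g \<in> L2 N"
begin

lemma rank_one_operator: "L2_operator N (rank_one N g)"
  unfolding L2_operator_def
proof (intro conjI ballI allI)
  fix f assume f: "f \<in> L2 N"
  show "rank_one N g f \<in> L2 N" unfolding rank_one_def[abs_def] by (intro L2_scale g)
  fix h assume h: "h \<in> L2 N"
  show "AE x in N. rank_one N g (\<lambda>z. f z + h z) x = rank_one N g f x + rank_one N g h x"
    using f g h by (simp add: rank_one_def L2_inner_add_left distrib_right)
next
  fix c f
  show "AE x in N. rank_one N g (\<lambda>z. c * f z) x = c * rank_one N g f x"
    by (simp add: rank_one_def L2_inner_scale_left)
next
  have "L2_norm N (rank_one N g f) \<le> (L2_norm N g * L2_norm N g) * L2_norm N f" if f: "f \<in> L2 N" for f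
    using mult_right_mono[OF L2_Cauchy_Schwarz[OF f g] L2_norm_nonneg[of N g]]
    unfolding rank_one_def[abs_def] L2_norm_scale by (simp add: mult_ac)
  then show "\<exists>b. \<forall>f\<in>L2 N. L2_norm N (rank_one N g f) \<le> b * L2_norm N f" by blast
qed

lemma rank_one_self_adjoint: "self_adjoint N (rank_one N g)"
  unfolding self_adjoint_def
proof (intro ballI)
  fix f h
  show "L2_inner N (rank_one N g f) h = L2_inner N f (rank_one N g h)"
    using L2_inner_commute[of N g h]
    by (simp add: rank_one_def[abs_def] L2_inner_scale_left L2_inner_scale_right)
qed

lemma rank_one_has_adjoint: "has_adjoint N (rank_one N g)"
  by (intro self_adjoint_has_adjoint rank_one_operator rank_one_self_adjoint)

text \<open>Up to a constant, the norms of the images of the basis vectors are the moduli of the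
  coefficients of \<open>g\<close>, so Bessel's inequality applies.\<close>

lemma rank_one_HS: "rank_one N g \<in> HS N"
proof -
  have "(\<lambda>e. (L2_norm N g)\<^sup>2 * (cmod (L2_inner N g e))\<^sup>2) summable_on L2_basis N"
    by (intro summable_on_cmult_right Bessel_summable[OF L2_basis_onb g])
  moreover have "(L2_norm N (rank_one N g e))\<^sup>2 = (L2_norm N g)\<^sup>2 * (cmod (L2_inner N g e))\<^sup>2" for e
    unfolding L2_inner_commute[of N g e]
    by (simp add: rank_one_def[abs_def] L2_norm_scale power_mult_distrib)
  ultimately show ?thesis
    using rank_one_operator by (simp add: HS_def)
qed

text \<open>With an adjoint \<open>A\<close> of \<open>K\<close>, the term at \<open>e\<close>
  becomes the product of the inner products of \<open>g\<close> with \<open>e\<close> and of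
  \<open>e\<close> with \<open>A g\<close>. Parseval sums these to the inner product of
  \<open>g\<close> with \<open>A g\<close>, and \<open>A\<close> is moved back.\<close>

lemma HS_inner_rank_one:
  assumes K: "L2_operator N K" "has_adjoint N K"
  shows "HS_inner N K (rank_one N g) = L2_inner N (K g) g"
proof -
  obtain A where A: "L2_operator N A"
    "\<And>f h. f \<in> L2 N \<Longrightarrow> h \<in> L2 N \<Longrightarrow> L2_inner N (K f) h = L2_inner N f (A h)"
    using K(2) by (auto simp: has_adjoint_def)
  have "HS_inner N K (rank_one N g) = (\<Sum>\<^sub>\<infinity>e\<in>L2_basis N. L2_inner N g e * L2_inner N e (A g))"
    unfolding HS_inner_eq_infsum[OF K(1) rank_one_operator rank_one_has_adjoint]
  proof (rule infsum_cong)
    fix e assume "e \<in> L2_basis N"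
    then have "e \<in> L2 N" by (rule L2_onb_subset[OF L2_basis_onb])
    then show "L2_inner N (K e) (rank_one N g e) = L2_inner N g e * L2_inner N e (A g)"
      using A(2) g by (simp add: rank_one_def[abs_def] L2_inner_scale_right L2_inner_commute[of N e g])
  qed
  also have "\<dots> = L2_inner N g (A g)"
    by (intro infsumI Parseval[OF L2_basis_onb] g L2_operator_L2[OF A(1)])
  finally show ?thesis using A(2) g by simp
qed

end

lemma HS_inner_rank_one_rank_one:
  assumes "f \<in> L2 N" "g \<in> L2 N"
  shows "HS_inner N (rank_one N f) (rank_one N g) = of_real ((cmod (L2_inner N f g))\<^sup>2)"
proof -
  have "HS_inner N (rank_one N f) (rank_one N g) = L2_inner N g f * L2_inner N f g"
    unfolding HS_inner_rank_one[OF assms(2) rank_one_operator[OF assms(1)] rank_one_has_adjoint[OF assms(1)]]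
    by (simp add: rank_one_def[abs_def] L2_inner_scale_left)
  then show ?thesis
    by (simp only: L2_inner_commute[of N g f] complex_norm_square mult.commute)
qed

lemma HS_norm_rank_one_square:
  assumes "g \<in> L2 N"
  shows "(HS_norm N (rank_one N g))\<^sup>2 = L2_norm N g ^ 4"
proof -
  have "of_real ((HS_norm N (rank_one N g))\<^sup>2) = complex_of_real (((L2_norm N g)\<^sup>2)\<^sup>2)"
    unfolding HS_inner_self[OF rank_one_operator[OF assms] rank_one_has_adjoint[OF assms], symmetric]
    using assms by (simp add: HS_inner_rank_one_rank_one L2_inner_self_norm norm_power L2_norm_nonneg)
  then show ?thesis by (simp only: of_real_eq_iff) simp
qed

text \<open>Completing the square. Uniqueness is proved as well, because \<open>arg_min\<close> is a
  choice among all minimisers.\<close>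

lemma arg_min_quadratic:
  fixes a b c :: real
  assumes "c > 0"
  shows "arg_min (\<lambda>x. a - 2 * x * b + x\<^sup>2 * c) (\<lambda>_. True) = b / c"
proof -
  have sq: "a - 2 * x * b + x\<^sup>2 * c = (a - b\<^sup>2 / c) + c * (x - b / c)\<^sup>2" for x
    using assms by (simp add: power2_eq_square field_simps)
  have "is_arg_min (\<lambda>x. a - 2 * x * b + x\<^sup>2 * c) (\<lambda>_. True) (b / c)"
    unfolding sq is_arg_min_def using assms by (auto simp: not_less)
  moreover have "x = b / c" if "is_arg_min (\<lambda>x. a - 2 * x * b + x\<^sup>2 * c) (\<lambda>_. True) x" for x
  proof -
    have "\<not> (a - b\<^sup>2 / c) + c * (b / c - b / c)\<^sup>2 < (a - b\<^sup>2 / c) + c * (x - b / c)\<^sup>2"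
      using that unfolding sq is_arg_min_def by blast
    then have "c * (x - b / c)\<^sup>2 \<le> 0" by simp
    then show ?thesis using assms by (simp add: mult_le_0_iff)
  qed
  ultimately show ?thesis
    unfolding arg_min_def by (intro some_equality)
qed

section \<open>Superpositions of rank-one operators\<close>

text \<open>An abstraction of Green's function for regions whose closures may touch: the kernel may
  be unbounded on the product. Uniform control is required only of the column norms, by
  \<open>G\<close>; the bound on a row may depend on \<open>x\<close> and serves to justify Fubini
  at that fixed \<open>x\<close>.\<close>

locale source_kernel = N: finite_measure N + W: finite_measure W
  for N :: "'a measure" and W :: "'b measure" +
  fixes g :: "'a \<Rightarrow> 'b \<Rightarrow> complex" and G :: real
  assumes kernel_measurable: "(\<lambda>(x, y). g x y) \<in> borel_measurable (N \<Otimes>\<^sub>M W)"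
    and G_nonneg: "0 \<le> G"
    and column_L2: "y \<in> space W \<Longrightarrow> (\<lambda>x. g x y) \<in> L2 N"
    and column_norm: "y \<in> space W \<Longrightarrow> (L2_norm N (\<lambda>x. g x y))\<^sup>2 \<le> G"
    and row_bounded: "x \<in> space N \<Longrightarrow> \<exists>b. \<forall>y\<in>space W. cmod (g x y) \<le> b"
begin

sublocale WN: pair_sigma_finite W N ..

lemma kernel_measurable_comp [measurable (raw)]:
  assumes [measurable]: "u \<in> measurable X N" "v \<in> measurable X W"
  shows "(\<lambda>z. g (u z) (v z)) \<in> borel_measurable X"
proof -
  have "(\<lambda>z. case (u z, v z) of (x, y) \<Rightarrow> g x y) \<in> borel_measurable X"
    by (rule measurable_compose[OF _ kernel_measurable]) measurable
  then show ?thesis by simp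
qed

definition source :: "('b \<Rightarrow> complex) \<Rightarrow> 'a operator" where
  "source q \<phi> x\<^sub>1 = (LINT x\<^sub>2|N. (LINT y|W. g x\<^sub>1 y * q y * cnj (g x\<^sub>2 y)) * \<phi> x\<^sub>2)"

text \<open>With \<open>V\<close> the superposition of columns, \<open>steer\<close> is the adjoint
  of \<open>V\<close>, and \<open>source q\<close> is \<open>V\<close> after multiplication by
  \<open>q\<close> after \<open>steer\<close>.\<close>

definition steer :: "('a \<Rightarrow> complex) \<Rightarrow> 'b \<Rightarrow> complex" where
  "steer \<phi> y = L2_inner N \<phi> (\<lambda>x. g x y)"

definition beam :: "'a operator \<Rightarrow> 'b \<Rightarrow> complex" where
  "beam K y = L2_inner N (K (\<lambda>x. g x y)) (\<lambda>x. g x y)"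

section \<open>Fubini and the mapping properties of \<open>source\<close>\<close>

lemma steer_measurable [measurable]:
  assumes "\<phi> \<in> L2 N"
  shows "steer \<phi> \<in> borel_measurable W"
proof -
  note [measurable] = L2_measurable[OF assms]
  show ?thesis unfolding steer_def[abs_def] L2_inner_def by measurable
qed

lemma column_norm_sqrt: "y \<in> space W \<Longrightarrow> L2_norm N (\<lambda>x. g x y) \<le> sqrt G"
  using column_norm by (rule real_le_rsqrt)

lemma steer_bound:
  assumes "\<phi> \<in> L2 N" "y \<in> space W"
  shows "cmod (steer \<phi> y) \<le> L2_norm N \<phi> * sqrt G"
proof -
  have "cmod (steer \<phi> y) \<le> L2_norm N \<phi> * L2_norm N (\<lambda>x. g x y)"
    unfolding steer_def using assms by (intro L2_Cauchy_Schwarz column_L2)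
  also have "\<dots> \<le> L2_norm N \<phi> * sqrt G"
    using assms by (intro mult_left_mono column_norm_sqrt L2_norm_nonneg)
  finally show ?thesis .
qed

lemma integral_column_bound:
  assumes "\<phi> \<in> L2 N" "y \<in> space W"
  shows "(LINT x|N. cmod (g x y) * cmod (\<phi> x)) \<le> sqrt G * L2_norm N \<phi>"
proof -
  have "(LINT x|N. cmod (g x y) * cmod (\<phi> x)) \<le> L2_norm N (\<lambda>x. g x y) * L2_norm N \<phi>"
    using assms by (intro L2_Cauchy_Schwarz_norm column_L2)
  also have "\<dots> \<le> sqrt G * L2_norm N \<phi>"
    using assms by (intro mult_right_mono column_norm_sqrt L2_norm_nonneg)
  finally show ?thesis .
qed

text \<open>On a finite measure space a square integrable \<open>q\<close> is integrable, so its
  product with a bounded function is integrable too.\<close>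

lemma integrable_source_bounded:
  fixes f :: "'b \<Rightarrow> 'c :: {banach, second_countable_topology}"
  assumes q: "q \<in> L2 W" and [measurable]: "f \<in> borel_measurable W"
    and b: "\<And>y. y \<in> space W \<Longrightarrow> norm (f y) \<le> cmod (q y) * b"
  shows "integrable W f"
proof (rule Bochner_Integration.integrable_bound)
  show "integrable W (\<lambda>y. cmod (q y) * b)"
    using W.L2_integrable[OF q] by (intro integrable_mult_left integrable_norm)
  show "AE y in W. norm (f y) \<le> norm (cmod (q y) * b)"
    using b by (intro AE_I2) (auto intro: order_trans[OF _ abs_ge_self])
qed measurable

text \<open>Integrating over \<open>x\<close> first needs only the uniform column norms. The free
  factor \<open>f\<close> is a row \<open>g x\<close> at a fixed point in
  \<open>source_eq_steer\<close> and the function \<open>steer\<close> of the argument in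
  \<open>source_inner\<close>.\<close>

lemma integrable_source_product:
  assumes q: "q \<in> L2 W" and \<psi>: "\<psi> \<in> L2 N" and [measurable]: "f \<in> borel_measurable W"
    and b: "\<And>y. y \<in> space W \<Longrightarrow> cmod (f y) \<le> b"
  shows "integrable (W \<Otimes>\<^sub>M N) (\<lambda>(y, x). f y * q y * (g x y * cnj (\<psi> x)))" (is ?A)
    and "integrable (W \<Otimes>\<^sub>M N) (\<lambda>(y, x). f y * q y * (cnj (g x y) * \<psi> x))" (is ?B)
proof -
  note [measurable] = L2_measurable[OF q] L2_measurable[OF \<psi>]
  have int: "integrable W (\<lambda>y. LINT x|N. cmod (f y) * cmod (q y) * (cmod (g x y) * cmod (\<psi> x)))"
  proof (rule integrable_source_bounded[OF q])
    show "norm (LINT x|N. cmod (f y) * cmod (q y) * (cmod (g x y) * cmod (\<psi> x)))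
        \<le> cmod (q y) * (b * (sqrt G * L2_norm N \<psi>))" if y: "y \<in> space W" for y
    proof -
      have i: "integrable N (\<lambda>x. cmod (g x y) * cmod (\<psi> x))"
        by (rule L2_mult_integrable(2)[OF column_L2[OF y] \<psi>])
      have 0: "(LINT x|N. cmod (g x y) * cmod (\<psi> x)) \<ge> 0"
        by (rule Bochner_Integration.integral_nonneg) simp
      have "norm (LINT x|N. cmod (f y) * cmod (q y) * (cmod (g x y) * cmod (\<psi> x)))
          = cmod (q y) * (cmod (f y) * (LINT x|N. cmod (g x y) * cmod (\<psi> x)))"
        using 0 by (simp add: abs_mult)
      also have "\<dots> \<le> cmod (q y) * (b * (sqrt G * L2_norm N \<psi>))"
        using order_trans[OF norm_ge_zero b[OF y]] 0
        by (intro mult_left_mono mult_mono b integral_column_bound \<psi> y) auto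
      finally show ?thesis .
    qed
  qed measurable
  have AE: "AE y in W. integrable N (\<lambda>x. f y * q y * (g x y * cnj (\<psi> x)))
      \<and> integrable N (\<lambda>x. f y * q y * (cnj (g x y) * \<psi> x))"
  proof (intro AE_I2 conjI integrable_mult_right)
    fix y assume y: "y \<in> space W"
    show "integrable N (\<lambda>x. g x y * cnj (\<psi> x))"
      by (rule L2_mult_integrable(1)[OF column_L2[OF y] \<psi>])
    show "integrable N (\<lambda>x. cnj (g x y) * \<psi> x)"
      using L2_mult_integrable(1)[OF \<psi> column_L2[OF y]] by (simp add: mult.commute)
  qed
  show ?A
    using int AE by (intro WN.Fubini_integrable) (auto simp: norm_mult)
  show ?B
    using int AE by (intro WN.Fubini_integrable) (auto simp: norm_mult)
qed

text \<open>Fubini at a fixed \<open>x\<close>, with the row at \<open>x\<close> as the bounded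
  factor; the inner integral over the second variable is then \<open>steer\<close>.\<close>

lemma source_eq_steer:
  assumes q: "q \<in> L2 W" and \<phi>: "\<phi> \<in> L2 N" and x: "x \<in> space N"
  shows "source q \<phi> x = (LINT y|W. g x y * q y * steer \<phi> y)"
proof -
  obtain b where b: "\<And>y. y \<in> space W \<Longrightarrow> cmod (g x y) \<le> b" using row_bounded[OF x] by auto
  have [measurable]: "(\<lambda>y. g x y) \<in> borel_measurable W"
    using x by measurable
  have "source q \<phi> x = (LINT z|N. LINT y|W. g x y * q y * (cnj (g z y) * \<phi> z))"
    unfolding source_def by (simp flip: integral_mult_left_zero add: mult.assoc)
  also have "\<dots> = (LINT y|W. LINT z|N. g x y * q y * (cnj (g z y) * \<phi> z))"
    by (rule WN.Fubini_integral) (rule integrable_source_product(2)[OF q \<phi> _ b], measurable)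
  also have "\<dots> = (LINT y|W. g x y * q y * steer \<phi> y)"
    by (simp add: steer_def L2_inner_def mult.commute)
  finally show ?thesis .
qed

lemma integrable_row_steer:
  assumes q: "q \<in> L2 W" and \<phi>: "\<phi> \<in> L2 N" and x: "x \<in> space N"
  shows "integrable W (\<lambda>y. g x y * q y * steer \<phi> y)"
proof -
  note [measurable] = L2_measurable[OF q] steer_measurable[OF \<phi>]
  have [measurable]: "(\<lambda>y. g x y) \<in> borel_measurable W" using x by measurable
  obtain b where b: "\<And>y. y \<in> space W \<Longrightarrow> cmod (g x y) \<le> b" using row_bounded[OF x] by auto
  show ?thesis
  proof (rule integrable_source_bounded[OF q])
    show "(\<lambda>y. g x y * q y * steer \<phi> y) \<in> borel_measurable W" by measurable
    fix y assume y: "y \<in> space W"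
    have "cmod (g x y) * cmod (steer \<phi> y) \<le> b * (L2_norm N \<phi> * sqrt G)"
      using order_trans[OF norm_ge_zero b[OF y]]
      by (intro mult_mono b steer_bound \<phi> y) auto
    from mult_left_mono[OF this norm_ge_zero[of "q y"]]
    show "norm (g x y * q y * steer \<phi> y) \<le> cmod (q y) * (b * (L2_norm N \<phi> * sqrt G))"
      by (simp add: mult_ac norm_mult)
  qed
qed

text \<open>Cauchy-Schwarz with weight \<open>cmod (q y)\<close>, followed by integration over
  \<open>x\<close>. The integral of the squared \<open>steer\<close> is kept in the bound instead of
  being estimated, since \<open>source_HS\<close> sums it over basis vectors.\<close>

lemma source_L2:
  assumes q: "q \<in> L2 W" and \<phi>: "\<phi> \<in> L2 N"
  shows "source q \<phi> \<in> L2 N"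
    and "(L2_norm N (source q \<phi>))\<^sup>2
       \<le> G * (LINT y|W. cmod (q y)) * (LINT y|W. cmod (q y) * (cmod (steer \<phi> y))\<^sup>2)"
proof -
  note [measurable] = L2_measurable[OF q] L2_measurable[OF \<phi>] steer_measurable[OF \<phi>]
  define T where "T x = (LINT y|W. g x y * q y * steer \<phi> y)" for x
  define I where "I = (LINT y|W. cmod (q y) * (cmod (steer \<phi> y))\<^sup>2)"
  have I0: "I \<ge> 0" unfolding I_def by (rule Bochner_Integration.integral_nonneg) simp
  have Q0: "(LINT y|W. cmod (q y)) \<ge> 0" by (rule Bochner_Integration.integral_nonneg) simp
  have iI: "integrable W (\<lambda>y. cmod (q y) * (cmod (steer \<phi> y))\<^sup>2)"
    using steer_bound[OF \<phi>]
    by (intro integrable_source_bounded[OF q, where b = "(L2_norm N \<phi> * sqrt G)\<^sup>2"])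
       (auto intro!: mult_left_mono power_mono)
  have T[measurable]: "T \<in> borel_measurable N" unfolding T_def[abs_def] by measurable
  have pt: "(cmod (T x))\<^sup>2 \<le> (LINT y|W. cmod (q y) * (cmod (g x y))\<^sup>2) * I"
    and iA: "integrable W (\<lambda>y. cmod (q y) * (cmod (g x y))\<^sup>2)" if x: "x \<in> space N" for x
  proof -
    obtain b where b: "\<And>y. y \<in> space W \<Longrightarrow> cmod (g x y) \<le> b" using row_bounded[OF x] by auto
    have [measurable]: "(\<lambda>y. g x y) \<in> borel_measurable W"
      using x by measurable
    show iA: "integrable W (\<lambda>y. cmod (q y) * (cmod (g x y))\<^sup>2)"
      using b by (intro integrable_source_bounded[OF q, where b = "b\<^sup>2"])
         (auto intro!: mult_left_mono power_mono)
    have iB: "integrable W (\<lambda>y. cmod (g x y) * cmod (q y) * cmod (steer \<phi> y))"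
      using integrable_norm[OF integrable_row_steer[OF q \<phi> x]] by (simp add: norm_mult)
    \<comment> \<open>The weight is split evenly between the two factors of Cauchy-Schwarz.\<close>
    have uv: "sqrt (cmod (q y)) * cmod (g x y) * (sqrt (cmod (q y)) * cmod (steer \<phi> y))
        = cmod (g x y) * cmod (q y) * cmod (steer \<phi> y)" for y
      using real_sqrt_mult_self[of "cmod (q y)"] by (simp add: mult_ac)
    have "cmod (T x) \<le> (LINT y|W. cmod (g x y) * cmod (q y) * cmod (steer \<phi> y))"
      unfolding T_def using integral_norm_bound[of W "\<lambda>y. g x y * q y * steer \<phi> y"] by (simp add: norm_mult)
    then have "(cmod (T x))\<^sup>2 \<le> (LINT y|W. cmod (g x y) * cmod (q y) * cmod (steer \<phi> y))\<^sup>2"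
      by (intro power_mono) auto
    also have "\<dots> \<le> (LINT y|W. cmod (q y) * (cmod (g x y))\<^sup>2) * I"
      using integral_Cauchy_Schwarz[of W "\<lambda>y. sqrt (cmod (q y)) * cmod (g x y)"
          "\<lambda>y. sqrt (cmod (q y)) * cmod (steer \<phi> y)"] iA iB iI
      by (simp add: uv power_mult_distrib I_def)
    finally show "(cmod (T x))\<^sup>2 \<le> (LINT y|W. cmod (q y) * (cmod (g x y))\<^sup>2) * I" .
  qed
  have "(\<integral>\<^sup>+x. ennreal ((cmod (T x))\<^sup>2) \<partial>N)
      \<le> (\<integral>\<^sup>+x. (\<integral>\<^sup>+y. ennreal (cmod (q y) * (cmod (g x y))\<^sup>2) \<partial>W) * ennreal I \<partial>N)"
  proof (rule nn_integral_mono)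
    fix x assume x: "x \<in> space N"
    have "ennreal ((cmod (T x))\<^sup>2) \<le> ennreal ((LINT y|W. cmod (q y) * (cmod (g x y))\<^sup>2) * I)"
      using pt[OF x] by (rule ennreal_leI)
    also have "\<dots> = ennreal (LINT y|W. cmod (q y) * (cmod (g x y))\<^sup>2) * ennreal I"
      using I0 by (simp add: ennreal_mult')
    also have "ennreal (LINT y|W. cmod (q y) * (cmod (g x y))\<^sup>2)
        = (\<integral>\<^sup>+y. ennreal (cmod (q y) * (cmod (g x y))\<^sup>2) \<partial>W)"
      using iA[OF x] by (intro nn_integral_eq_integral[symmetric]) auto
    finally show "ennreal ((cmod (T x))\<^sup>2)
        \<le> (\<integral>\<^sup>+y. ennreal (cmod (q y) * (cmod (g x y))\<^sup>2) \<partial>W) * ennreal I" .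
  qed
  also have "\<dots> = (\<integral>\<^sup>+x. \<integral>\<^sup>+y. ennreal (cmod (q y) * (cmod (g x y))\<^sup>2) \<partial>W \<partial>N) * ennreal I"
    by (intro nn_integral_multc) measurable
  \<comment> \<open>Tonelli: with \<open>x\<close> as the inner variable the squared column norms
    appear, which are at most \<open>G\<close>.\<close>
  also have "(\<integral>\<^sup>+x. \<integral>\<^sup>+y. ennreal (cmod (q y) * (cmod (g x y))\<^sup>2) \<partial>W \<partial>N)
      = (\<integral>\<^sup>+y. \<integral>\<^sup>+x. ennreal (cmod (q y) * (cmod (g x y))\<^sup>2) \<partial>N \<partial>W)"
    by (rule WN.Fubini') measurable
  also have "\<dots> = (\<integral>\<^sup>+y. ennreal (cmod (q y)) * ennreal ((L2_norm N (\<lambda>x. g x y))\<^sup>2) \<partial>W)"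
  proof (rule nn_integral_cong)
    fix y assume y: "y \<in> space W"
    have [measurable]: "(\<lambda>x. g x y) \<in> borel_measurable N" using y by measurable
    show "(\<integral>\<^sup>+x. ennreal (cmod (q y) * (cmod (g x y))\<^sup>2) \<partial>N)
        = ennreal (cmod (q y)) * ennreal ((L2_norm N (\<lambda>x. g x y))\<^sup>2)"
      by (simp add: ennreal_mult nn_integral_cmult nn_integral_L2_norm[OF column_L2[OF y]])
  qed
  also have "\<dots> \<le> (\<integral>\<^sup>+y. ennreal (cmod (q y)) * ennreal G \<partial>W)"
    by (intro nn_integral_mono mult_left_mono ennreal_leI column_norm) auto
  also have "\<dots> = ennreal (LINT y|W. cmod (q y)) * ennreal G"
    using W.L2_integrable[OF q] by (simp add: nn_integral_multc nn_integral_eq_integral)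
  finally have le: "(\<integral>\<^sup>+x. ennreal ((cmod (T x))\<^sup>2) \<partial>N)
      \<le> ennreal (LINT y|W. cmod (q y)) * ennreal G * ennreal I"
    by (simp add: mult_right_mono)
  have pos: "G * (LINT y|W. cmod (q y)) * I \<ge> 0"
    using I0 Q0 G_nonneg by simp
  have le': "(\<integral>\<^sup>+x. ennreal ((cmod (T x))\<^sup>2) \<partial>N) \<le> ennreal ((sqrt (G * (LINT y|W. cmod (q y)) * I))\<^sup>2)"
    using le pos I0 Q0 G_nonneg by (simp add: ennreal_mult mult.commute)
  have eq: "source q \<phi> x = T x" if "x \<in> space N" for x
    unfolding T_def by (rule source_eq_steer[OF q \<phi> that])
  show "source q \<phi> \<in> L2 N"
    using L2_cong_space[of N "source q \<phi>" T] eq L2_nn_integralI(1)[OF T le'] by simp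
  have "L2_norm N (source q \<phi>) \<le> sqrt (G * (LINT y|W. cmod (q y)) * I)"
    using L2_norm_cong_space[of N "source q \<phi>" T] eq L2_nn_integralI(2)[OF T le'] pos by simp
  then show "(L2_norm N (source q \<phi>))\<^sup>2
       \<le> G * (LINT y|W. cmod (q y)) * (LINT y|W. cmod (q y) * (cmod (steer \<phi> y))\<^sup>2)"
    using pos power_mono[OF _ L2_norm_nonneg, of N "source q \<phi>" "sqrt (G * (LINT y|W. cmod (q y)) * I)" 2]
    by (simp add: I_def)
qed

text \<open>The sesquilinear form of \<open>source q\<close> is diagonal in \<open>y\<close>. The
  conjugate symmetry of its kernel is what yields the adjoint in
  \<open>source_has_adjoint\<close>.\<close>

lemma source_inner:
  assumes q: "q \<in> L2 W" and \<phi>: "\<phi> \<in> L2 N" and \<psi>: "\<psi> \<in> L2 N"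
  shows "L2_inner N (source q \<phi>) \<psi> = (LINT y|W. q y * (steer \<phi> y * cnj (steer \<psi> y)))"
proof -
  note [measurable] = steer_measurable[OF \<phi>]
  have "L2_inner N (source q \<phi>) \<psi> = (LINT x|N. (LINT y|W. g x y * q y * steer \<phi> y) * cnj (\<psi> x))"
    unfolding L2_inner_def using source_eq_steer[OF q \<phi>]
    by (intro Bochner_Integration.integral_cong) auto
  also have "\<dots> = (LINT x|N. LINT y|W. (g x y * q y * steer \<phi> y) * cnj (\<psi> x))"
    by (simp only: integral_mult_left_zero)
  also have "\<dots> = (LINT x|N. LINT y|W. steer \<phi> y * q y * (g x y * cnj (\<psi> x)))"
    by (simp only: mult_ac)
  also have "\<dots> = (LINT y|W. LINT x|N. steer \<phi> y * q y * (g x y * cnj (\<psi> x)))"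
    by (rule WN.Fubini_integral) (rule integrable_source_product(1)[OF q \<psi> _ steer_bound[OF \<phi>]], measurable)
  also have "\<dots> = (LINT y|W. steer \<phi> y * q y * L2_inner N (\<lambda>x. g x y) \<psi>)"
    by (simp add: L2_inner_def)
  also have "\<dots> = (LINT y|W. q y * (steer \<phi> y * cnj (steer \<psi> y)))"
    unfolding steer_def by (subst (2) L2_inner_commute) (simp add: mult_ac)
  finally show ?thesis .
qed

lemma integrable_source_steer:
  assumes q: "q \<in> L2 W" and \<phi>: "\<phi> \<in> L2 N" and \<psi>: "\<psi> \<in> L2 N"
  shows "integrable W (\<lambda>y. q y * (steer \<phi> y * cnj (steer \<psi> y)))"
proof (rule integrable_source_bounded[OF q])
  note [measurable] = L2_measurable[OF q] steer_measurable[OF \<phi>] steer_measurable[OF \<psi>]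
  show "(\<lambda>y. q y * (steer \<phi> y * cnj (steer \<psi> y))) \<in> borel_measurable W" by measurable
  fix y assume y: "y \<in> space W"
  show "norm (q y * (steer \<phi> y * cnj (steer \<psi> y)))
      \<le> cmod (q y) * ((L2_norm N \<phi> * sqrt G) * (L2_norm N \<psi> * sqrt G))"
    unfolding norm_mult complex_mod_cnj
    by (intro mult_left_mono mult_mono steer_bound \<phi> \<psi> y mult_nonneg_nonneg L2_norm_nonneg)
       (use G_nonneg in auto)
qed

lemma source_comb:
  assumes q: "q \<in> L2 W" and h: "h \<in> L2 W" and \<phi>: "\<phi> \<in> L2 N" and x: "x \<in> space N"
  shows "source (\<lambda>y. q y + c * h y) \<phi> x = source q \<phi> x + c * source h \<phi> x"
proof -
  have "source (\<lambda>y. q y + c * h y) \<phi> x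
      = (LINT y|W. g x y * q y * steer \<phi> y + c * (g x y * h y * steer \<phi> y))"
    unfolding source_eq_steer[OF L2_add[OF q L2_scale[OF h]] \<phi> x] by (simp add: algebra_simps)
  also have "\<dots> = source q \<phi> x + c * source h \<phi> x"
    using integrable_row_steer[OF q \<phi> x] integrable_row_steer[OF h \<phi> x] by (simp add: source_eq_steer q h \<phi> x)
  finally show ?thesis .
qed

text \<open>Inserting \<open>steer_bound\<close> into \<open>source_L2\<close> gives the operator
  bound \<open>G * Q\<close>, with \<open>Q\<close> the integral of
  \<open>cmod (q y)\<close>.\<close>

lemma source_operator:
  assumes q: "q \<in> L2 W"
  shows "L2_operator N (source q)"
  unfolding L2_operator_def
proof (intro conjI ballI allI)
  fix f assume f: "f \<in> L2 N"
  show "source q f \<in> L2 N" by (rule source_L2(1)[OF q f])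
  fix h assume h: "h \<in> L2 N"
  show "AE x in N. source q (\<lambda>z. f z + h z) x = source q f x + source q h x"
  proof (rule AE_I2)
    fix x assume x: "x \<in> space N"
    have "source q (\<lambda>z. f z + h z) x
        = (LINT y|W. g x y * q y * steer f y + g x y * q y * steer h y)"
      unfolding source_eq_steer[OF q L2_add[OF f h] x] using f h
      by (intro Bochner_Integration.integral_cong)
         (auto simp: steer_def L2_inner_add_left column_L2 distrib_left)
    then show "source q (\<lambda>z. f z + h z) x = source q f x + source q h x"
      using integrable_row_steer[OF q f x] integrable_row_steer[OF q h x] by (simp add: source_eq_steer q f h x)
  qed
next
  fix c f assume f: "f \<in> L2 N"
  show "AE x in N. source q (\<lambda>z. c * f z) x = c * source q f x"
    unfolding source_def by (simp flip: integral_mult_right_zero add: mult_ac)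
next
  define Q where "Q = (LINT y|W. cmod (q y))"
  have "L2_norm N (source q f) \<le> (G * Q) * L2_norm N f" if f: "f \<in> L2 N" for f
  proof -
    note G = G_nonneg
    have Q: "Q \<ge> 0" unfolding Q_def by (rule Bochner_Integration.integral_nonneg) simp
    note [measurable] = L2_measurable[OF q] steer_measurable[OF f]
    have "(LINT y|W. cmod (q y) * (cmod (steer f y))\<^sup>2) \<le> (LINT y|W. cmod (q y) * (L2_norm N f * sqrt G)\<^sup>2)"
    proof (rule integral_mono)
      show le: "cmod (q y) * (cmod (steer f y))\<^sup>2 \<le> cmod (q y) * (L2_norm N f * sqrt G)\<^sup>2"
        if "y \<in> space W" for y
        by (intro mult_left_mono power_mono steer_bound f that) auto
      then show "integrable W (\<lambda>y. cmod (q y) * (cmod (steer f y))\<^sup>2)"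
        by (intro integrable_source_bounded[OF q]) auto
      show "integrable W (\<lambda>y. cmod (q y) * (L2_norm N f * sqrt G)\<^sup>2)"
        using W.L2_integrable[OF q] by (intro integrable_mult_left integrable_norm)
    qed
    also have "\<dots> = Q * ((L2_norm N f)\<^sup>2 * G)" using G by (simp add: Q_def power_mult_distrib)
    finally have "(L2_norm N (source q f))\<^sup>2 \<le> G * Q * (Q * ((L2_norm N f)\<^sup>2 * G))"
      using source_L2(2)[OF q f] mult_left_mono[of _ _ "G * Q"] G Q unfolding Q_def
      by (meson mult_nonneg_nonneg order_trans)
    also have "\<dots> = ((G * Q) * L2_norm N f)\<^sup>2" by (simp add: power2_eq_square)
    finally show ?thesis
      by (rule power2_le_imp_le) (simp add: G Q L2_norm_nonneg)
  qed
  then show "\<exists>b. \<forall>f\<in>L2 N. L2_norm N (source q f) \<le> b * L2_norm N f" by blast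
qed

lemma source_has_adjoint:
  assumes q: "q \<in> L2 W"
  shows "has_adjoint N (source q)"
  unfolding has_adjoint_def
proof (intro exI[of _ "source (\<lambda>y. cnj (q y))"] conjI ballI)
  show "L2_operator N (source (\<lambda>y. cnj (q y)))" by (intro source_operator L2_cnj q)
  fix f h assume f: "f \<in> L2 N" and h: "h \<in> L2 N"
  have "L2_inner N f (source (\<lambda>y. cnj (q y)) h) = cnj (L2_inner N (source (\<lambda>y. cnj (q y)) h) f)"
    by (rule L2_inner_commute)
  also have "\<dots> = (LINT y|W. cnj (cnj (q y) * (steer h y * cnj (steer f y))))"
    unfolding source_inner[OF L2_cnj[OF q] h f] by (rule Bochner_Integration.integral_cnj[symmetric])
  also have "\<dots> = L2_inner N (source q f) h"
    unfolding source_inner[OF q f h] by (simp add: mult_ac)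
  finally show "L2_inner N (source q f) h = L2_inner N f (source (\<lambda>y. cnj (q y)) h)" ..
qed

text \<open>Summing the bound of \<open>source_L2\<close> over basis vectors brings the sum inside
  the integral, where Bessel's inequality for the column at \<open>y\<close> bounds it by
  \<open>G\<close>.\<close>

lemma source_HS:
  assumes q: "q \<in> L2 W"
  shows "source q \<in> HS N"
proof -
  define Q where "Q = (LINT y|W. cmod (q y))"
  have Q: "Q \<ge> 0" unfolding Q_def by (rule Bochner_Integration.integral_nonneg) simp
  have bound: "(\<Sum>e\<in>F. (L2_norm N (source q e))\<^sup>2) \<le> G * Q * (Q * G)"
    if F: "finite F" "F \<subseteq> L2_basis N" for F
  proof -
    note G = G_nonneg
    have e_L2: "e \<in> L2 N" if "e \<in> F" for e
      using that F L2_onb_subset[OF L2_basis_onb] by blast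
    note [measurable] = L2_measurable[OF q]
    have int: "integrable W (\<lambda>y. cmod (q y) * (cmod (steer e y))\<^sup>2)" if e: "e \<in> F" for e
    proof (rule integrable_source_bounded[OF q])
      note [measurable] = steer_measurable[OF e_L2[OF e]]
      show "(\<lambda>y. cmod (q y) * (cmod (steer e y))\<^sup>2) \<in> borel_measurable W" by measurable
      show "norm (cmod (q y) * (cmod (steer e y))\<^sup>2) \<le> cmod (q y) * (L2_norm N e * sqrt G)\<^sup>2"
        if "y \<in> space W" for y
        using steer_bound[OF e_L2[OF e] that] by (auto intro!: mult_left_mono power_mono)
    qed
    have "(\<Sum>e\<in>F. (L2_norm N (source q e))\<^sup>2)
        \<le> (\<Sum>e\<in>F. G * Q * (LINT y|W. cmod (q y) * (cmod (steer e y))\<^sup>2))"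
      unfolding Q_def by (intro sum_mono source_L2(2) q e_L2)
    also have "\<dots> = G * Q * (LINT y|W. cmod (q y) * (\<Sum>e\<in>F. (cmod (steer e y))\<^sup>2))"
      using int by (simp add: sum_distrib_left[symmetric])
        (simp add: sum_distrib_left)
    also have "\<dots> \<le> G * Q * (LINT y|W. cmod (q y) * G)"
    proof (intro mult_left_mono integral_mono)
      show "integrable W (\<lambda>y. cmod (q y) * (\<Sum>e\<in>F. (cmod (steer e y))\<^sup>2))"
        using int by (simp add: sum_distrib_left)
      show "integrable W (\<lambda>y. cmod (q y) * G)"
        using W.L2_integrable[OF q] by (intro integrable_mult_left integrable_norm)
      fix y assume y: "y \<in> space W"
      have "(\<Sum>e\<in>F. (cmod (steer e y))\<^sup>2) = (\<Sum>e\<in>F. (cmod (L2_inner N (\<lambda>x. g x y) e))\<^sup>2)"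
        unfolding steer_def by (subst L2_inner_commute) simp
      also have "\<dots> \<le> (L2_norm N (\<lambda>x. g x y))\<^sup>2"
        by (rule Bessel_inequality[OF L2_basis_onb F column_L2[OF y]])
      also have "\<dots> \<le> G" by (rule column_norm[OF y])
      finally show "(\<Sum>e\<in>F. (cmod (steer e y))\<^sup>2) \<le> G" .
    qed (use G Q in auto)
    also have "\<dots> = G * Q * (Q * G)" by (simp add: Q_def)
    finally show ?thesis .
  qed
  then have "(\<lambda>e. (L2_norm N (source q e))\<^sup>2) summable_on L2_basis N"
    by (intro nonneg_bdd_above_summable_on) (auto simp: bdd_above_def)
  then show ?thesis using source_operator[OF q] by (simp add: HS_def)
qed

section \<open>Expansion of \<open>beam\<close> over the basis and the adjoint of the forward
  operator\<close>

lemma steer_has_sum_beam: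
  assumes K: "K \<in> HS N" "has_adjoint N K" and y: "y \<in> space W"
  shows "((\<lambda>e. steer e y * cnj (steer (K e) y)) has_sum cnj (beam K y)) (L2_basis N)"
proof -
  note gy = column_L2[OF y]
  have "HS_inner N (rank_one N (\<lambda>x. g x y)) K = cnj (HS_inner N K (rank_one N (\<lambda>x. g x y)))"
    by (intro HS_inner_commute HS_operator K rank_one_operator rank_one_has_adjoint gy)
  also have "\<dots> = cnj (beam K y)"
    unfolding beam_def by (simp add: HS_inner_rank_one gy HS_operator K)
  finally have "((\<lambda>e. L2_inner N (rank_one N (\<lambda>x. g x y) e) (K e)) has_sum cnj (beam K y)) (L2_basis N)"
    using HS_inner_has_sum[OF rank_one_HS[OF gy] K] by simp
  moreover have "L2_inner N (rank_one N (\<lambda>x. g x y) e) (K e) = steer e y * cnj (steer (K e) y)" for e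
    unfolding rank_one_def[abs_def] L2_inner_scale_left steer_def
    by (simp add: L2_inner_commute[of N "\<lambda>x. g x y" "K e"])
  ultimately show ?thesis by simp
qed

text \<open>Cauchy-Schwarz and Bessel bound the tail of the series uniformly in \<open>y\<close>, so that no
  interchange theorem for uncountable sums is needed.\<close>

lemma steer_sum_approx:
  assumes K: "K \<in> HS N" "has_adjoint N K" and y: "y \<in> space W"
    and F: "finite F" "F \<subseteq> L2_basis N"
  shows "cmod (cnj (beam K y) - (\<Sum>e\<in>F. steer e y * cnj (steer (K e) y)))
       \<le> G * sqrt ((HS_norm N K)\<^sup>2 - (\<Sum>e\<in>F. (L2_norm N (K e))\<^sup>2))"
proof -
  let ?t = "\<lambda>e. steer e y * cnj (steer (K e) y)"
  define S where "S = (HS_norm N K)\<^sup>2"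
  have S: "((\<lambda>e. (L2_norm N (K e))\<^sup>2) has_sum S) (L2_basis N)"
    using HS_summable[OF K(1)] by (simp add: S_def HS_norm_square_infsum[OF HS_operator[OF K(1)] K(2)])
  note gy = column_L2[OF y]
  have e_L2: "e \<in> L2 N" if "e \<in> L2_basis N" for e
    using that by (rule L2_onb_subset[OF L2_basis_onb])
  \<comment> \<open>The uniform estimate is proved for finite sets \<open>F'\<close> above
    \<open>F\<close>; letting \<open>F'\<close> run through the net turns the sum over
    \<open>F'\<close> into the conjugate of \<open>beam K y\<close>.\<close>
  have bound: "cmod (sum ?t F' - sum ?t F) \<le> G * sqrt (S - (\<Sum>e\<in>F. (L2_norm N (K e))\<^sup>2))"
    if F': "finite F'" "F' \<subseteq> L2_basis N" "F \<subseteq> F'" for F'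
  proof -
    have D: "finite (F' - F)" "F' - F \<subseteq> L2_basis N" using F' by auto
    have "cmod (sum ?t F' - sum ?t F) = cmod (sum ?t (F' - F))"
      using F' by (simp add: sum_diff)
    also have "\<dots> \<le> (\<Sum>e\<in>F' - F. cmod (steer e y) * cmod (steer (K e) y))"
      by (rule order_trans[OF norm_sum]) (simp add: norm_mult)
    also have "\<dots> \<le> (\<Sum>e\<in>F' - F. \<bar>cmod (steer e y)\<bar> * \<bar>sqrt G * L2_norm N (K e)\<bar>)"
    proof (intro sum_mono mult_mono)
      fix e assume "e \<in> F' - F"
      then have "K e \<in> L2 N" using D e_L2 L2_operator_L2[OF HS_operator[OF K(1)]] by blast
      then show "cmod (steer (K e) y) \<le> \<bar>sqrt G * L2_norm N (K e)\<bar>"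
        using steer_bound[of "K e" y] y by (simp add: mult.commute)
    qed auto
    also have "\<dots> \<le> L2_set (\<lambda>e. cmod (steer e y)) (F' - F) * L2_set (\<lambda>e. sqrt G * L2_norm N (K e)) (F' - F)"
      by (rule L2_set_mult_ineq)
    also have "\<dots> \<le> sqrt G * (sqrt G * sqrt (S - (\<Sum>e\<in>F. (L2_norm N (K e))\<^sup>2)))"
    proof (rule mult_mono)
      have "(\<Sum>e\<in>F' - F. (cmod (steer e y))\<^sup>2) = (\<Sum>e\<in>F' - F. (cmod (L2_inner N (\<lambda>x. g x y) e))\<^sup>2)"
        unfolding steer_def by (subst L2_inner_commute) simp
      also have "\<dots> \<le> (L2_norm N (\<lambda>x. g x y))\<^sup>2"
        by (rule Bessel_inequality[OF L2_basis_onb D gy])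
      also have "\<dots> \<le> G" by (rule column_norm[OF y])
      finally show "L2_set (\<lambda>e. cmod (steer e y)) (F' - F) \<le> sqrt G"
        unfolding L2_set_def by (rule real_sqrt_le_mono)
      have "(\<Sum>e\<in>F' - F. (L2_norm N (K e))\<^sup>2) = (\<Sum>e\<in>F'. (L2_norm N (K e))\<^sup>2) - (\<Sum>e\<in>F. (L2_norm N (K e))\<^sup>2)"
        using F' by (intro sum_diff)
      also have "\<dots> \<le> S - (\<Sum>e\<in>F. (L2_norm N (K e))\<^sup>2)"
        using finite_sum_le_has_sum[OF S F'(1,2)] by simp
      finally have "(\<Sum>e\<in>F' - F. (L2_norm N (K e))\<^sup>2) \<le> S - (\<Sum>e\<in>F. (L2_norm N (K e))\<^sup>2)" .
      then have "G * (\<Sum>e\<in>F' - F. (L2_norm N (K e))\<^sup>2) \<le> G * (S - (\<Sum>e\<in>F. (L2_norm N (K e))\<^sup>2))"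
        using G_nonneg by (rule mult_left_mono)
      then show "L2_set (\<lambda>e. sqrt G * L2_norm N (K e)) (F' - F)
          \<le> sqrt G * sqrt (S - (\<Sum>e\<in>F. (L2_norm N (K e))\<^sup>2))"
        using G_nonneg
        by (simp add: L2_set_def power_mult_distrib real_sqrt_mult[symmetric] flip: sum_distrib_left)
    qed (use G_nonneg in \<open>auto simp: L2_set_nonneg\<close>)
    also have "\<dots> = G * sqrt (S - (\<Sum>e\<in>F. (L2_norm N (K e))\<^sup>2))"
      using G_nonneg by simp
    finally show ?thesis .
  qed
  have "((\<lambda>F'. cmod (sum ?t F' - sum ?t F)) \<longlongrightarrow> cmod (cnj (beam K y) - sum ?t F)) (finite_subsets_at_top (L2_basis N))"
    using steer_has_sum_beam[OF K y] unfolding has_sum_def by (intro tendsto_intros)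
  then have "cmod (cnj (beam K y) - sum ?t F) \<le> G * sqrt (S - (\<Sum>e\<in>F. (L2_norm N (K e))\<^sup>2))"
  proof (rule tendsto_upperbound)
    show "\<forall>\<^sub>F F' in finite_subsets_at_top (L2_basis N).
        cmod (sum ?t F' - sum ?t F) \<le> G * sqrt (S - (\<Sum>e\<in>F. (L2_norm N (K e))\<^sup>2))"
      unfolding eventually_finite_subsets_at_top using F bound by (intro exI[of _ F]) auto
  qed simp
  then show ?thesis by (simp only: S_def)
qed

lemma HS_tail_tendsto:
  assumes K: "K \<in> HS N" "has_adjoint N K"
  shows "((\<lambda>F. G * sqrt ((HS_norm N K)\<^sup>2 - (\<Sum>e\<in>F. (L2_norm N (K e))\<^sup>2))) \<longlongrightarrow> 0)
    (finite_subsets_at_top (L2_basis N))"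
proof -
  have "((\<lambda>e. (L2_norm N (K e))\<^sup>2) has_sum (HS_norm N K)\<^sup>2) (L2_basis N)"
    using HS_summable[OF K(1)] by (simp add: HS_norm_square_infsum[OF HS_operator[OF K(1)] K(2)])
  then have "((\<lambda>F. G * sqrt ((HS_norm N K)\<^sup>2 - (\<Sum>e\<in>F. (L2_norm N (K e))\<^sup>2)))
      \<longlongrightarrow> G * sqrt ((HS_norm N K)\<^sup>2 - (HS_norm N K)\<^sup>2)) (finite_subsets_at_top (L2_basis N))"
    unfolding has_sum_def by (intro tendsto_intros)
  then show ?thesis by simp
qed

text \<open>For a general \<open>K\<close> the dependence of \<open>K\<close> applied to the column
  on \<open>y\<close> is not explicit. The finite partial sums of the expansion are visibly
  measurable, and the uniform tail estimate provides a sequence of them that converges at every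
  \<open>y\<close>.\<close>

lemma beam_measurable:
  assumes K: "K \<in> HS N" "has_adjoint N K"
  shows "beam K \<in> borel_measurable W"
proof -
  define d where "d F = G * sqrt ((HS_norm N K)\<^sup>2 - (\<Sum>e\<in>F. (L2_norm N (K e))\<^sup>2))" for F
  have "\<exists>F. finite F \<and> F \<subseteq> L2_basis N \<and> d F < 1 / Suc n" for n
  proof -
    have "\<forall>\<^sub>F F in finite_subsets_at_top (L2_basis N). d F < 1 / Suc n"
      using HS_tail_tendsto[OF K] unfolding d_def by (rule order_tendstoD) simp
    then show ?thesis unfolding eventually_finite_subsets_at_top by blast
  qed
  then obtain F where F: "\<And>n. finite (F n)" "\<And>n. F n \<subseteq> L2_basis N" "\<And>n. d (F n) < 1 / Suc n"
    by metis
  have e_L2: "e \<in> L2 N" "K e \<in> L2 N" if "e \<in> F n" for e n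
    using that F(2)[of n] L2_onb_subset[OF L2_basis_onb] L2_operator_L2[OF HS_operator[OF K(1)]] by auto
  have m: "(\<lambda>y. \<Sum>e\<in>F n. steer e y * cnj (steer (K e) y)) \<in> borel_measurable W" for n
    by (intro borel_measurable_sum borel_measurable_times borel_measurable_cnj steer_measurable e_L2)
  have "(\<lambda>y. cnj (beam K y)) \<in> borel_measurable W"
  proof (rule borel_measurable_LIMSEQ_metric[OF m])
    fix y assume y: "y \<in> space W"
    have "(\<lambda>n. (\<Sum>e\<in>F n. steer e y * cnj (steer (K e) y)) - cnj (beam K y)) \<longlonglongrightarrow> 0"
    proof (rule Lim_null_comparison)
      have "norm ((\<Sum>e\<in>F n. steer e y * cnj (steer (K e) y)) - cnj (beam K y)) \<le> 1 / Suc n" for n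
        using order_trans[OF steer_sum_approx[OF K y F(1,2)[of n]] less_imp_le[OF F(3)[of n, unfolded d_def]]]
        by (simp only: norm_minus_commute)
      then show "\<forall>\<^sub>F n in sequentially. norm ((\<Sum>e\<in>F n. steer e y * cnj (steer (K e) y)) - cnj (beam K y)) \<le> 1 / Suc n"
        by simp
      show "(\<lambda>n. 1 / real (Suc n)) \<longlonglongrightarrow> 0" by (rule LIMSEQ_Suc[OF lim_1_over_n])
    qed
    then show "(\<lambda>n. \<Sum>e\<in>F n. steer e y * cnj (steer (K e) y)) \<longlonglongrightarrow> cnj (beam K y)"
      by (subst Lim_null)
  qed
  then have "(\<lambda>y. cnj (cnj (beam K y))) \<in> borel_measurable W" by measurable
  then show ?thesis by simp
qed

lemma beam_L2:
  assumes K: "K \<in> HS N" "has_adjoint N K"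
  shows "beam K \<in> L2 W"
proof -
  obtain b where b: "b \<ge> 0" "\<And>f. f \<in> L2 N \<Longrightarrow> L2_norm N (K f) \<le> b * L2_norm N f"
    using L2_operator_bounded[OF HS_operator[OF K(1)]] by blast
  show ?thesis
  proof (rule W.L2_boundedI[OF beam_measurable[OF K]])
    fix y assume y: "y \<in> space W"
    have "cmod (beam K y) \<le> L2_norm N (K (\<lambda>x. g x y)) * L2_norm N (\<lambda>x. g x y)"
      unfolding beam_def
      by (intro L2_Cauchy_Schwarz L2_operator_L2[OF HS_operator[OF K(1)]] column_L2 y)
    also have "\<dots> \<le> (b * L2_norm N (\<lambda>x. g x y)) * L2_norm N (\<lambda>x. g x y)"
      by (intro mult_right_mono b column_L2 y L2_norm_nonneg)
    also have "\<dots> = b * (L2_norm N (\<lambda>x. g x y))\<^sup>2" by (simp add: power2_eq_square)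
    also have "\<dots> \<le> b * G" by (intro mult_left_mono column_norm y b)
    finally show "cmod (beam K y) \<le> b * G" .
  qed
qed

text \<open>The uniform tail estimate is integrated against \<open>cmod (q y)\<close>: finite sums
  commute with the integral, and the error \<open>d F * Q\<close> tends to zero. This identifies
  \<open>beam K\<close> as the image of \<open>K\<close> under the adjoint of the forward
  operator.\<close>

lemma HS_inner_source:
  assumes q: "q \<in> L2 W" and K: "K \<in> HS N" "has_adjoint N K"
  shows "HS_inner N (source q) K = L2_inner W q (beam K)"
proof -
  let ?B = "L2_basis N"
  define d where "d F = G * sqrt ((HS_norm N K)\<^sup>2 - (\<Sum>e\<in>F. (L2_norm N (K e))\<^sup>2))" for F
  define Q where "Q = (LINT y|W. cmod (q y))"
  have e_L2: "e \<in> L2 N" "K e \<in> L2 N" if "e \<in> ?B" for e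
    using that L2_onb_subset[OF L2_basis_onb] L2_operator_L2[OF HS_operator[OF K(1)]] by auto
  have "((\<lambda>F. d F * Q) \<longlongrightarrow> 0 * Q) (finite_subsets_at_top ?B)"
    unfolding d_def by (intro tendsto_mult_right HS_tail_tendsto K)
  then have "((\<lambda>F. d F * Q) \<longlongrightarrow> 0) (finite_subsets_at_top ?B)" by simp
  then have "((\<lambda>F. (\<Sum>e\<in>F. L2_inner N (source q e) (K e)) - L2_inner W q (beam K)) \<longlongrightarrow> 0) (finite_subsets_at_top ?B)"
  proof (rule Lim_null_comparison[rotated])
    have "cmod ((\<Sum>e\<in>F. L2_inner N (source q e) (K e)) - L2_inner W q (beam K)) \<le> d F * Q"
      if F: "finite F" "F \<subseteq> ?B" for F
    proof -
      let ?t = "\<lambda>y e. steer e y * cnj (steer (K e) y)"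
      have i: "integrable W (\<lambda>y. q y * ?t y e)" if "e \<in> F" for e
        using that F by (intro integrable_source_steer q e_L2) auto
      have iw: "integrable W (\<lambda>y. q y * cnj (beam K y))"
        by (intro L2_mult_integrable q beam_L2 K)
      have "(\<Sum>e\<in>F. L2_inner N (source q e) (K e)) = (\<Sum>e\<in>F. (LINT y|W. q y * ?t y e))"
        using F by (intro sum.cong refl source_inner q e_L2) auto
      also have "\<dots> = (LINT y|W. (\<Sum>e\<in>F. q y * ?t y e))"
        using i by (subst Bochner_Integration.integral_sum) auto
      finally have "L2_inner W q (beam K) - (\<Sum>e\<in>F. L2_inner N (source q e) (K e))
          = (LINT y|W. q y * (cnj (beam K y) - sum (?t y) F))"
        using i iw by (simp add: L2_inner_def sum_distrib_left right_diff_distrib)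
      then have "cmod ((\<Sum>e\<in>F. L2_inner N (source q e) (K e)) - L2_inner W q (beam K))
          = cmod (LINT y|W. q y * (cnj (beam K y) - sum (?t y) F))"
        by (simp add: norm_minus_commute)
      also have "\<dots> \<le> (LINT y|W. norm (q y * (cnj (beam K y) - sum (?t y) F)))"
        by (rule integral_norm_bound)
      also have "\<dots> \<le> (LINT y|W. d F * cmod (q y))"
      proof (rule integral_mono[OF integrable_norm])
        show "integrable W (\<lambda>y. q y * (cnj (beam K y) - sum (?t y) F))"
          using i iw by (simp add: sum_distrib_left right_diff_distrib)
        show "integrable W (\<lambda>y. d F * cmod (q y))"
          using W.L2_integrable[OF q] by (intro integrable_mult_right integrable_norm)
        fix y assume y: "y \<in> space W"
        show "norm (q y * (cnj (beam K y) - sum (?t y) F)) \<le> d F * cmod (q y)"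
          using mult_left_mono[OF steer_sum_approx[OF K y F] norm_ge_zero[of "q y"]]
          by (simp add: norm_mult d_def mult.commute)
      qed
      finally show ?thesis by (simp add: Q_def)
    qed
    then show "\<forall>\<^sub>F F in finite_subsets_at_top ?B.
        norm ((\<Sum>e\<in>F. L2_inner N (source q e) (K e)) - L2_inner W q (beam K)) \<le> d F * Q"
      by (intro eventually_finite_subsets_at_top_weakI) auto
  qed
  then have "((\<lambda>e. L2_inner N (source q e) (K e)) has_sum L2_inner W q (beam K)) ?B"
    unfolding has_sum_def by (subst Lim_null)
  then show ?thesis
    using HS_inner_has_sum[OF source_HS[OF q] K] by (rule has_sum_unique[symmetric])
qed

text \<open>\<open>beam K\<close> is a witness for the choice, and testing the defining property
  with \<open>f - beam K\<close> shows that any choice agrees with it almost everywhere.\<close>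

lemma source_adjoint_eq_beam:
  assumes K: "K \<in> HS N" "has_adjoint N K"
    and f: "f = (SOME f. f \<in> L2 W \<and> (\<forall>q\<in>L2 W. HS_inner N (source q) K = L2_inner W q f))"
  shows "AE y in W. f y = beam K y"
proof -
  have "f \<in> L2 W \<and> (\<forall>q\<in>L2 W. HS_inner N (source q) K = L2_inner W q f)"
    unfolding f by (rule someI[of _ "beam K"]) (simp add: beam_L2 HS_inner_source K)
  then have f': "f \<in> L2 W" "\<And>q. q \<in> L2 W \<Longrightarrow> L2_inner W q (beam K) = L2_inner W q f"
    using HS_inner_source[OF _ K] by auto
  define r where "r y = f y - beam K y" for y
  have r: "r \<in> L2 W" unfolding r_def by (intro L2_diff f' beam_L2 K)
  have "L2_inner W r r = L2_inner W r f - L2_inner W r (beam K)"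
    using f' r beam_L2[OF K] unfolding r_def by (intro L2_inner_diff_right)
  then have "L2_norm W r = 0" using f'(2)[OF r] by (simp add: L2_norm_def)
  then show ?thesis using L2_norm_eq_0_iff[OF r] by (simp add: r_def)
qed

section \<open>The least squares problem\<close>

lemma beam_diff:
  assumes "L2_operator N K\<^sub>1" "L2_operator N K\<^sub>2" "y \<in> space W"
  shows "beam (\<lambda>\<phi> x. K\<^sub>1 \<phi> x - K\<^sub>2 \<phi> x) y = beam K\<^sub>1 y - beam K\<^sub>2 y"
  unfolding beam_def using assms by (intro L2_inner_diff_left column_L2) (auto intro: L2_operator_L2 column_L2)

lemma residual_HS:
  assumes q: "q \<in> L2 W" and C: "C \<in> HS N" "has_adjoint N C"
  shows "(\<lambda>\<phi> x. source q \<phi> x - C \<phi> x) \<in> HS N" "has_adjoint N (\<lambda>\<phi> x. source q \<phi> x - C \<phi> x)"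
proof -
  note s = source_HS[OF q] source_has_adjoint[OF q]
  show "(\<lambda>\<phi> x. source q \<phi> x - C \<phi> x) \<in> HS N"
    using HS_norm_square_comb(1)[OF s C, of "- 1"] by simp
  show "has_adjoint N (\<lambda>\<phi> x. source q \<phi> x - C \<phi> x)"
    using has_adjoint_comb[OF HS_operator[OF s(1)] s(2) HS_operator[OF C(1)] C(2), of "- 1"] by simp
qed

text \<open>The residual at \<open>q + c h\<close> is \<open>D\<close> plus \<open>c\<close> times
  \<open>source h\<close>; \<open>HS_inner_source\<close> rewrites the cross term as a pairing of
  \<open>h\<close> with \<open>beam D\<close>. Thus \<open>beam D\<close> is the gradient of the
  functional up to a factor.\<close>

lemma residual_expansion:
  assumes q: "q \<in> L2 W" and h: "h \<in> L2 W" and C: "C \<in> HS N" "has_adjoint N C"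
  defines "D \<equiv> \<lambda>\<phi> x. source q \<phi> x - C \<phi> x"
  shows "(HS_norm N (\<lambda>\<phi> x. source (\<lambda>y. q y + c * h y) \<phi> x - C \<phi> x))\<^sup>2
       = (HS_norm N D)\<^sup>2 + 2 * Re (c * L2_inner W h (beam D)) + (cmod c)\<^sup>2 * (HS_norm N (source h))\<^sup>2"
proof -
  have D: "D \<in> HS N" "has_adjoint N D"
    unfolding D_def by (intro residual_HS q C)+
  note sh = source_HS[OF h] source_has_adjoint[OF h]
  note qh = L2_add[OF q L2_scale[OF h, of c]]
  have "HS_norm N (\<lambda>\<phi> x. source (\<lambda>y. q y + c * h y) \<phi> x - C \<phi> x)
      = HS_norm N (\<lambda>\<phi> x. D \<phi> x + c * source h \<phi> x)"
  proof (rule HS_norm_cong)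
    show "L2_operator N (\<lambda>\<phi> x. source (\<lambda>y. q y + c * h y) \<phi> x - C \<phi> x)"
      "has_adjoint N (\<lambda>\<phi> x. source (\<lambda>y. q y + c * h y) \<phi> x - C \<phi> x)"
      using residual_HS[OF qh C] by (auto intro: HS_operator)
    show "L2_operator N (\<lambda>\<phi> x. D \<phi> x + c * source h \<phi> x)"
      by (intro L2_operator_comb HS_operator D sh)
    show "has_adjoint N (\<lambda>\<phi> x. D \<phi> x + c * source h \<phi> x)"
      by (intro has_adjoint_comb HS_operator D sh)
    show "AE x in N. source (\<lambda>y. q y + c * h y) f x - C f x = D f x + c * source h f x"
      if "f \<in> L2 N" for f
      using source_comb[OF q h that] by (intro AE_I2) (simp add: D_def)
  qed
  moreover have "HS_inner N D (source h) = cnj (L2_inner W h (beam D))"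
    using HS_inner_commute[OF HS_operator[OF sh(1)] sh(2) HS_operator[OF D(1)] D(2)] HS_inner_source[OF h D]
    by simp
  moreover have "Re (cnj c * cnj z) = Re (c * z)" for z by simp
  ultimately show ?thesis
    using HS_norm_square_comb(2)[OF D sh, of c] by simp
qed

text \<open>Both conditions say that \<open>beam D\<close> is null. If it is, the expansion has no
  linear term and its quadratic term is nonnegative; otherwise a short step along
  \<open>- beam D\<close> lowers the value.\<close>

lemma normal_equation_iff_arg_min:
  assumes q: "q \<in> L2 W" and C: "C \<in> HS N" "has_adjoint N C"
  shows "(AE y in W. beam (source q) y = beam C y) \<longleftrightarrow>
    is_arg_min (\<lambda>q'. (HS_norm N (\<lambda>\<phi> x. source q' \<phi> x - C \<phi> x))\<^sup>2) (\<lambda>q'. q' \<in> L2 W) q"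
proof -
  define D where "D \<phi> x = source q \<phi> x - C \<phi> x" for \<phi> x
  have D: "D \<in> HS N" "has_adjoint N D"
    unfolding D_def[abs_def] by (intro residual_HS q C)+
  have beam_D: "beam D y = beam (source q) y - beam C y" if "y \<in> space W" for y
    unfolding D_def[abs_def] by (intro beam_diff HS_operator source_HS q C that)
  have "(AE y in W. beam (source q) y = beam C y) \<longleftrightarrow> (AE y in W. beam D y = 0)"
    using beam_D by (intro AE_cong) auto
  also have "\<dots> \<longleftrightarrow> L2_norm W (beam D) = 0"
    using L2_norm_eq_0_iff[OF beam_L2[OF D]] ..
  also have "\<dots> \<longleftrightarrow> is_arg_min (\<lambda>q'. (HS_norm N (\<lambda>\<phi> x. source q' \<phi> x - C \<phi> x))\<^sup>2) (\<lambda>q'. q' \<in> L2 W) q"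
  proof
    assume 0: "L2_norm W (beam D) = 0"
    have "(HS_norm N D)\<^sup>2 \<le> (HS_norm N (\<lambda>\<phi> x. source q' \<phi> x - C \<phi> x))\<^sup>2" if q': "q' \<in> L2 W" for q'
    proof -
      have h: "(\<lambda>y. q' y - q y) \<in> L2 W" by (intro L2_diff q q')
      have "L2_inner W (\<lambda>y. q' y - q y) (beam D) = 0"
        using L2_Cauchy_Schwarz[OF h beam_L2[OF D]] 0 by simp
      then show ?thesis
        using residual_expansion[OF q h C, of 1] by (simp add: D_def[abs_def])
    qed
    then show "is_arg_min (\<lambda>q'. (HS_norm N (\<lambda>\<phi> x. source q' \<phi> x - C \<phi> x))\<^sup>2) (\<lambda>q'. q' \<in> L2 W) q"
      using q by (simp add: is_arg_min_def not_less D_def[abs_def])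
  next
    assume min: "is_arg_min (\<lambda>q'. (HS_norm N (\<lambda>\<phi> x. source q' \<phi> x - C \<phi> x))\<^sup>2) (\<lambda>q'. q' \<in> L2 W) q"
    define A B where "A = (L2_norm W (beam D))\<^sup>2" and "B = (HS_norm N (source (beam D)))\<^sup>2"
    have B: "B \<ge> 0" by (simp add: B_def)
    have ge: "t\<^sup>2 * B \<ge> 2 * t * A" for t :: real
    proof -
      \<comment> \<open>The competitor moves a distance \<open>t\<close> in the direction of
        descent, so the linear term becomes \<open>- 2 * t * A\<close>.\<close>
      have "(\<lambda>y. q y + of_real (- t) * beam D y) \<in> L2 W"
        by (intro L2_add L2_scale q beam_L2 D)
      then have "(HS_norm N D)\<^sup>2 \<le> (HS_norm N (\<lambda>\<phi> x. source (\<lambda>y. q y + of_real (- t) * beam D y) \<phi> x - C \<phi> x))\<^sup>2"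
        using min unfolding is_arg_min_def D_def[abs_def] by (auto simp: not_less)
      also have "\<dots> = (HS_norm N D)\<^sup>2 + 2 * Re (of_real (- t) * L2_inner W (beam D) (beam D)) + (cmod (of_real (- t)))\<^sup>2 * B"
        using residual_expansion[OF q beam_L2[OF D] C, of "of_real (- t)"] unfolding D_def[abs_def] B_def .
      also have "\<dots> = (HS_norm N D)\<^sup>2 - 2 * t * A + t\<^sup>2 * B"
        by (simp add: L2_inner_self_norm A_def)
      finally show ?thesis by simp
    qed
    have "A \<le> 0"
    proof (rule ccontr)
      assume "\<not> A \<le> 0"
      then have A: "A > 0" by simp
      \<comment> \<open>A step short enough that the quadratic term is dominated:
        \<open>t * B <= A < 2 * A\<close>. The \<open>1\<close> in the denominator covers the case
        \<open>B = 0\<close>.\<close>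
      define t where "t = A / (B + 1)"
      have t: "t > 0" using A B by (simp add: t_def)
      have "t * (t * B) \<ge> t * (2 * A)" using ge[of t] by (simp add: power2_eq_square mult_ac)
      then have "t * B \<ge> 2 * A" using t by simp
      moreover have "t * B \<le> A" using A B by (simp add: t_def field_simps)
      ultimately show False using A by simp
    qed
    then show "L2_norm W (beam D) = 0" by (simp add: A_def)
  qed
  finally show ?thesis .
qed

section \<open>The two sides of the DAMAS equation, and the regularity of \<open>beam\<close> in
  \<open>y\<close>\<close>

lemma beamforming_eq_beam:
  assumes C: "C \<in> HS N" "self_adjoint N C" and y: "y \<in> space W" and pos: "L2_norm N (\<lambda>x. g x y) > 0"
  shows "of_real (arg_min (\<lambda>\<mu>. (HS_norm N (\<lambda>\<phi> x. C \<phi> x - of_real \<mu> * rank_one N (\<lambda>x. g x y) \<phi> x))\<^sup>2) (\<lambda>_. True))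
      = beam C y / of_real (L2_norm N (\<lambda>x. g x y) ^ 4)"
proof -
  note gy = column_L2[OF y]
  have adj: "has_adjoint N C" using C HS_operator self_adjoint_has_adjoint by blast
  \<comment> \<open>Minimisation over real numbers sees only the real part of the inner product;
    self-adjointness makes that part the whole of it.\<close>
  have "beam C y = cnj (beam C y)"
    using C(2) gy unfolding beam_def self_adjoint_def
    by (subst L2_inner_commute) simp
  then have real: "beam C y = of_real (Re (beam C y))"
    using Reals_cnj_iff[of "beam C y"] of_real_Re[of "beam C y"] by simp
  have "(HS_norm N (\<lambda>\<phi> x. C \<phi> x - of_real \<mu> * rank_one N (\<lambda>x. g x y) \<phi> x))\<^sup>2
      = (HS_norm N C)\<^sup>2 - 2 * \<mu> * Re (beam C y) + \<mu>\<^sup>2 * L2_norm N (\<lambda>x. g x y) ^ 4" for \<mu> :: real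
    using HS_norm_square_comb(2)[OF C(1) adj rank_one_HS[OF gy] rank_one_has_adjoint[OF gy], of "- of_real \<mu>"]
    by (simp add: HS_norm_rank_one_square gy HS_inner_rank_one HS_operator C adj beam_def)
  then have "arg_min (\<lambda>\<mu>. (HS_norm N (\<lambda>\<phi> x. C \<phi> x - of_real \<mu> * rank_one N (\<lambda>x. g x y) \<phi> x))\<^sup>2) (\<lambda>_. True)
      = Re (beam C y) / L2_norm N (\<lambda>x. g x y) ^ 4"
    using pos by (simp add: arg_min_quadratic)
  then show ?thesis by (subst real) simp
qed

text \<open>The numerator of the point-spread function is the squared modulus of
  \<open>steer\<close> of the column at \<open>y\<close>, so its integral against \<open>q\<close>
  is the diagonal form of \<open>source_inner\<close> with both arguments equal to that
  column.\<close>

lemma integral_psf_eq_beam: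
  assumes q: "q \<in> L2 W" and y: "y \<in> space W"
  shows "(LINT y'|W. HS_inner N (rank_one N (\<lambda>x. g x y)) (rank_one N (\<lambda>x. g x y'))
        / of_real ((HS_norm N (rank_one N (\<lambda>x. g x y)))\<^sup>2) * q y')
      = beam (source q) y / of_real (L2_norm N (\<lambda>x. g x y) ^ 4)"
proof -
  note gy = column_L2[OF y]
  have "(LINT y'|W. HS_inner N (rank_one N (\<lambda>x. g x y)) (rank_one N (\<lambda>x. g x y'))
        / of_real ((HS_norm N (rank_one N (\<lambda>x. g x y)))\<^sup>2) * q y')
      = (LINT y'|W. q y' * (steer (\<lambda>x. g x y) y' * cnj (steer (\<lambda>x. g x y) y')) / of_real (L2_norm N (\<lambda>x. g x y) ^ 4))"
  proof (rule Bochner_Integration.integral_cong[OF refl])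
    fix y' assume y': "y' \<in> space W"
    have "HS_inner N (rank_one N (\<lambda>x. g x y)) (rank_one N (\<lambda>x. g x y'))
        = steer (\<lambda>x. g x y) y' * cnj (steer (\<lambda>x. g x y) y')"
      unfolding HS_inner_rank_one_rank_one[OF gy column_L2[OF y']] steer_def complex_norm_square ..
    then show "HS_inner N (rank_one N (\<lambda>x. g x y)) (rank_one N (\<lambda>x. g x y'))
        / of_real ((HS_norm N (rank_one N (\<lambda>x. g x y)))\<^sup>2) * q y'
      = q y' * (steer (\<lambda>x. g x y) y' * cnj (steer (\<lambda>x. g x y) y')) / of_real (L2_norm N (\<lambda>x. g x y) ^ 4)"
      by (simp add: HS_norm_rank_one_square[OF gy])
  qed
  also have "\<dots> = beam (source q) y / of_real (L2_norm N (\<lambda>x. g x y) ^ 4)"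
    unfolding beam_def source_inner[OF q gy gy] by simp
  finally show ?thesis .
qed

text \<open>Writing \<open>d\<close> for the difference of the two columns, the difference of the
  quadratic forms splits into one term with \<open>K d\<close> and one with \<open>d\<close> in the
  second slot. Continuity of \<open>beam K\<close> thereby reduces to that of the columns in
  norm.\<close>

lemma beam_lipschitz:
  assumes K: "L2_operator N K" and b: "\<And>f. f \<in> L2 N \<Longrightarrow> L2_norm N (K f) \<le> b * L2_norm N f" "b \<ge> 0"
    and y: "y \<in> space W" and z: "z \<in> space W"
  shows "cmod (beam K y - beam K z) \<le> 2 * b * sqrt G * L2_norm N (\<lambda>x. g x y - g x z)"
proof -
  define d where "d x = g x y - g x z" for x
  note gy = column_L2[OF y] and gz = column_L2[OF z]
  have d: "d \<in> L2 N" unfolding d_def by (intro L2_diff gy gz)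
  have "L2_inner N (\<lambda>x. K (\<lambda>x. g x y) x - K (\<lambda>x. g x z) x) (\<lambda>x. g x y) = L2_inner N (K d) (\<lambda>x. g x y)"
  proof (rule L2_inner_cong_AE)
    show "AE x in N. K (\<lambda>x. g x y) x - K (\<lambda>x. g x z) x = K d x"
      using L2_operator_diff_AE[OF K gy gz] unfolding d_def[abs_def] by eventually_elim simp
  qed (auto intro!: L2_diff L2_operator_L2[OF K] gy gz d)
  then have "beam K y - beam K z = L2_inner N (K d) (\<lambda>x. g x y) + L2_inner N (K (\<lambda>x. g x z)) d"
    unfolding beam_def d_def[abs_def]
    by (simp add: L2_inner_diff_left L2_inner_diff_right L2_operator_L2[OF K] gy gz algebra_simps)
  then have "cmod (beam K y - beam K z)
      \<le> cmod (L2_inner N (K d) (\<lambda>x. g x y)) + cmod (L2_inner N (K (\<lambda>x. g x z)) d)"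
    by (simp add: norm_triangle_ineq)
  also have "\<dots> \<le> L2_norm N (K d) * L2_norm N (\<lambda>x. g x y) + L2_norm N (K (\<lambda>x. g x z)) * L2_norm N d"
    by (intro add_mono L2_Cauchy_Schwarz L2_operator_L2[OF K] gy gz d)
  also have "\<dots> \<le> (b * L2_norm N d) * sqrt G + (b * sqrt G) * L2_norm N d"
  proof (intro add_mono mult_mono)
    show "L2_norm N (K (\<lambda>x. g x z)) \<le> b * sqrt G"
      using b(1)[OF gz] mult_left_mono[OF column_norm_sqrt[OF z] b(2)] by linarith
  qed (use b d y G_nonneg in \<open>auto intro: column_norm_sqrt simp: L2_norm_nonneg\<close>)
  finally show ?thesis by (simp add: d_def[abs_def] mult_ac)
qed

end

section \<open>Weak singularities\<close>

text \<open>Dyadic decomposition: on the shell of radii between \<open>R / 2^(n+1)\<close> and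
  \<open>R / 2^n\<close> the integrand is at most the power of the inverse inner radius. Multiplied
  by the ball volume, this leaves the terms of a geometric series with ratio \<open>1/2\<close>,
  whose sum supplies the last factor \<open>2\<close> of the constant.\<close>

lemma nn_integral_weak_singularity:
  fixes y :: "'a::euclidean_space"
  assumes R: "R > 0" and dim: "DIM('a) \<ge> 2"
  shows "(\<integral>\<^sup>+x. indicator (cball y R) x * ennreal (1 / dist x y ^ (DIM('a) - 1)) \<partial>lborel)
    \<le> ennreal (2 ^ DIM('a) * R * unit_ball_vol (DIM('a)))"
proof -
  define p where "p = DIM('a) - 1"
  have p: "DIM('a) = Suc p" "p > 0" using dim by (auto simp: p_def)
  have [measurable]: "cball y r \<in> sets borel" for r by simp
  have "(\<integral>\<^sup>+x. indicator (cball y R) x * ennreal (1 / dist x y ^ p) \<partial>lborel)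
      \<le> (\<integral>\<^sup>+x. (\<Sum>n. ennreal ((2 ^ Suc n / R) ^ p) * indicator (cball y (R / 2 ^ n)) x) \<partial>lborel)"
  proof (rule nn_integral_mono)
    fix x
    show "indicator (cball y R) x * ennreal (1 / dist x y ^ p)
        \<le> (\<Sum>n. ennreal ((2 ^ Suc n / R) ^ p) * indicator (cball y (R / 2 ^ n)) x)"
    proof (cases "x \<in> cball y R \<and> x \<noteq> y")
      case True
      define r where "r = dist x y"
      have r: "0 < r" "r \<le> R" using True by (auto simp: r_def dist_commute)
      obtain n0 where "(1/2) ^ n0 < r / R"
        using real_arch_pow_inv[of "r / R" "1/2"] r R by auto
      then have ex: "R / 2 ^ Suc n0 < r"
        using R r by (simp add: field_simps power_one_over)
      \<comment> \<open>The least such \<open>n\<close> is the index of the shell that contains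
        \<open>x\<close>.\<close>
      define n where "n = (LEAST n. R / 2 ^ Suc n < r)"
      have n: "R / 2 ^ Suc n < r" unfolding n_def using ex by (rule LeastI)
      have "r \<le> R / 2 ^ n"
      proof (cases n)
        case 0
        then show ?thesis using r by simp
      next
        case (Suc k)
        then have "\<not> R / 2 ^ Suc k < r" unfolding n_def using not_less_Least by (metis lessI)
        then show ?thesis using Suc by simp
      qed
      then have mem: "x \<in> cball y (R / 2 ^ n)" by (simp add: r_def dist_commute)
      define f where "f k = ennreal ((2 ^ Suc k / R) ^ p) * indicator (cball y (R / 2 ^ k)) x" for k
      have "1 / r \<le> 2 ^ Suc n / R"
        using n R r by (simp add: field_simps)
      then have "(1 / r) ^ p \<le> (2 ^ Suc n / R) ^ p"
        using r by (intro power_mono) auto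
      then have "ennreal (1 / r ^ p) \<le> ennreal ((2 ^ Suc n / R) ^ p)"
        by (intro ennreal_leI) (simp add: power_one_over)
      then have "indicator (cball y R) x * ennreal (1 / dist x y ^ p)
          \<le> f n"
        using True mem by (simp add: r_def f_def)
      also have "f n = sum f {n}" by simp
      also have "\<dots> \<le> suminf f" by (rule sum_le_suminf) auto
      finally show ?thesis by (simp only: f_def[abs_def])
    next
      case False
      \<comment> \<open>At the singular point the integrand is zero by the convention for division;
        \<open>p > 0\<close> matters here, since \<open>0 ^ 0 = 1\<close>.\<close>
      have "1 / (0 :: real) ^ p = 0" using p(2) by (simp only: zero_power div_by_0)
      then have 0: "x = y \<Longrightarrow> ennreal (1 / dist x y ^ p) = 0" by (simp only: dist_self ennreal_0)
      show ?thesis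
      proof (cases "x = y")
        case True
        show ?thesis unfolding 0[OF True] by simp
      next
        case False
        then have "x \<notin> cball y R" using \<open>\<not> (x \<in> cball y R \<and> x \<noteq> y)\<close> by simp
        then show ?thesis by simp
      qed
    qed
  qed
  also have "\<dots> = (\<Sum>n. \<integral>\<^sup>+x. ennreal ((2 ^ Suc n / R) ^ p) * indicator (cball y (R / 2 ^ n)) x \<partial>lborel)"
    by (rule nn_integral_suminf) measurable
  also have "\<dots> = (\<Sum>n. ennreal (2 ^ p * R * unit_ball_vol (real (Suc p)) * (1/2) ^ n))"
  proof (rule suminf_cong)
    fix n :: nat
    define X :: real where "X = 2 ^ n"
    have X: "X > 0" by (simp add: X_def)
    \<comment> \<open>The volume contributes \<open>p + 1\<close> powers of the radius and the
      kernel removes \<open>p\<close>, so one factor \<open>R / 2^n\<close> survives.\<close>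
    have e: "(2 * X / R) ^ p * (R / X) ^ Suc p = 2 ^ p * (R / X)"
    proof -
      have "a ^ p * b ^ Suc p = (a * b) ^ p * b" for a b :: real by (simp add: power_mult_distrib)
      then have "(2 * X / R) ^ p * (R / X) ^ Suc p = ((2 * X / R) * (R / X)) ^ p * (R / X)" .
      also have "(2 * X / R) * (R / X) = 2" using X R by simp
      finally show ?thesis .
    qed
    have "(\<integral>\<^sup>+x. ennreal ((2 ^ Suc n / R) ^ p) * indicator (cball y (R / 2 ^ n)) x \<partial>lborel)
        = ennreal ((2 * X / R) ^ p) * ennreal (unit_ball_vol (real (Suc p)) * (R / X) ^ Suc p)"
      using R by (subst nn_integral_cmult_indicator) (auto simp: emeasure_cball p X_def)
    also have "\<dots> = ennreal ((2 * X / R) ^ p * (unit_ball_vol (real (Suc p)) * (R / X) ^ Suc p))"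
      using R X by (intro ennreal_mult[symmetric]) auto
    also have "(2 * X / R) ^ p * (unit_ball_vol (real (Suc p)) * (R / X) ^ Suc p)
        = unit_ball_vol (real (Suc p)) * ((2 * X / R) ^ p * (R / X) ^ Suc p)" by (simp add: mult_ac)
    also have "\<dots> = 2 ^ p * R * unit_ball_vol (real (Suc p)) * (1/2) ^ n"
      unfolding e by (simp add: X_def power_one_over field_simps)
    finally show "(\<integral>\<^sup>+x. ennreal ((2 ^ Suc n / R) ^ p) * indicator (cball y (R / 2 ^ n)) x \<partial>lborel)
        = ennreal (2 ^ p * R * unit_ball_vol (real (Suc p)) * (1/2) ^ n)" .
  qed
  also have "\<dots> = ennreal (\<Sum>n. 2 ^ p * R * unit_ball_vol (real (Suc p)) * (1/2) ^ n)"
    using R by (intro suminf_ennreal2 summable_mult summable_geometric) auto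
  also have "(\<Sum>n. 2 ^ p * R * unit_ball_vol (real (Suc p)) * (1/2) ^ n)
      = 2 ^ Suc p * R * unit_ball_vol (real (Suc p))"
    using suminf_mult[OF summable_geometric, of "1/2::real" "2 ^ p * R * unit_ball_vol (real (Suc p))"]
      suminf_geometric[of "1/2::real"] by simp
  finally show ?thesis unfolding p by (simp add: p_def[symmetric])
qed

text \<open>The set where \<open>f\<close> does not vanish is open and negligible, hence
  empty.\<close>

lemma continuous_AE_zero:
  fixes f :: "'a::euclidean_space \<Rightarrow> complex"
  assumes S: "open S" and f: "continuous_on S f" and ae: "AE x in lebesgue_on S. f x = 0" and x: "x \<in> S"
  shows "f x = 0"
proof (rule ccontr)
  assume "f x \<noteq> 0"
  define U where "U = {x\<in>S. f x \<noteq> 0}"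
  have "open (S \<inter> f -` (- {0}))"
    using S f by (intro continuous_open_preimage) auto
  moreover have "S \<inter> f -` (- {0}) = U" by (auto simp: U_def)
  ultimately have U: "open U" by simp
  have "AE x in lebesgue. x \<in> S \<longrightarrow> f x = 0"
    using ae S by (simp add: AE_restrict_space_iff)
  then have "AE x in lebesgue. x \<notin> U"
    by eventually_elim (auto simp: U_def)
  then have "negligible U"
    using U AE_iff_null_sets[of U lebesgue] by (simp add: negligible_iff_null_sets)
  moreover have "U \<noteq> {}" using x \<open>f x \<noteq> 0\<close> by (auto simp: U_def)
  ultimately show False using open_not_negligible[OF U] by simp
qed

section \<open>Bessel and Hankel functions of order zero\<close>

text \<open>A crude bound that lets the coefficients of both Bessel series be majorised by
  \<open>1 / fact n\<close>.\<close>

lemma harm_le_fact: "harm n \<le> (fact n :: real)"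
proof -
  have "harm n \<le> (\<Sum>k=1..n. 1 :: real)"
    unfolding harm_def by (intro sum_mono) (auto simp: field_simps)
  also have "\<dots> = real n" by simp
  also have "\<dots> \<le> real (fact n)" unfolding of_nat_le_iff by (rule fact_ge_self)
  also have "\<dots> = fact n" by (rule of_nat_fact)
  finally show ?thesis .
qed

lemma summable_bessel_coefficients:
  fixes w :: "'a::{real_normed_field,banach}"
  assumes "\<And>n. \<bar>c n\<bar> \<le> 1 / (fact n :: real)"
  shows "summable (\<lambda>n. of_real (c n) * w ^ n)"
proof (rule summable_comparison_test')
  show "summable (\<lambda>n. inverse (fact n) * norm w ^ n)" by (rule summable_exp)
  show "norm (of_real (c n) * w ^ n) \<le> inverse (fact n) * norm w ^ n" for n
    using mult_right_mono[OF assms[of n], of "norm w ^ n"]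
    by (simp add: norm_mult norm_power divide_inverse)
qed

lemma bessel_coefficient_bounds:
  "\<bar>(- 1) ^ n / (fact n)\<^sup>2\<bar> \<le> 1 / (fact n :: real)"
  "\<bar>(- 1) ^ n * harm n / (fact n)\<^sup>2\<bar> \<le> 1 / (fact n :: real)"
proof -
  have f: "(fact n :: real) \<ge> 1" by (rule fact_ge_1)
  have h: "harm n \<ge> (0::real)" by (simp add: harm_nonneg)
  have "\<bar>(- 1) ^ n / (fact n)\<^sup>2\<bar> = 1 / (fact n :: real)\<^sup>2" by (simp add: power_abs)
  also have "\<dots> \<le> 1 / fact n"
    using f by (intro divide_left_mono self_le_power) auto
  finally show "\<bar>(- 1) ^ n / (fact n)\<^sup>2\<bar> \<le> 1 / (fact n :: real)" .
  have "\<bar>(- 1) ^ n * harm n / (fact n)\<^sup>2\<bar> = harm n / (fact n :: real)\<^sup>2"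
    using h by (simp add: power_abs abs_mult)
  also have "\<dots> \<le> fact n / (fact n)\<^sup>2"
    by (intro divide_right_mono harm_le_fact) simp
  also have "\<dots> = 1 / fact n" by (simp add: power2_eq_square)
  finally show "\<bar>(- 1) ^ n * harm n / (fact n)\<^sup>2\<bar> \<le> 1 / (fact n :: real)" .
qed

text \<open>The series is an everywhere convergent power series in \<open>(t / 2)^2\<close>,
  dominated by that of the exponential.\<close>

lemma isCont_powser_even:
  fixes c :: "nat \<Rightarrow> real"
  assumes "\<And>n. \<bar>c n\<bar> \<le> 1 / fact n"
  shows "isCont (\<lambda>t. \<Sum>n. c n * (t / 2) ^ (2 * n)) t"
proof -
  have "isCont (\<lambda>w. \<Sum>n. c n * w ^ n) ((t / 2)\<^sup>2)"
    using summable_bessel_coefficients[where 'a = real and c = c, OF assms]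
    by (intro isCont_powser_converges_everywhere) simp
  moreover have "isCont (\<lambda>t. (t / 2)\<^sup>2) t" by (intro continuous_intros) auto
  ultimately have "isCont (\<lambda>t. \<Sum>n. c n * ((t / 2)\<^sup>2) ^ n) t"
    using isCont_o2[where f = "\<lambda>t. (t / 2)\<^sup>2" and g = "\<lambda>w. \<Sum>n. c n * w ^ n" and a = t] by simp
  then show ?thesis by (simp add: power_mult)
qed

lemma isCont_bessel_J0: "isCont bessel_J0 t"
  unfolding bessel_J0_def[abs_def] by (rule isCont_powser_even) (rule bessel_coefficient_bounds)

lemma isCont_bessel_Y0_series:
  "isCont (\<lambda>t. \<Sum>n. (- 1) ^ n * harm n / (fact n)\<^sup>2 * (t / 2) ^ (2 * n) :: real) t"
  by (rule isCont_powser_even) (rule bessel_coefficient_bounds)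

lemma isCont_hankel1_0:
  assumes "t > 0"
  shows "isCont hankel1_0 t"
  unfolding hankel1_0_def[abs_def] bessel_Y0_def using assms
  by (intro continuous_intros isCont_bessel_J0 isCont_bessel_Y0_series) auto

lemma borel_measurable_hankel1_0 [measurable]: "hankel1_0 \<in> borel_measurable borel"
proof -
  have [measurable]: "bessel_J0 \<in> borel_measurable borel"
    by (intro borel_measurable_continuous_onI continuous_at_imp_continuous_on ballI isCont_bessel_J0)
  have [measurable]: "(\<lambda>t. \<Sum>n. (- 1) ^ n * harm n / (fact n)\<^sup>2 * (t / 2) ^ (2 * n) :: real) \<in> borel_measurable borel"
    by (intro borel_measurable_continuous_onI continuous_at_imp_continuous_on ballI isCont_bessel_Y0_series)
  show ?thesis unfolding hankel1_0_def[abs_def] bessel_Y0_def by measurable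
qed

text \<open>As a function of \<open>(t / 2)\<^sup>2\<close>, the Bessel function is the restriction of an entire function that
  takes the value \<open>1\<close> at \<open>0\<close>.\<close>

lemma bessel_J0_not_zero_on_interval:
  assumes ab: "0 < a" "a < b"
  shows "\<exists>t\<in>{a<..<b}. bessel_J0 t \<noteq> 0"
proof (rule ccontr)
  assume "\<not> ?thesis"
  then have zero: "bessel_J0 t = 0" if "a < t" "t < b" for t using that by auto
  define c :: "nat \<Rightarrow> real" where "c n = (- 1) ^ n / (fact n)\<^sup>2" for n
  define F :: "complex \<Rightarrow> complex" where "F w = (\<Sum>n. of_real (c n) * w ^ n)" for w
  have sm: "summable (\<lambda>n. of_real (c n) * w ^ n)" for w :: complex
    using bessel_coefficient_bounds(1) by (intro summable_bessel_coefficients) (simp add: c_def)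
  have "(F has_field_derivative (\<Sum>n. diffs (\<lambda>n. complex_of_real (c n)) n * w ^ n)) (at w)" for w
    unfolding F_def[abs_def] using sm by (rule termdiffs_strong_converges_everywhere)
  then have hol: "F holomorphic_on UNIV"
    by (auto simp: holomorphic_on_open)
  have real: "F (of_real ((t / 2)\<^sup>2)) = of_real (bessel_J0 t)" for t
  proof -
    have "summable (\<lambda>n. c n * ((t / 2)\<^sup>2) ^ n)"
      using bessel_coefficient_bounds(1) summable_bessel_coefficients[of c "(t / 2)\<^sup>2 :: real"]
      by (simp add: c_def)
    from suminf_of_real[OF this, where 'a = complex]
    show ?thesis by (simp add: F_def bessel_J0_def c_def power_mult)
  qed
  define U where "U = (\<lambda>t. complex_of_real ((t / 2)\<^sup>2)) ` {a<..<b}"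
  define s where "s = (a + b) / 2"
  have s: "a < s" "s < b" "s > 0" using ab by (auto simp: s_def)
  have lim: "complex_of_real ((s / 2)\<^sup>2) islimpt U"
    unfolding islimpt_sequential
  proof (intro exI conjI allI)
    \<comment> \<open>The offset \<open>2\<close> keeps the points strictly between \<open>s\<close>
      and \<open>b\<close>; squaring is injective on positive numbers, so no term equals the
      limit.\<close>
    define f where "f n = complex_of_real (((s + (b - s) * (1 / real (n + 2))) / 2)\<^sup>2)" for n
    show "f n \<in> U - {complex_of_real ((s / 2)\<^sup>2)}" for n
    proof -
      define u where "u = s + (b - s) * (1 / real (n + 2))"
      have "0 < (b - s) * (1 / real (n + 2))" "(b - s) * (1 / real (n + 2)) < b - s"
        using s mult_strict_left_mono[of "1 / real (n + 2)" 1 "b - s"] by auto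
      then have u: "s < u" "u < b" by (auto simp: u_def)
      then have "(s / 2)\<^sup>2 < (u / 2)\<^sup>2"
        using s by (intro power_strict_mono) auto
      moreover have "f n = complex_of_real ((u / 2)\<^sup>2)" by (simp only: f_def u_def)
      moreover have "u \<in> {a<..<b}" using u s by simp
      ultimately show ?thesis unfolding U_def by (auto simp del: of_real_power)
    qed
    have "(\<lambda>n. complex_of_real (((s + (b - s) * (1 / real (n + 2))) / 2)\<^sup>2)) \<longlonglongrightarrow> complex_of_real (((s + (b - s) * 0) / 2)\<^sup>2)"
      by (intro tendsto_intros LIMSEQ_ignore_initial_segment[OF lim_1_over_n]) auto
    then show "f \<longlonglongrightarrow> complex_of_real ((s / 2)\<^sup>2)" by (simp add: f_def[abs_def])
  qed
  \<comment> \<open>Identity theorem: \<open>F\<close> vanishes on \<open>U\<close>, which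
    accumulates at the point in \<open>lim\<close>.\<close>
  have "F 0 = 0"
  proof (rule analytic_continuation[OF hol open_UNIV connected_UNIV _ _ lim])
    show "F z = 0" if "z \<in> U" for z
      using that zero real unfolding U_def by auto
  qed auto
  moreover have "F 0 = 1" unfolding F_def powser_zero by (simp add: c_def)
  ultimately show False by simp
qed

text \<open>The singularity of the Hankel function at \<open>0\<close> is logarithmic, so
  \<open>sqrt t\<close> times its modulus stays bounded. This weak form suffices to give the plane
  the exponent \<open>d - 1 = 1\<close> that is exact in dimension 3.\<close>

lemma hankel1_0_bound:
  assumes R: "R > 0"
  obtains C where "C > 0" "\<And>t. 0 < t \<Longrightarrow> t \<le> R \<Longrightarrow> (cmod (hankel1_0 t))\<^sup>2 \<le> C / t"
proof -
  define Y where "Y t = (\<Sum>n. (- 1) ^ n * harm n / (fact n)\<^sup>2 * (t / 2) ^ (2 * n) :: real)" for t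
  have "compact (bessel_J0 ` {0..R})" "compact (Y ` {0..R})"
    unfolding Y_def[abs_def]
    by (intro compact_continuous_image continuous_at_imp_continuous_on ballI
        isCont_bessel_J0 isCont_bessel_Y0_series compact_Icc)+
  then have "bounded (bessel_J0 ` {0..R})" "bounded (Y ` {0..R})"
    by (auto intro: compact_imp_bounded)
  then obtain a b where a: "\<And>t. t \<in> {0..R} \<Longrightarrow> \<bar>bessel_J0 t\<bar> \<le> a" and b: "\<And>t. t \<in> {0..R} \<Longrightarrow> \<bar>Y t\<bar> \<le> b"
    unfolding bounded_iff real_norm_def by blast
  have a0: "a \<ge> 0" using a[of 0] R by fastforce
  have b0: "b \<ge> 0" using b[of 0] R by fastforce
  define c where "c = 2 / pi"
  have c: "c > 0" by (simp add: c_def)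
  define e where "e = \<bar>euler_mascheroni :: real\<bar>"
  have e: "e \<ge> 0" by (simp add: e_def)
  \<comment> \<open>The first summand collects the terms bounded on the interval, the second the
    logarithm, for which \<open>2 * R + 4\<close> is derived below; the final \<open>1\<close> makes
    \<open>D\<close> positive.\<close>
  define D where "D = sqrt R * (a + c * e * a + c * b) + c * a * (2 * R + 4) + 1"
  have D: "D > 0" unfolding D_def using a0 b0 c e R by (intro add_nonneg_pos add_nonneg_nonneg mult_nonneg_nonneg) auto
  have key: "sqrt t * cmod (hankel1_0 t) \<le> D" if t: "0 < t" "t \<le> R" for t
  proof -
    have "sqrt t * \<bar>ln (t / 2)\<bar> \<le> 2 * R + 4"
    proof -
      \<comment> \<open>In terms of \<open>s\<close> the logarithm is \<open>2 * ln s\<close>, and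
        \<open>ln x <= x - 1\<close> at \<open>s\<close> and \<open>1 / s\<close> bounds it by
        \<open>2 * s + 2 / s\<close>. Multiplying by \<open>2 * s\<close>, which is at least
        \<open>sqrt t\<close>, gives \<open>2 * t + 4\<close>.\<close>
      define s where "s = sqrt (t / 2)"
      have s: "s > 0" "s\<^sup>2 = t / 2" using t by (auto simp: s_def)
      have "ln (t / 2) = 2 * ln s" using s by (metis ln_realpow of_nat_numeral)
      moreover have "ln s \<le> s" "- ln s \<le> 1 / s"
        using ln_le_minus_one[of s] ln_le_minus_one[of "1 / s"] s by (auto simp: ln_div)
      ultimately have ln: "\<bar>ln (t / 2)\<bar> \<le> 2 * s + 2 / s"
      proof -
        have "1 / s > 0" "2 / s = 2 * (1 / s)" using s(1) by auto
        then show ?thesis using \<open>ln (t / 2) = 2 * ln s\<close> \<open>ln s \<le> s\<close> \<open>- ln s \<le> 1 / s\<close> s(1)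
          unfolding abs_le_iff by linarith
      qed
      have "sqrt t \<le> 2 * s" using s(1) unfolding s_def
        by (intro real_le_lsqrt) (auto simp: power_mult_distrib t less_imp_le)
      then have "sqrt t * \<bar>ln (t / 2)\<bar> \<le> 2 * s * (2 * s + 2 / s)"
        using ln s t by (intro mult_mono) auto
      also have "\<dots> = 2 * t + 4" using s by (simp add: algebra_simps flip: power2_eq_square)
      also have "\<dots> \<le> 2 * R + 4" using t by simp
      finally show ?thesis .
    qed
    then have "c * a * (sqrt t * \<bar>ln (t / 2)\<bar>) \<le> c * a * (2 * R + 4)"
      using c a0 by (intro mult_left_mono) auto
    moreover have "sqrt t * (a + c * e * a + c * b) \<le> sqrt R * (a + c * e * a + c * b)"
      using t a0 b0 c e by (intro mult_right_mono) auto
    moreover have "cmod (hankel1_0 t) \<le> a + (c * (\<bar>ln (t / 2)\<bar> + e) * a + c * b)"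
    proof -
      have "cmod (hankel1_0 t) \<le> \<bar>bessel_J0 t\<bar> + \<bar>bessel_Y0 t\<bar>"
        unfolding hankel1_0_def by (rule order_trans[OF norm_triangle_ineq]) (simp add: norm_mult)
      moreover have "\<bar>bessel_Y0 t\<bar> \<le> c * (\<bar>ln (t / 2)\<bar> + e) * a + c * b"
      proof -
        have "\<bar>bessel_Y0 t\<bar> \<le> \<bar>c * (ln (t / 2) + euler_mascheroni) * bessel_J0 t\<bar> + \<bar>c * Y t\<bar>"
          unfolding bessel_Y0_def Y_def c_def by (rule abs_triangle_ineq4)
        also have "\<dots> = c * \<bar>ln (t / 2) + euler_mascheroni\<bar> * \<bar>bessel_J0 t\<bar> + c * \<bar>Y t\<bar>"
          using c by (simp add: abs_mult)
        also have "\<dots> \<le> c * (\<bar>ln (t / 2)\<bar> + e) * a + c * b"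
          using t a[of t] b[of t] c a0 e unfolding e_def
          by (intro add_mono mult_mono mult_left_mono abs_triangle_ineq) auto
        finally show ?thesis .
      qed
      ultimately show ?thesis using a[of t] t by simp
    qed
    then have "sqrt t * cmod (hankel1_0 t) \<le> sqrt t * (a + (c * (\<bar>ln (t / 2)\<bar> + e) * a + c * b))"
      using t by (intro mult_left_mono) auto
    moreover have "sqrt t * (a + (c * (\<bar>ln (t / 2)\<bar> + e) * a + c * b))
        = sqrt t * (a + c * e * a + c * b) + c * a * (sqrt t * \<bar>ln (t / 2)\<bar>)"
      by (simp add: algebra_simps)
    ultimately show ?thesis unfolding D_def by linarith
  qed
  show thesis
  proof (rule that[of "D\<^sup>2"])
    show "D\<^sup>2 > 0" using D by simp
    fix t :: real assume t: "0 < t" "t \<le> R"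
    have "(sqrt t * cmod (hankel1_0 t))\<^sup>2 \<le> D\<^sup>2"
      using key[OF t] t by (intro power_mono) auto
    then show "(cmod (hankel1_0 t))\<^sup>2 \<le> D\<^sup>2 / t"
      using t by (simp add: power_mult_distrib field_simps)
  qed
qed

section \<open>Green's function\<close>

text \<open>Translation invariance reduces continuity in either variable to that of a function of
  one variable.\<close>

lemma green_diff: "green k m x y = green k m (x - y) 0"
  by (simp add: green_def)

lemma isCont_mach_norm: "isCont (mach_norm m) z"
  unfolding mach_norm_def[abs_def] by (intro continuous_intros)

lemma borel_measurable_mach_norm [measurable]: "mach_norm m \<in> borel_measurable borel"
  by (intro borel_measurable_continuous_onI continuous_at_imp_continuous_on ballI isCont_mach_norm)

lemma mach_norm_scale: "s \<ge> 0 \<Longrightarrow> mach_norm m (s *\<^sub>R v) = s * mach_norm m v"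
proof -
  assume s: "s \<ge> 0"
  have "((s *\<^sub>R v) \<bullet> m)\<^sup>2 + (mach_beta m)\<^sup>2 * (norm (s *\<^sub>R v))\<^sup>2
      = s\<^sup>2 * ((v \<bullet> m)\<^sup>2 + (mach_beta m)\<^sup>2 * (norm v)\<^sup>2)"
    by (simp add: power_mult_distrib algebra_simps)
  then show ?thesis using s by (simp add: mach_norm_def real_sqrt_mult)
qed

section \<open>Size, continuity and non-vanishing of Green's function\<close>

context
  fixes m :: "real^'n" and k :: real
  assumes k: "k > 0" and m: "norm m < 1" and dim: "CARD('n) = 2 \<or> CARD('n) = 3"
begin

lemma mach_beta_pos: "mach_beta m > 0"
proof -
  have "(norm m)\<^sup>2 < 1" using m by (simp add: power_less_one_iff abs_square_less_1)
  then show ?thesis by (simp add: mach_beta_def)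
qed

lemma mach_beta_square: "(mach_beta m)\<^sup>2 = 1 - (norm m)\<^sup>2"
  using mach_beta_pos by (simp add: mach_beta_def)

lemma mach_norm_lower: "mach_beta m * norm z \<le> mach_norm m z"
  unfolding mach_norm_def using mach_beta_pos
  by (intro real_le_rsqrt) (simp add: power_mult_distrib)

text \<open>The term \<open>|z|^2 |m|^2\<close> from Cauchy-Schwarz cancels against
  \<open>(mach_beta m)^2 = 1 - |m|^2\<close>.\<close>

lemma mach_norm_upper: "mach_norm m z \<le> norm z"
proof -
  have "\<bar>z \<bullet> m\<bar>\<^sup>2 \<le> (norm z * norm m)\<^sup>2"
    by (intro power_mono Cauchy_Schwarz_ineq2) auto
  then show ?thesis
    unfolding mach_norm_def mach_beta_square
    by (intro real_le_lsqrt) (auto simp: power_mult_distrib algebra_simps)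
qed

lemma mach_norm_pos: "z \<noteq> 0 \<Longrightarrow> mach_norm m z > 0"
  using mach_norm_lower[of z] mach_beta_pos by (meson less_le_trans mult_pos_pos zero_less_norm_iff)

lemma isCont_green:
  assumes "z \<noteq> 0"
  shows "isCont (\<lambda>z. green k m z 0) z"
proof -
  note pos = mach_beta_pos mach_norm_pos[OF assms]
  have mn: "isCont (\<lambda>z. mach_norm m z) z" by (rule isCont_mach_norm)
  show ?thesis
  proof (cases "CARD('n) = 3")
    case True
    have "isCont (\<lambda>z. exp (\<i> * of_real (k / (mach_beta m)\<^sup>2 * (- (z \<bullet> m) + mach_norm m z)))
        / of_real (4 * pi * mach_norm m z)) z"
      using pos by (intro continuous_intros mn) simp
    then show ?thesis using True by (simp only: green_def if_True diff_zero simp_thms)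
  next
    case False
    have "isCont (\<lambda>z. k / (mach_beta m)\<^sup>2 * mach_norm m z) z"
      by (intro isCont_mult mn continuous_const)
    moreover have "isCont hankel1_0 (k / (mach_beta m)\<^sup>2 * mach_norm m z)"
      using pos k by (intro isCont_hankel1_0) simp
    ultimately have h: "isCont (\<lambda>z. hankel1_0 (k / (mach_beta m)\<^sup>2 * mach_norm m z)) z"
      by (rule isCont_o2)
    have "isCont (\<lambda>z. \<i> / of_real (4 * mach_beta m)
        * exp (- (\<i> * of_real (k / (mach_beta m)\<^sup>2 * (z \<bullet> m))))
        * hankel1_0 (k / (mach_beta m)\<^sup>2 * mach_norm m z)) z"
      using pos by (intro isCont_mult[OF _ h] continuous_intros) simp_all
    then show ?thesis using False by (simp only: green_def if_False diff_zero simp_thms)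
  qed
qed

text \<open>The phase factors have modulus one, and \<open>mach_norm m z\<close> is at least
  \<open>mach_beta m * norm z\<close>, so only the denominator in dimension 3 and the Hankel factor
  in dimension 2 remain to be estimated.\<close>

lemma green_bound:
  assumes R: "R > 0"
  obtains C where "C > 0"
    "\<And>x y. x \<noteq> y \<Longrightarrow> dist x y \<le> R \<Longrightarrow> (cmod (green k m x y))\<^sup>2 \<le> C / dist x y ^ (CARD('n) - 1)"
proof (cases "CARD('n) = 3")
  case True
  define C where "C = 1 / (4 * pi * mach_beta m)\<^sup>2"
  show thesis
  proof (rule that[of C])
    show "C > 0" unfolding C_def using mach_beta_pos by simp
    fix x y :: "real^'n" assume xy: "x \<noteq> y"
    define z where "z = x - y"
    have z: "z \<noteq> 0" "norm z > 0" using xy by (auto simp: z_def)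
    have "cmod (green k m x y) = 1 / (4 * pi * mach_norm m z)"
      using True mach_norm_pos[OF z(1)]
      by (simp add: green_def z_def norm_divide norm_mult del: of_real_mult of_real_divide of_real_add of_real_minus of_real_diff)
    also have "\<dots> \<le> 1 / (4 * pi * (mach_beta m * norm z))"
      using mach_norm_lower[of z] mach_beta_pos z mach_norm_pos[OF z(1)]
      by (intro divide_left_mono mult_left_mono mult_pos_pos) auto
    finally have "(cmod (green k m x y))\<^sup>2 \<le> (1 / (4 * pi * (mach_beta m * norm z)))\<^sup>2"
      by (intro power_mono) auto
    also have "\<dots> = C / dist x y ^ (CARD('n) - 1)"
      using True by (simp add: C_def z_def dist_norm power_divide power_mult_distrib)
    finally show "(cmod (green k m x y))\<^sup>2 \<le> C / dist x y ^ (CARD('n) - 1)" .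
  qed
next
  case False
  then have card: "CARD('n) = 2" using dim by simp
  define \<kappa> where "\<kappa> = k / (mach_beta m)\<^sup>2"
  have \<kappa>: "\<kappa> > 0" using k mach_beta_pos by (simp add: \<kappa>_def)
  obtain D where D: "D > 0" "\<And>t. 0 < t \<Longrightarrow> t \<le> \<kappa> * R \<Longrightarrow> (cmod (hankel1_0 t))\<^sup>2 \<le> D / t"
    using hankel1_0_bound[of "\<kappa> * R"] \<kappa> R by auto
  \<comment> \<open>The squared prefactor times the Hankel constant, with its argument bounded below
    by \<open>\<kappa> * mach_beta m * norm z\<close>.\<close>
  define C where "C = (1 / (4 * mach_beta m))\<^sup>2 * (D / (\<kappa> * mach_beta m))"
  show thesis
  proof (rule that[of C])
    show "C > 0" unfolding C_def using mach_beta_pos D(1) \<kappa> by simp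
    fix x y :: "real^'n" assume xy: "x \<noteq> y" "dist x y \<le> R"
    define z where "z = x - y"
    have z: "z \<noteq> 0" "norm z > 0" "norm z \<le> R" using xy by (auto simp: z_def dist_norm)
    define t where "t = \<kappa> * mach_norm m z"
    have t: "0 < t" "t \<le> \<kappa> * R" "\<kappa> * (mach_beta m * norm z) \<le> t"
      using \<kappa> mach_norm_pos[OF z(1)] order_trans[OF mach_norm_upper z(3)] mach_norm_lower[of z]
      by (auto simp: t_def)
    have e: "cmod (exp (- (\<i> * complex_of_real u))) = 1" for u :: real
      using norm_exp_i_times[of "- u"] by simp
    have "cmod (green k m x y) = 1 / (4 * mach_beta m) * cmod (hankel1_0 t)"
      using card mach_beta_pos unfolding green_def z_def[symmetric] \<kappa>_def[symmetric] t_def[symmetric]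
      by (simp add: norm_mult norm_divide e del: of_real_mult of_real_divide)
    then have "(cmod (green k m x y))\<^sup>2 = (1 / (4 * mach_beta m))\<^sup>2 * (cmod (hankel1_0 t))\<^sup>2"
      by (simp only: power_mult_distrib)
    also have "\<dots> \<le> (1 / (4 * mach_beta m))\<^sup>2 * (D / t)"
      by (intro mult_left_mono D t) simp
    also have "\<dots> \<le> (1 / (4 * mach_beta m))\<^sup>2 * (D / (\<kappa> * (mach_beta m * norm z)))"
      using D(1) t \<kappa> mach_beta_pos z by (intro mult_left_mono divide_left_mono) auto
    also have "\<dots> = C / dist x y ^ (CARD('n) - 1)"
      using card by (simp add: C_def z_def dist_norm)
    finally show "(cmod (green k m x y))\<^sup>2 \<le> C / dist x y ^ (CARD('n) - 1)" .
  qed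
qed

lemma green_measurable: "(\<lambda>(x, y). green k m x y) \<in> borel_measurable (borel \<Otimes>\<^sub>M borel)"
  unfolding green_def by (cases "CARD('n) = 3") (simp_all, measurable)

text \<open>In dimension 3 the exponential never vanishes. In dimension 2 the real part of the
  Hankel function is \<open>bessel_J0\<close>, and moving along the ray from \<open>y\<close>
  through a point of \<open>M\<close> makes its argument sweep an interval, where it cannot vanish
  identically.\<close>

lemma green_not_zero_on_open:
  assumes M: "open M" "M \<noteq> {}" "y \<notin> M"
  shows "\<exists>x\<in>M. green k m x y \<noteq> 0"
proof (rule ccontr)
  assume "\<not> ?thesis"
  then have zero: "green k m x y = 0" if "x \<in> M" for x using that by auto
  obtain x0 where x0: "x0 \<in> M" using M by auto
  define v where "v = x0 - y"
  have v: "v \<noteq> 0" using x0 M by (auto simp: v_def)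
  note pos = mach_beta_pos mach_norm_pos[OF v]
  show False
  proof (cases "CARD('n) = 3")
    case True
    then show False using zero[OF x0] pos by (simp add: green_def v_def[symmetric])
  next
    case False
    define \<kappa> where "\<kappa> = k / (mach_beta m)\<^sup>2"
    define \<tau> where "\<tau> = \<kappa> * mach_norm m v"
    have \<tau>: "\<tau> > 0" using k pos by (simp add: \<tau>_def \<kappa>_def)
    have J0: "bessel_J0 (s * \<tau>) = 0" if "s > 0" "y + s *\<^sub>R v \<in> M" for s
    proof -
      have "hankel1_0 (\<kappa> * mach_norm m (s *\<^sub>R v)) = 0"
        using zero[OF that(2)] False pos by (simp add: green_def \<kappa>_def)
      then have "Re (hankel1_0 (s * \<tau>)) = 0"
        using that(1) by (simp add: mach_norm_scale \<tau>_def mult.left_commute)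
      then show ?thesis by (simp add: hankel1_0_def)
    qed
    have "open ((\<lambda>s. y + s *\<^sub>R v) -` M)"
      using M(1) by (intro open_vimage continuous_intros)
    moreover have "1 \<in> (\<lambda>s. y + s *\<^sub>R v) -` M" using x0 by (simp add: v_def)
    ultimately obtain e where e: "e > 0" "\<And>s. dist s 1 < e \<Longrightarrow> y + s *\<^sub>R v \<in> M"
      unfolding open_dist by force
    \<comment> \<open>Scaling factors between \<open>1\<close> and \<open>1 + e\<close> stay in
      \<open>M\<close> and carry the Hankel argument through exactly this interval, because
      \<open>mach_norm\<close> is positively homogeneous.\<close>
    have "\<tau> < (1 + e) * \<tau>" using e \<tau> by simp
    then obtain t where t: "\<tau> < t" "t < (1 + e) * \<tau>" "bessel_J0 t \<noteq> 0"
      using bessel_J0_not_zero_on_interval[OF \<tau>, of "(1 + e) * \<tau>"] unfolding Bex_def greaterThanLessThan_iff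
      by blast
    have "bessel_J0 (t / \<tau> * \<tau>) = 0"
      using t \<tau> e(1) by (intro J0 e(2)) (auto simp: dist_real_def field_simps)
    then show False using t \<tau> by simp
  qed
qed

end

section \<open>Green's function as a kernel between the two regions\<close>

context
  fixes m :: "real^'n" and k :: real and \<Omega> M :: "(real^'n) set"
  assumes k: "k > 0" and m: "norm m < 1" and dim: "CARD('n) = 2 \<or> CARD('n) = 3"
    and \<Omega>: "open \<Omega>" "bounded \<Omega>" and M: "open M" "bounded M" "M \<noteq> {}" "M \<subseteq> - closure \<Omega>"
begin

lemma green_region_bound:
  "\<exists>R>0. \<exists>C>0. \<forall>x\<in>M. \<forall>y\<in>\<Omega>. dist x y \<le> R \<and> (cmod (green k m x y))\<^sup>2 \<le> C / dist x y ^ (CARD('n) - 1)"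
proof -
  obtain a where a: "\<And>x. x \<in> M \<Longrightarrow> norm x \<le> a" using M(2) by (auto simp: bounded_iff)
  obtain b where b: "\<And>y. y \<in> \<Omega> \<Longrightarrow> norm y \<le> b" using \<Omega>(2) by (auto simp: bounded_iff)
  define R where "R = \<bar>a\<bar> + \<bar>b\<bar> + 1"
  have R: "R > 0" by (simp add: R_def)
  have dist_le: "dist x y \<le> R" if "x \<in> M" "y \<in> \<Omega>" for x y
    using a[OF that(1)] b[OF that(2)] norm_triangle_ineq4[of x y] by (simp add: dist_norm R_def)
  have disj: "x \<noteq> y" if "x \<in> M" "y \<in> \<Omega>" for x y
    using that M(4) closure_subset by blast
  obtain C where C: "C > 0"
    "\<And>x y. x \<noteq> y \<Longrightarrow> dist x y \<le> R \<Longrightarrow> (cmod (green k m x y))\<^sup>2 \<le> C / dist x y ^ (CARD('n) - 1)"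
    using green_bound[OF k m dim R] by blast
  have "\<forall>x\<in>M. \<forall>y\<in>\<Omega>. dist x y \<le> R \<and> (cmod (green k m x y))\<^sup>2 \<le> C / dist x y ^ (CARD('n) - 1)"
    by (intro ballI conjI dist_le C(2)[OF disj dist_le])
  then show ?thesis using R C(1) by blast
qed

text \<open>Squared column norms are bounded by \<open>C * V\<close>, where \<open>V\<close> is the
  constant of the weak singularity on the ball of radius \<open>R\<close>. This radius covers
  \<open>M\<close> from every source point, so the bound is uniform.\<close>

lemma green_source_kernel: "\<exists>G. source_kernel (lebesgue_on M) (lebesgue_on \<Omega>) (green k m) G"
proof -
  obtain R C where R: "R > 0" and C: "C > 0"
    and dist_le: "\<And>x y. x \<in> M \<Longrightarrow> y \<in> \<Omega> \<Longrightarrow> dist x y \<le> R"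
    and bound: "\<And>x y. x \<in> M \<Longrightarrow> y \<in> \<Omega> \<Longrightarrow> (cmod (green k m x y))\<^sup>2 \<le> C / dist x y ^ (CARD('n) - 1)"
    using green_region_bound by meson
  define V where "V = 2 ^ CARD('n) * R * unit_ball_vol (CARD('n))"
  have V: "V \<ge> 0" using R by (simp add: V_def)
  have sets: "M \<in> sets lebesgue" "\<Omega> \<in> sets lebesgue" using M \<Omega> by auto
  \<comment> \<open>Green's function is Borel measurable on the product; composing it with these
    identities transfers that to the Lebesgue measures.\<close>
  have id_meas: "(\<lambda>x. x) \<in> measurable (lebesgue_on S) (borel :: (real^'n) measure)" for S
    by (intro measurable_restrict_space1 measurable_completion) simp
  have meas: "(\<lambda>x. green k m (u x) (v x)) \<in> borel_measurable X"
    if "u \<in> measurable X borel" "v \<in> measurable X borel" for u v and X :: "'z measure"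
    using measurable_compose[OF measurable_Pair[OF that] green_measurable[OF k m dim]] by simp
  have nn: "(\<integral>\<^sup>+x. ennreal ((cmod (green k m x y))\<^sup>2) \<partial>lebesgue_on M) \<le> ennreal ((sqrt (C * V))\<^sup>2)"
    if y: "y \<in> \<Omega>" for y
  proof -
    have "(\<integral>\<^sup>+x. ennreal ((cmod (green k m x y))\<^sup>2) \<partial>lebesgue_on M)
        = (\<integral>\<^sup>+x. ennreal ((cmod (green k m x y))\<^sup>2) * indicator M x \<partial>lebesgue)"
      using sets by (intro nn_integral_restrict_space) simp
    also have "\<dots> \<le> (\<integral>\<^sup>+x. ennreal C * (indicator (cball y R) x * ennreal (1 / dist x y ^ (CARD('n) - 1))) \<partial>lebesgue)"
    proof (rule nn_integral_mono)
      fix x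
      show "ennreal ((cmod (green k m x y))\<^sup>2) * indicator M x
          \<le> ennreal C * (indicator (cball y R) x * ennreal (1 / dist x y ^ (CARD('n) - 1)))"
      proof (cases "x \<in> M")
        case True
        have "(cmod (green k m x y))\<^sup>2 \<le> C * (1 / dist x y ^ (CARD('n) - 1))"
          using bound[OF True y] by simp
        then have "ennreal ((cmod (green k m x y))\<^sup>2) \<le> ennreal C * ennreal (1 / dist x y ^ (CARD('n) - 1))"
          using C by (subst ennreal_mult[symmetric]) (auto intro: ennreal_leI)
        then show ?thesis using True dist_le[OF True y] by (simp add: dist_commute)
      qed simp
    qed
    also have "\<dots> = ennreal C * (\<integral>\<^sup>+x. indicator (cball y R) x * ennreal (1 / dist x y ^ (CARD('n) - 1)) \<partial>lborel)"
    proof -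
      have [measurable]: "cball y R \<in> sets borel" by simp
      show ?thesis by (simp only: nn_integral_completion) (rule nn_integral_cmult, measurable)
    qed
    also have "\<dots> \<le> ennreal C * ennreal V"
      using nn_integral_weak_singularity[OF R, of y] dim unfolding V_def
      by (intro mult_left_mono) auto
    also have "\<dots> = ennreal ((sqrt (C * V))\<^sup>2)"
      using C V by (simp add: ennreal_mult)
    finally show ?thesis .
  qed
  have col: "(\<lambda>x. green k m x y) \<in> borel_measurable (lebesgue_on M)" for y
    by (intro meas id_meas) simp
  have "source_kernel (lebesgue_on M) (lebesgue_on \<Omega>) (green k m) (C * V)"
  proof (intro source_kernel.intro source_kernel_axioms.intro)
    show "finite_measure (lebesgue_on M)" "finite_measure (lebesgue_on \<Omega>)"
      using M \<Omega> by (auto intro!: finite_measure_lebesgue_on lmeasurable_open)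
    show "(\<lambda>(x, y). green k m x y) \<in> borel_measurable (lebesgue_on M \<Otimes>\<^sub>M lebesgue_on \<Omega>)"
      unfolding split_beta
      by (intro meas measurable_compose[OF measurable_fst id_meas] measurable_compose[OF measurable_snd id_meas])
    show "0 \<le> C * V" using C V by simp
  next
    fix y assume "y \<in> space (lebesgue_on \<Omega>)"
    then have y: "y \<in> \<Omega>" by simp
    show "(\<lambda>x. green k m x y) \<in> L2 (lebesgue_on M)"
      by (rule L2_nn_integralI(1)[OF col nn[OF y]])
    have "L2_norm (lebesgue_on M) (\<lambda>x. green k m x y) \<le> sqrt (C * V)"
      using L2_nn_integralI(2)[OF col nn[OF y]] C V by simp
    then have "(L2_norm (lebesgue_on M) (\<lambda>x. green k m x y))\<^sup>2 \<le> (sqrt (C * V))\<^sup>2"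
      by (intro power_mono L2_norm_nonneg)
    then show "(L2_norm (lebesgue_on M) (\<lambda>x. green k m x y))\<^sup>2 \<le> C * V"
      using C V by simp
  next
    fix x assume "x \<in> space (lebesgue_on M)"
    then have x: "x \<in> M" by simp
    then have "x \<in> - closure \<Omega>" using M(4) by blast
    \<comment> \<open>Each single point of the open exterior has positive distance from the source
      region, which bounds its row; the distance has no uniform lower bound over
      \<open>M\<close>.\<close>
    then obtain r where r: "r > 0" "ball x r \<subseteq> - closure \<Omega>"
      using open_contains_ball[of "- closure \<Omega>"] by auto
    have "cmod (green k m x y) \<le> sqrt (C / r ^ (CARD('n) - 1))" if y: "y \<in> \<Omega>" for y
    proof (rule real_le_rsqrt)
      have "y \<notin> ball x r" using r(2) y closure_subset by blast
      then have "r \<le> dist x y" by simp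
      then have "C / dist x y ^ (CARD('n) - 1) \<le> C / r ^ (CARD('n) - 1)"
        using C r(1) by (intro divide_left_mono power_mono mult_pos_pos zero_less_power) auto
      then show "(cmod (green k m x y))\<^sup>2 \<le> C / r ^ (CARD('n) - 1)"
        using bound[OF x y] by linarith
    qed
    then show "\<exists>b. \<forall>y\<in>space (lebesgue_on \<Omega>). cmod (green k m x y) \<le> b" by auto
  qed
  then show ?thesis by blast
qed

text \<open>Dominated convergence. Near an interior point \<open>a\<close> of the source region the
  singularity stays away from \<open>M\<close>, so a constant dominates on a region of finite
  measure.\<close>

lemma green_column_tendsto:
  assumes y: "\<And>n. y n \<in> \<Omega>" "y \<longlonglongrightarrow> a" and a: "a \<in> \<Omega>"
  shows "(\<lambda>n. L2_norm (lebesgue_on M) (\<lambda>x. green k m x (y n) - green k m x a)) \<longlonglongrightarrow> 0"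
proof -
  obtain r where r: "r > 0" "ball a r \<subseteq> \<Omega>" using \<Omega>(1) a open_contains_ball by blast
  obtain C where C: "C > 0"
    and green_le: "\<And>x y. x \<in> M \<Longrightarrow> y \<in> \<Omega> \<Longrightarrow> (cmod (green k m x y))\<^sup>2 \<le> C / dist x y ^ (CARD('n) - 1)"
    using green_region_bound by meson
  define B where "B = sqrt (C / (r / 2) ^ (CARD('n) - 1))"
  \<comment> \<open>The ball of radius \<open>r\<close> about \<open>a\<close> lies in the source
    region and misses \<open>M\<close>; halving the radius for \<open>z\<close> leaves a gap of
    \<open>r / 2\<close>.\<close>
  have far: "r / 2 \<le> dist x z" if "x \<in> M" "z \<in> ball a (r / 2)" for x z
  proof (rule ccontr)
    assume "\<not> r / 2 \<le> dist x z"
    then have "x \<in> ball a r"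
      using that(2) dist_triangle[of a x z] by (simp add: dist_commute[of z x])
    then show False using r(2) that(1) M(4) closure_subset by blast
  qed
  have bound: "cmod (green k m x z) \<le> B" if "x \<in> M" "z \<in> ball a (r / 2)" for x z
    unfolding B_def
  proof (rule real_le_rsqrt)
    have "z \<in> \<Omega>" using that(2) r by (auto simp: subset_iff)
    then have "(cmod (green k m x z))\<^sup>2 \<le> C / dist x z ^ (CARD('n) - 1)"
      by (rule green_le[OF that(1)])
    also have "\<dots> \<le> C / (r / 2) ^ (CARD('n) - 1)"
      using C r(1) far[OF that] by (intro divide_left_mono power_mono mult_pos_pos zero_less_power) auto
    finally show "(cmod (green k m x z))\<^sup>2 \<le> C / (r / 2) ^ (CARD('n) - 1)" .
  qed
  obtain G where "source_kernel (lebesgue_on M) (lebesgue_on \<Omega>) (green k m) G"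
    using green_source_kernel by blast
  then interpret source_kernel "lebesgue_on M" "lebesgue_on \<Omega>" "green k m" G .
  have "\<forall>\<^sub>F n in sequentially. y n \<in> ball a (r / 2)"
    using y(2) r(1) by (intro topological_tendstoD) auto
  then obtain n0 where n0: "\<And>n. n \<ge> n0 \<Longrightarrow> y n \<in> ball a (r / 2)"
    unfolding eventually_sequentially by blast
  \<comment> \<open>The shift makes every term, not only eventually every term, lie in the small
    ball, so that the domination holds for all indices.\<close>
  define z where "z n = y (n + n0)" for n
  have z: "z n \<in> ball a (r / 2)" "z n \<in> \<Omega>" for n using n0 y by (auto simp: z_def)
  have z_lim: "z \<longlonglongrightarrow> a" unfolding z_def[abs_def] using y(2) by (rule LIMSEQ_ignore_initial_segment)
  have d: "(\<lambda>x. green k m x (z n) - green k m x a) \<in> L2 (lebesgue_on M)" for n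
    using z(2) a by (intro L2_diff column_L2) auto
  have "(\<lambda>n. LINT x|lebesgue_on M. (cmod (green k m x (z n) - green k m x a))\<^sup>2)
      \<longlonglongrightarrow> (LINT x|lebesgue_on M. 0)"
  proof (rule integral_dominated_convergence)
    show "(\<lambda>x. (cmod (green k m x (z n) - green k m x a))\<^sup>2) \<in> borel_measurable (lebesgue_on M)" for n
      using L2_measurable[OF d] by measurable
    show "integrable (lebesgue_on M) (\<lambda>x. (2 * B)\<^sup>2)" by simp
    show "AE x in lebesgue_on M. (\<lambda>n. (cmod (green k m x (z n) - green k m x a))\<^sup>2) \<longlonglongrightarrow> 0"
    proof (rule AE_I2)
      fix x assume "x \<in> space (lebesgue_on M)"
      then have x: "x \<in> M" by simp
      have "a \<in> ball a (r / 2)" using r(1) by simp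
      from far[OF x this] have "x - a \<noteq> 0" using r(1) by auto
      then have "isCont (\<lambda>w. green k m w 0) (x - a)" by (rule isCont_green[OF k m dim])
      moreover have "(\<lambda>n. x - z n) \<longlonglongrightarrow> x - a" by (intro tendsto_intros z_lim)
      ultimately have "(\<lambda>n. green k m (x - z n) 0) \<longlonglongrightarrow> green k m (x - a) 0"
        by (rule isCont_tendsto_compose)
      then have "(\<lambda>n. green k m x (z n)) \<longlonglongrightarrow> green k m x a"
        by (simp only: green_diff[of k m x "z _"] green_diff[of k m x a])
      then have "(\<lambda>n. (cmod (green k m x (z n) - green k m x a))\<^sup>2) \<longlonglongrightarrow> (cmod (green k m x a - green k m x a))\<^sup>2"
        by (intro tendsto_intros)
      then show "(\<lambda>n. (cmod (green k m x (z n) - green k m x a))\<^sup>2) \<longlonglongrightarrow> 0" by simp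
    qed
    show "AE x in lebesgue_on M. norm ((cmod (green k m x (z n) - green k m x a))\<^sup>2) \<le> (2 * B)\<^sup>2" for n
    proof (rule AE_I2)
      fix x assume "x \<in> space (lebesgue_on M)"
      then have x: "x \<in> M" by simp
      have "cmod (green k m x (z n) - green k m x a) \<le> 2 * B"
        using norm_triangle_ineq4[of "green k m x (z n)" "green k m x a"] bound[OF x z(1)[of n]] bound[OF x, of a] r(1)
        by simp
      then have "(cmod (green k m x (z n) - green k m x a))\<^sup>2 \<le> (2 * B)\<^sup>2"
        by (intro power_mono) auto
      then show "norm ((cmod (green k m x (z n) - green k m x a))\<^sup>2) \<le> (2 * B)\<^sup>2" by simp
    qed
  qed simp
  then have "(\<lambda>n. sqrt ((L2_norm (lebesgue_on M) (\<lambda>x. green k m x (z n) - green k m x a))\<^sup>2)) \<longlonglongrightarrow> sqrt 0"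
    unfolding L2_norm_square by (intro tendsto_real_sqrt) simp
  then have "(\<lambda>n. L2_norm (lebesgue_on M) (\<lambda>x. green k m x (y (n + n0)) - green k m x a)) \<longlonglongrightarrow> 0"
    by (simp add: L2_norm_nonneg z_def)
  then show ?thesis by (rule LIMSEQ_offset)
qed

text \<open>A null column would vanish on all of \<open>M\<close> by continuity, contrary to
  \<open>green_not_zero_on_open\<close>.\<close>

lemma green_column_norm_pos:
  assumes y: "y \<in> \<Omega>"
  shows "L2_norm (lebesgue_on M) (\<lambda>x. green k m x y) > 0"
proof (rule ccontr)
  assume "\<not> ?thesis"
  then have zero: "L2_norm (lebesgue_on M) (\<lambda>x. green k m x y) = 0"
    using L2_norm_nonneg[of "lebesgue_on M" "\<lambda>x. green k m x y"] by simp
  obtain G where "source_kernel (lebesgue_on M) (lebesgue_on \<Omega>) (green k m) G"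
    using green_source_kernel by blast
  then interpret source_kernel "lebesgue_on M" "lebesgue_on \<Omega>" "green k m" G .
  have ae: "AE x in lebesgue_on M. green k m x y = 0"
    using L2_norm_eq_0_iff[OF column_L2, of y] zero y by simp
  have yM: "y \<notin> M" using y M(4) closure_subset by blast
  have "continuous_on M (\<lambda>x. green k m x y)"
  proof (intro continuous_at_imp_continuous_on ballI)
    fix x assume "x \<in> M"
    then have "x - y \<noteq> 0" using yM by auto
    then have "isCont (\<lambda>w. green k m w 0) (x - y)" by (rule isCont_green[OF k m dim])
    moreover have "isCont (\<lambda>x. x - y) x" by (intro continuous_intros)
    ultimately have "isCont (\<lambda>x. green k m (x - y) 0) x" using isCont_o2 by blast
    moreover have "(\<lambda>x. green k m x y) = (\<lambda>x. green k m (x - y) 0)"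
      by (intro ext green_diff)
    ultimately show "isCont (\<lambda>x. green k m x y) x" by (simp only:)
  qed
  then have "green k m x y = 0" if "x \<in> M" for x
    using continuous_AE_zero[OF M(1) _ ae that] by blast
  then show False using green_not_zero_on_open[OF k m dim M(1,3) yM] by blast
qed

end

theorem proposition4p3:
  fixes \<Omega> M :: "(real^'n) set" and k :: real and m :: "real^'n"
    and Cobs :: "(real^'n) operator" and q :: "real^'n \<Rightarrow> complex"
  assumes "CARD('n) = 2 \<or> CARD('n) = 3"
    and "open \<Omega>" "connected \<Omega>" "bounded \<Omega>" "0 \<in> \<Omega>" "connected (- closure \<Omega>)"
    and "open M" "connected M" "bounded M" "M \<noteq> {}" "M \<subseteq> - closure \<Omega>"
    and "k > 0" "norm m < 1"
    and "Cobs \<in> HS (lebesgue_on M)" "self_adjoint (lebesgue_on M) Cobs"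
    and "q \<in> L2 (lebesgue_on \<Omega>)"
  shows "((\<forall>y\<in>\<Omega>. of_real (beamforming k m M Cobs y)
              = (LINT y'|lebesgue_on \<Omega>. psf k m M y y' * q y'))
          \<longleftrightarrow> (AE y in lebesgue_on \<Omega>. forward_adjoint k m \<Omega> M (forward k m \<Omega> M q) y
                                     = forward_adjoint k m \<Omega> M Cobs y))
       \<and> ((AE y in lebesgue_on \<Omega>. forward_adjoint k m \<Omega> M (forward k m \<Omega> M q) y
                                  = forward_adjoint k m \<Omega> M Cobs y)
          \<longleftrightarrow> is_arg_min (\<lambda>q'. (HS_norm (lebesgue_on M)
                                  (\<lambda>\<phi> x. forward k m \<Omega> M q' \<phi> x - Cobs \<phi> x))\<^sup>2)
                (\<lambda>q'. q' \<in> L2 (lebesgue_on \<Omega>)) q)"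
proof -
  note dim = assms(1) and \<Omega> = assms(2,4) and M = assms(7,9,10,11) and k = assms(12) and m = assms(13)
  note C = assms(14,15) and q = assms(16)
  obtain G where "source_kernel (lebesgue_on M) (lebesgue_on \<Omega>) (green k m) G"
    using green_source_kernel[OF k m dim \<Omega> M] by blast
  then interpret source_kernel "lebesgue_on M" "lebesgue_on \<Omega>" "green k m" G .
  have C': "has_adjoint (lebesgue_on M) Cobs"
    using C by (intro self_adjoint_has_adjoint HS_operator)
  have forward: "forward k m \<Omega> M = source"
    by (simp add: fun_eq_iff forward_def forward_kernel_def source_def)
  have monopole: "monopole k m M y = rank_one (lebesgue_on M) (\<lambda>x. green k m x y)" for y
  proof (intro ext)
    fix \<phi> x
    have "monopole k m M y \<phi> x
        = (LINT z|lebesgue_on M. green k m x y * (\<phi> z * cnj (green k m z y)))"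
      unfolding monopole_def by (simp only: mult_ac)
    then show "monopole k m M y \<phi> x = rank_one (lebesgue_on M) (\<lambda>x. green k m x y) \<phi> x"
      by (simp add: rank_one_def L2_inner_def mult.commute)
  qed
  \<comment> \<open>Only an almost everywhere statement is possible here, since
    \<open>forward_adjoint\<close> chooses some representative.\<close>
  have adj: "AE y in lebesgue_on \<Omega>. forward_adjoint k m \<Omega> M K y = beam K y"
    if "K \<in> HS (lebesgue_on M)" "has_adjoint (lebesgue_on M) K" for K
    using that by (rule source_adjoint_eq_beam) (simp add: forward_adjoint_def forward)
  have normal: "(AE y in lebesgue_on \<Omega>. forward_adjoint k m \<Omega> M (forward k m \<Omega> M q) y
      = forward_adjoint k m \<Omega> M Cobs y)
    \<longleftrightarrow> (AE y in lebesgue_on \<Omega>. beam (source q) y = beam Cobs y)" (is "?N \<longleftrightarrow> ?B")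
  proof
    show ?B if ?N
      using that adj[OF source_HS[OF q] source_has_adjoint[OF q]] adj[OF C(1) C']
      unfolding forward by eventually_elim simp
    show ?N if ?B
      using that adj[OF source_HS[OF q] source_has_adjoint[OF q]] adj[OF C(1) C']
      unfolding forward by eventually_elim simp
  qed
  \<comment> \<open>Both sides carry the same nonzero denominator, so this equivalence holds at each
    point separately.\<close>
  have damas: "of_real (beamforming k m M Cobs y) = (LINT y'|lebesgue_on \<Omega>. psf k m M y y' * q y')
      \<longleftrightarrow> beam (source q) y = beam Cobs y" if y: "y \<in> \<Omega>" for y
  proof -
    have pos: "L2_norm (lebesgue_on M) (\<lambda>x. green k m x y) > 0"
      by (rule green_column_norm_pos[OF k m dim \<Omega> M y])
    have y': "y \<in> space (lebesgue_on \<Omega>)" using y by simp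
    have bf: "of_real (beamforming k m M Cobs y)
        = beam Cobs y / of_real (L2_norm (lebesgue_on M) (\<lambda>x. green k m x y) ^ 4)"
      unfolding beamforming_def monopole by (rule beamforming_eq_beam[OF C y' pos])
    have ps: "(LINT y'|lebesgue_on \<Omega>. psf k m M y y' * q y')
        = beam (source q) y / of_real (L2_norm (lebesgue_on M) (\<lambda>x. green k m x y) ^ 4)"
      unfolding psf_def monopole by (rule integral_psf_eq_beam[OF q y'])
    have cancel: "a / c = b / c \<longleftrightarrow> b = a" if "c \<noteq> 0" for a b c :: complex
      using that by auto
    show ?thesis unfolding bf ps by (rule cancel) (use pos in simp)
  qed
  \<comment> \<open>\<open>beam_lipschitz\<close> transfers the sequential convergence of the
    columns to \<open>beam K\<close>.\<close>
  have cont: "continuous_on \<Omega> (beam K)" if K: "L2_operator (lebesgue_on M) K" for K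
  proof (rule continuous_on_sequentiallyI)
    fix u a assume u: "\<forall>n. u n \<in> \<Omega>" and a: "a \<in> \<Omega>" and lim: "u \<longlonglongrightarrow> a"
    obtain b where b: "b \<ge> 0"
      "\<And>f. f \<in> L2 (lebesgue_on M) \<Longrightarrow> L2_norm (lebesgue_on M) (K f) \<le> b * L2_norm (lebesgue_on M) f"
      using L2_operator_bounded[OF K] by blast
    have "(\<lambda>n. beam K (u n) - beam K a) \<longlonglongrightarrow> 0"
    proof (rule Lim_null_comparison)
      show "\<forall>\<^sub>F n in sequentially. norm (beam K (u n) - beam K a)
          \<le> 2 * b * sqrt G * L2_norm (lebesgue_on M) (\<lambda>x. green k m x (u n) - green k m x a)"
        using u a by (intro always_eventually allI beam_lipschitz[OF K b(2,1)]) auto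
      show "(\<lambda>n. 2 * b * sqrt G * L2_norm (lebesgue_on M) (\<lambda>x. green k m x (u n) - green k m x a)) \<longlonglongrightarrow> 0"
        using u green_column_tendsto[OF k m dim \<Omega> M _ lim a] by (intro tendsto_mult_right_zero) auto
    qed
    then show "(\<lambda>n. beam K (u n)) \<longlonglongrightarrow> beam K a" by (subst Lim_null)
  qed
  have everywhere: "(\<forall>y\<in>\<Omega>. beam (source q) y = beam Cobs y)
      \<longleftrightarrow> (AE y in lebesgue_on \<Omega>. beam (source q) y = beam Cobs y)"
  proof
    assume ae: "AE y in lebesgue_on \<Omega>. beam (source q) y = beam Cobs y"
    have c: "continuous_on \<Omega> (\<lambda>y. beam (source q) y - beam Cobs y)"
      by (rule continuous_on_diff[OF cont[OF source_operator[OF q]] cont[OF HS_operator[OF C(1)]]])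
    have z: "AE y in lebesgue_on \<Omega>. beam (source q) y - beam Cobs y = 0"
      using ae by eventually_elim simp
    show "\<forall>y\<in>\<Omega>. beam (source q) y = beam Cobs y"
    proof
      fix y assume "y \<in> \<Omega>"
      from continuous_AE_zero[OF \<Omega>(1) c z this] show "beam (source q) y = beam Cobs y" by simp
    qed
  next
    assume "\<forall>y\<in>\<Omega>. beam (source q) y = beam Cobs y"
    then show "AE y in lebesgue_on \<Omega>. beam (source q) y = beam Cobs y" by (intro AE_I2) simp
  qed
  have "(\<forall>y\<in>\<Omega>. of_real (beamforming k m M Cobs y) = (LINT y'|lebesgue_on \<Omega>. psf k m M y y' * q y'))
      \<longleftrightarrow> (\<forall>y\<in>\<Omega>. beam (source q) y = beam Cobs y)"
    by (rule ball_cong[OF refl damas])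
  also note everywhere
  also note normal[symmetric]
  finally have equivalence: "(\<forall>y\<in>\<Omega>. of_real (beamforming k m M Cobs y)
        = (LINT y'|lebesgue_on \<Omega>. psf k m M y y' * q y')) \<longleftrightarrow> ?N" .
  have least_squares: "?N \<longleftrightarrow> is_arg_min (\<lambda>q'. (HS_norm (lebesgue_on M)
      (\<lambda>\<phi> x. forward k m \<Omega> M q' \<phi> x - Cobs \<phi> x))\<^sup>2) (\<lambda>q'. q' \<in> L2 (lebesgue_on \<Omega>)) q"
    unfolding normal unfolding forward by (rule normal_equation_iff_arg_min[OF q C(1) C'])
  show ?thesis
    by (rule conjI[OF equivalence least_squares])
qed

end
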